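(* Let $\alpha\in(-1,\infty)$ with $\alpha\neq 0$, let $1\le p\le\infty$, and let $f=\mathcal{P}_\alpha[F]$, where $F:\mathbb{U}\to\mathbb{C}$ is absolutely continuous with $\dot F\in L^p(\mathbb{U})$. (1) If $\alpha>0$, then $\overline{\partial} f$ and $\partial f$ are in $\mathcal{H}^p_{\mathcal{G}}(\mathbb{D})\subset L^p(\mathbb{D})$. (2) If $\alpha\in(-1,0)$, then $\partial f$ and $\overline{\partial} f$ are in $L^p(\mathbb{D})$ for $p<-\frac1\alpha$. (3) For $\alpha\in(-1,0)$ and $p\ge-\frac1\alpha$ there exists an $\alpha$-harmonic function $f$ on $\mathbb{D}$ such that $\partial f\notin L^p(\mathbb{D})$ and $\overline{\partial} f\notin L^p(\mathbb{D})$; moreover, $\partial f\notin\mathcal{H}^1_{\mathcal{G}}(\mathbb{D})$ and $\overline{\partial} f\notin \mathcal{H}^1_{\mathcal{G}}(\mathbb{D})$.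
   Context: $\mathbb{D}$ is the open unit disk in $\mathbb{C}$ and $\mathbb{U}=\partial\mathbb{D}$ the unit circle. For $z=x+iy$, $\partial f=f_z=\frac12(f_x-if_y)$ and $\overline{\partial}f=f_{\bar z}=\frac12(f_x+if_y)$. For $\alpha>-1$, a function $f\in C^2(\mathbb{D})$ (complex-valued) is $\alpha$-harmonic if $\partial_z\big((1-|z|^2)^{-\alpha}\,\overline{\partial}_z f\big)=0$ in $\mathbb{D}$. The $\alpha$-harmonic Poisson kernel is $P_\alpha(z)=\frac{(1-|z|^2)^{\alpha+1}}{(1-z)(1-\bar z)^{\alpha+1}}$ (principal branch of the power), and $\mathcal{P}_\alpha[F](z)=\frac1{2\pi}\int_0^{2\pi}P_\alpha(ze^{-i\theta})F(e^{i\theta})\,d\theta$, $z\in\mathbb{D}$. $F$ absolutely continuous on $\mathbb{U}$ means that $\theta\mapsto F(e^{i\theta})$ is absolutely continuous on $[0,2\pi]$; then $\dot F(e^{i\theta})=\frac{d}{d\theta}F(e^{i\theta})$ exists for almost every $\theta$. $L^p(\mathbb{U})$ is the usual Lebesgue space on the circle (with respect to $d\theta/2\pi$; essentially bounded functions for $p=\infty$), and $L^p(\mathbb{D})$ is the Lebesgue space with respect to area measure. For $p\in(0,\infty]$, the generalized Hardy space $\mathcal{H}^p_{\mathcal{G}}(\mathbb{D})$ consists of all measurable $f:\mathbb{D}\to\mathbb{C}$ such that $M_p(r,f)$ exists for all $r\in(0,1)$ and $\|f\|_p<\infty$, where for $p<\infty$, $M_p(r,f)=\left(\frac1{2\pi}\int_0^{2\pi}|f(re^{i\theta})|^p\,d\theta\right)^{1/p}$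 and $\|f\|_p=\sup_{0<r<1}M_p(r,f)$, and $\|f\|_\infty=\sup_{z\in\mathbb{D}}|f(z)|$. *)

theory Defs
  imports "HOL-Analysis.Analysis"
begin

text \<open>
  Functions on the open unit disk \<open>ball 0 1\<close> and on the unit circle are total functions
  \<open>complex \<Rightarrow> complex\<close>; only their values on the disk, respectively the circle, are used.
\<close>

definition dx :: "(complex \<Rightarrow> complex) \<Rightarrow> complex \<Rightarrow> complex" where
  "dx f z = vector_derivative (\<lambda>t::real. f (z + of_real t)) (at 0)"

definition dy :: "(complex \<Rightarrow> complex) \<Rightarrow> complex \<Rightarrow> complex" where
  "dy f z = vector_derivative (\<lambda>t::real. f (z + \<i> * of_real t)) (at 0)"

definition dz :: "(complex \<Rightarrow> complex) \<Rightarrow> complex \<Rightarrow> complex" where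
  "dz f z = (dx f z - \<i> * dy f z) / 2"

definition dzbar :: "(complex \<Rightarrow> complex) \<Rightarrow> complex \<Rightarrow> complex" where
  "dzbar f z = (dx f z + \<i> * dy f z) / 2"

definition C1_on :: "complex set \<Rightarrow> (complex \<Rightarrow> complex) \<Rightarrow> bool" where
  "C1_on S f \<longleftrightarrow>
     (\<forall>z\<in>S. (\<lambda>t::real. f (z + of_real t)) differentiable (at 0) \<and>
            (\<lambda>t::real. f (z + \<i> * of_real t)) differentiable (at 0)) \<and>
     continuous_on S (dx f) \<and> continuous_on S (dy f)"

definition C2_on :: "complex set \<Rightarrow> (complex \<Rightarrow> complex) \<Rightarrow> bool" where
  "C2_on S f \<longleftrightarrow> C1_on S f \<and> C1_on S (dx f) \<and> C1_on S (dy f)"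

definition alpha_harmonic :: "real \<Rightarrow> (complex \<Rightarrow> complex) \<Rightarrow> bool" where
  "alpha_harmonic \<alpha> f \<longleftrightarrow>
     C2_on (ball 0 1) f \<and>
     (\<forall>z\<in>ball 0 1. dz (\<lambda>w. of_real ((1 - (cmod w)\<^sup>2) powr (- \<alpha>)) * dzbar f w) z = 0)"

definition alpha_poisson_kernel :: "real \<Rightarrow> complex \<Rightarrow> complex" where
  "alpha_poisson_kernel \<alpha> z =
     of_real ((1 - (cmod z)\<^sup>2) powr (\<alpha> + 1)) /
     ((1 - z) * (1 - cnj z) powr (of_real (\<alpha> + 1)))"

definition alpha_poisson :: "real \<Rightarrow> (complex \<Rightarrow> complex) \<Rightarrow> complex \<Rightarrow> complex" where
  "alpha_poisson \<alpha> F z =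
     of_real (1 / (2 * pi)) *
     (LINT \<theta>|lebesgue_on {0..2*pi}. alpha_poisson_kernel \<alpha> (z * cis (- \<theta>)) * F (cis \<theta>))"

definition absolutely_continuous_on_interval ::
    "real \<Rightarrow> real \<Rightarrow> (real \<Rightarrow> complex) \<Rightarrow> bool" where
  "absolutely_continuous_on_interval a b g \<longleftrightarrow>
     (\<forall>\<epsilon>>0. \<exists>\<delta>>0. \<forall>(n::nat) (u::nat \<Rightarrow> real) v.
        (\<forall>i<n. a \<le> u i \<and> u i < v i \<and> v i \<le> b) \<longrightarrow>
        disjoint_family_on (\<lambda>i. {u i<..<v i}) {..<n} \<longrightarrow>
        (\<Sum>i<n. v i - u i) < \<delta> \<longrightarrow>
        (\<Sum>i<n. cmod (g (v i) - g (u i))) < \<epsilon>)"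

definition absolutely_continuous_on_circle :: "(complex \<Rightarrow> complex) \<Rightarrow> bool" where
  "absolutely_continuous_on_circle F \<longleftrightarrow>
     absolutely_continuous_on_interval 0 (2 * pi) (\<lambda>\<theta>. F (cis \<theta>))"

text \<open>
  The exponent ranges over \<open>{0<..\<infinity>}\<close>. Membership concerns representatives, so \<open>M\<close> should be a
  complete measure: modifying a function on a null set then does not affect it.
\<close>

definition Lp_space :: "ennreal \<Rightarrow> 'a measure \<Rightarrow> ('a \<Rightarrow> complex) set" where
  "Lp_space p M =
     {f \<in> borel_measurable M.
        if p = \<infinity> then \<exists>C. AE x in M. cmod (f x) \<le> C
        else integrable M (\<lambda>x. cmod (f x) powr enn2real p)}"

definition Lp_disk :: "ennreal \<Rightarrow> (complex \<Rightarrow> complex) set" where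
  "Lp_disk p = Lp_space p (lebesgue_on (ball 0 1))"

text \<open>
  A function on the circle is represented by its pullback along \<open>cis\<close> to \<open>{0..2*pi}\<close>.
  The normalizing factor \<open>1 / (2*pi)\<close> of the measure does not affect membership in \<open>L\<^sup>p\<close>.
\<close>

definition Lp_circle :: "ennreal \<Rightarrow> (real \<Rightarrow> complex) set" where
  "Lp_circle p = Lp_space p (lebesgue_on {0..2*pi})"

text \<open>
  The derivative as a function of the angle. Where it does not exist the value is unspecified;
  for absolutely continuous \<open>F\<close> this is a null set.
\<close>

definition circle_deriv :: "(complex \<Rightarrow> complex) \<Rightarrow> real \<Rightarrow> complex" where
  "circle_deriv F \<theta> = vector_derivative (\<lambda>t. F (cis t)) (at \<theta>)"

definition integral_mean_exists :: "real \<Rightarrow> real \<Rightarrow> (complex \<Rightarrow> complex) \<Rightarrow> bool" where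
  "integral_mean_exists p r f \<longleftrightarrow>
     integrable (lebesgue_on {0..2*pi}) (\<lambda>\<theta>. cmod (f (of_real r * cis \<theta>)) powr p)"

definition integral_mean :: "real \<Rightarrow> real \<Rightarrow> (complex \<Rightarrow> complex) \<Rightarrow> real" where
  "integral_mean p r f =
     (1 / (2 * pi) * (LINT \<theta>|lebesgue_on {0..2*pi}. cmod (f (of_real r * cis \<theta>)) powr p))
       powr (1 / p)"

definition hardy_norm :: "ennreal \<Rightarrow> (complex \<Rightarrow> complex) \<Rightarrow> ereal" where
  "hardy_norm p f =
     (if p = \<infinity> then (SUP z\<in>ball 0 1. ereal (cmod (f z)))
      else (SUP r\<in>{0<..<1}. ereal (integral_mean (enn2real p) r f)))"

definition hardy_space :: "ennreal \<Rightarrow> (complex \<Rightarrow> complex) set" where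
  "hardy_space p =
     {f \<in> borel_measurable (lebesgue_on (ball 0 1)).
        (p \<noteq> \<infinity> \<longrightarrow> (\<forall>r\<in>{0<..<1}. integral_mean_exists (enn2real p) r f)) \<and>
        hardy_norm p f < \<infinity>}"

end

theory Submission
  imports Defs
begin

text \<open>
  Write \<open>f\<close> for the Poisson integral of \<open>F\<close>, \<open>h\<close> for the angular derivative of \<open>F\<close>, and
  \<open>\<beta> = \<alpha> + 1\<close>. The kernel satisfies \<open>dzbar K(z) = \<beta> (1 - |z|\<^sup>2)\<^sup>\<alpha> (1 - cnj z) powr (- \<beta> - 1)\<close>.
  Along a circle the second power is, up to the factor \<open>cnj z\<close>, the angular derivative of
  \<open>(1 - cnj z) powr (- \<beta>)\<close>, so one integration by parts turns \<open>cnj z * dzbar f(z)\<close> into an integral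
  of \<open>h\<close> against a kernel of modulus \<open>(1 - |z|\<^sup>2)\<^sup>\<alpha> |1 - z e\<^sup>-\<^sup>i\<^sup>\<theta>| powr (- \<beta>)\<close>. Moreover
  \<open>z * dz f - cnj z * dzbar f\<close> is, up to \<open>\<i>\<close>, the angular derivative of \<open>f\<close>, which is the Poisson
  integral of \<open>h\<close>, and \<open>|K|\<close> is at most twice the same kernel. Hence both derivatives of \<open>f\<close> are
  dominated by one convolution (\<open>alpha_poisson_derivs_bound\<close>). Near the origin, where the factor
  \<open>z\<close> carries no information, they are bounded by compactness.

  The mass of this kernel on the circle of radius \<open>r\<close> is of order \<open>(1 - r\<^sup>2) powr min \<alpha> 0\<close>
  (\<open>circle_kernel_mass_bound\<close>): bounded for \<open>\<alpha> > 0\<close>, and \<open>(1 - r\<^sup>2)\<^sup>\<alpha>\<close> for \<open>\<alpha> < 0\<close>. By Young's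
  inequality (\<open>kernel_mean_circle_bound\<close>) the \<open>p\<close>-th power means of the derivatives have the
  corresponding growth. For \<open>\<alpha> > 0\<close> this is membership in the Hardy space; for \<open>\<alpha> < 0\<close> the area
  integral is at most a constant times \<open>\<integral> t powr (\<alpha> p)\<close> over \<open>{0<..1}\<close>, which converges exactly when
  \<open>p < - 1 / \<alpha>\<close>.

  For the last part the kernel itself serves as \<open>f\<close>. It is \<open>\<alpha>\<close>-harmonic, and for \<open>\<alpha> < 0\<close> the
  moduli of both its derivatives are at least a constant times \<open>(1 - |z|\<^sup>2)\<^sup>\<alpha>\<close>; the mean of
  this bound over a circle is unbounded as \<open>r\<close> tends to \<open>1\<close>, and the area integral of its \<open>p\<close>-th
  power diverges for \<open>p \<ge> - 1 / \<alpha>\<close>.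

  Integration by parts for an absolutely continuous \<open>F\<close> rests on Lebesgue's theorem that \<open>F\<close> is
  differentiable almost everywhere, which is obtained from the Vitali covering theorem by an argument of
  Austin (\<open>negligible_slopes_both_signs\<close>), and on a direct gauge argument for the fundamental theorem
  of calculus (\<open>absolutely_continuous_FTC\<close>). Polar coordinates are replaced by averaging over
  rotations (\<open>nn_integral_disk_le_circle_means\<close>) together with the fact that \<open>1 - |z|\<^sup>2\<close> is uniformly
  distributed under area measure on the disk (\<open>nn_integral_disk_radial\<close>).
\<close>

section \<open>Absolutely continuous functions are differentiable almost everywhere\<close>

abbreviation (input) nonoverlapping :: "real \<times> real \<Rightarrow> real \<times> real \<Rightarrow> bool" where
  "nonoverlapping I J \<equiv> disjnt {fst I<..<snd I} {fst J<..<snd J}"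

abbreviation (input) apart :: "real \<times> real \<Rightarrow> real \<times> real \<Rightarrow> bool" where
  "apart I J \<equiv> disjnt {fst I..snd I} {fst J..snd J}"

text \<open>
  A pair stands for the interval between its components. Only interiors have to be disjoint, so the
  pieces of a partition form such a family.
\<close>

definition disjoint_intervals :: "real \<Rightarrow> real \<Rightarrow> (real \<times> real) set \<Rightarrow> bool" where
  "disjoint_intervals c d D \<longleftrightarrow> finite D \<and> (\<forall>I\<in>D. c \<le> fst I \<and> fst I < snd I \<and> snd I \<le> d) \<and>
     pairwise (\<lambda>I J. nonoverlapping I J) D"

definition variation_sum :: "(real \<Rightarrow> real) \<Rightarrow> (real \<times> real) set \<Rightarrow> real" where
  "variation_sum g D = (\<Sum>I\<in>D. \<bar>g (snd I) - g (fst I)\<bar>)"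

definition finite_variation :: "(real \<Rightarrow> real) \<Rightarrow> real \<Rightarrow> real \<Rightarrow> bool" where
  "finite_variation g c d \<longleftrightarrow> bdd_above (variation_sum g ` Collect (disjoint_intervals c d))"

text \<open>
  The supremum runs over families that need not cover the interval. The union of families in two adjacent
  intervals is again such a family, which gives superadditivity without common refinements.
\<close>

definition total_variation :: "(real \<Rightarrow> real) \<Rightarrow> real \<Rightarrow> real \<Rightarrow> real" where
  "total_variation g c d = (SUP D\<in>Collect (disjoint_intervals c d). variation_sum g D)"

lemma disjoint_intervals_empty [simp]: "disjoint_intervals c d {}"
  by (simp add: disjoint_intervals_def)

lemma disjoint_intervals_mono:
  "disjoint_intervals u v D \<Longrightarrow> c \<le> u \<Longrightarrow> v \<le> d \<Longrightarrow> disjoint_intervals c d D"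
  unfolding disjoint_intervals_def by (meson order_trans)

lemma open_intervals_disjnt_iff:
  fixes a b c d :: real
  assumes "a < b" "c < d"
  shows "disjnt {a<..<b} {c<..<d} \<longleftrightarrow> b \<le> c \<or> d \<le> a"
proof
  assume *: "disjnt {a<..<b} {c<..<d}"
  show "b \<le> c \<or> d \<le> a"
  proof (rule ccontr)
    assume "\<not> (b \<le> c \<or> d \<le> a)"
    then have "max a c < min b d" using assms by auto
    then obtain x where "max a c < x" "x < min b d" using dense by blast
    then show False using * by (auto simp: disjnt_iff)
  qed
qed (auto simp: disjnt_iff)

text \<open>
  The induction removes the rightmost interval of the family; nonnegativity pays for the gaps. The lemma
  is applied to the length, to the total variation, and to the excess of the variation over an increment.
\<close>

lemma sum_superadditive_le:
  fixes W :: "real \<Rightarrow> real \<Rightarrow> real"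
  assumes super: "\<And>u v w. c \<le> u \<Longrightarrow> u \<le> v \<Longrightarrow> v \<le> w \<Longrightarrow> w \<le> d \<Longrightarrow> W u v + W v w \<le> W u w"
    and nonneg: "\<And>u v. c \<le> u \<Longrightarrow> u \<le> v \<Longrightarrow> v \<le> d \<Longrightarrow> 0 \<le> W u v"
    and D: "disjoint_intervals c d D" and cd: "c \<le> d"
  shows "(\<Sum>I\<in>D. W (fst I) (snd I)) \<le> W c d"
proof -
  have "(\<Sum>I\<in>D. W (fst I) (snd I)) \<le> W c e"
    if "card D = n" "disjoint_intervals c e D" "c \<le> e" "e \<le> d" for n e D
    using that
  proof (induction n arbitrary: D e)
    case 0
    then have "D = {}" by (simp add: disjoint_intervals_def)
    then show ?case using nonneg 0 by simp
  next
    case (Suc n)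
    have fin: "finite D" and ne: "D \<noteq> {}" using Suc.prems by (auto simp: disjoint_intervals_def)
    have "Max (snd ` D) \<in> snd ` D" using fin ne by (intro Max_in) auto
    then obtain J where J: "J \<in> D" and "snd J = Max (snd ` D)" by auto
    then have J: "J \<in> D" "\<And>I. I \<in> D \<Longrightarrow> snd I \<le> snd J" using fin by auto
    have bnd: "c \<le> fst J" "fst J < snd J" "snd J \<le> e"
      using J(1) Suc.prems(2) by (auto simp: disjoint_intervals_def)
    have dis: "disjoint_intervals c (fst J) (D - {J})"
      unfolding disjoint_intervals_def
    proof (intro conjI ballI)
      show "finite (D - {J})" using fin by simp
      show "pairwise (\<lambda>I J. nonoverlapping I J) (D - {J})"
        using Suc.prems(2) by (auto simp: disjoint_intervals_def intro: pairwise_subset)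
      fix I assume I: "I \<in> D - {J}"
      then have I': "c \<le> fst I" "fst I < snd I" "nonoverlapping I J" "snd I \<le> snd J"
        using Suc.prems(2) J by (auto simp: disjoint_intervals_def pairwise_def)
      then show "c \<le> fst I" "fst I < snd I" by auto
      show "snd I \<le> fst J"
        using I' bnd by (auto simp: open_intervals_disjnt_iff)
    qed
    have "(\<Sum>I\<in>D. W (fst I) (snd I)) = W (fst J) (snd J) + (\<Sum>I\<in>D - {J}. W (fst I) (snd I))"
      using fin J(1) by (simp add: sum.remove)
    also have "\<dots> \<le> W (fst J) (snd J) + W c (fst J)"
      using Suc.IH[OF _ dis] bnd J Suc.prems fin by simp
    also have "\<dots> \<le> W c (snd J)" using super[of c "fst J" "snd J"] bnd Suc.prems by simp
    also have "\<dots> \<le> W c e"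
      using super[of c "snd J" e] nonneg[of "snd J" e] bnd Suc.prems by simp
    finally show ?case .
  qed
  then show ?thesis using D cd by blast
qed

lemma finite_variation_mono:
  "finite_variation g c d \<Longrightarrow> c \<le> u \<Longrightarrow> v \<le> d \<Longrightarrow> finite_variation g u v"
  unfolding finite_variation_def
  by (rule bdd_above_mono) (auto intro: disjoint_intervals_mono)

lemma variation_sum_le_total:
  "finite_variation g c d \<Longrightarrow> disjoint_intervals c d D \<Longrightarrow> variation_sum g D \<le> total_variation g c d"
  unfolding finite_variation_def total_variation_def by (rule cSUP_upper) auto

lemma total_variation_nonneg:
  "finite_variation g c d \<Longrightarrow> 0 \<le> total_variation g c d"
  using variation_sum_le_total[of g c d "{}"] by (simp add: variation_sum_def)

lemma abs_diff_le_total_variation: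
  assumes "finite_variation g c d" "c \<le> d"
  shows "\<bar>g d - g c\<bar> \<le> total_variation g c d"
proof (cases "c = d")
  case True
  then show ?thesis using total_variation_nonneg assms by simp
next
  case False
  then have "disjoint_intervals c d {(c,d)}" using assms by (simp add: disjoint_intervals_def)
  from variation_sum_le_total[OF assms(1) this] show ?thesis by (simp add: variation_sum_def)
qed

lemma total_variation_superadditive:
  assumes fv: "finite_variation g u w" and uv: "u \<le> v" "v \<le> w"
  shows "total_variation g u v + total_variation g v w \<le> total_variation g u w"
proof -
  have *: "variation_sum g D1 + variation_sum g D2 \<le> total_variation g u w"
    if 1: "disjoint_intervals u v D1" and 2: "disjoint_intervals v w D2" for D1 D2
  proof -
    have fin: "finite D1" "finite D2" using that by (auto simp: disjoint_intervals_def)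
    have int: "D1 \<inter> D2 = {}" using 1 2 unfolding disjoint_intervals_def by fastforce
    have D1: "u \<le> fst I \<and> fst I < snd I \<and> snd I \<le> v" if "I \<in> D1" for I
      using 1 that by (auto simp: disjoint_intervals_def)
    have D2: "v \<le> fst I \<and> fst I < snd I \<and> snd I \<le> w" if "I \<in> D2" for I
      using 2 that by (auto simp: disjoint_intervals_def)
    have p12: "pairwise (\<lambda>I J. nonoverlapping I J) D1"
      "pairwise (\<lambda>I J. nonoverlapping I J) D2"
      using 1 2 by (auto simp: disjoint_intervals_def)
    have cross: "nonoverlapping I J" if "I \<in> D1" "J \<in> D2" for I J
      using D1[OF that(1)] D2[OF that(2)] by (auto simp: disjnt_iff)
    have "disjoint_intervals u w (D1 \<union> D2)"
      unfolding disjoint_intervals_def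
    proof (intro conjI ballI)
      show "pairwise (\<lambda>I J. nonoverlapping I J) (D1 \<union> D2)"
        using p12 cross unfolding pairwise_def by (metis Un_iff disjnt_sym)
    next
      fix I assume "I \<in> D1 \<union> D2"
      then consider "I \<in> D1" | "I \<in> D2" by blast
      then have "u \<le> fst I \<and> fst I < snd I \<and> snd I \<le> w"
        by cases (use D1[of I] D2[of I] uv in linarith)+
      then show "u \<le> fst I" "fst I < snd I" "snd I \<le> w" by simp_all
    qed (use fin in auto)
    from variation_sum_le_total[OF fv this] show ?thesis
      by (simp add: variation_sum_def sum.union_disjoint fin int)
  qed
  have ne: "Collect (disjoint_intervals a b) \<noteq> {}" for a b
    using disjoint_intervals_empty by blast
  have "total_variation g u v \<le> total_variation g u w - variation_sum g D2"
    if "disjoint_intervals v w D2" for D2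
  proof -
    have "(SUP D\<in>Collect (disjoint_intervals u v). variation_sum g D) \<le> total_variation g u w - variation_sum g D2"
      using ne by (rule cSUP_least) (use *[OF _ that] in \<open>simp add: le_diff_eq\<close>)
    then show ?thesis by (simp add: total_variation_def[of g u v])
  qed
  then have "variation_sum g D2 \<le> total_variation g u w - total_variation g u v"
    if "disjoint_intervals v w D2" for D2 using that by (simp add: le_diff_eq add.commute)
  then have "(SUP D\<in>Collect (disjoint_intervals v w). variation_sum g D) \<le> total_variation g u w - total_variation g u v"
    by (intro cSUP_least[OF ne]) simp
  then have "total_variation g v w \<le> total_variation g u w - total_variation g u v"
    by (simp add: total_variation_def[of g v w])
  then show ?thesis by simp
qed

lemma sum_total_variation_le:
  assumes "finite_variation g c d" "disjoint_intervals c d D" "c \<le> d"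
  shows "(\<Sum>I\<in>D. total_variation g (fst I) (snd I)) \<le> total_variation g c d"
  using assms
  by (intro sum_superadditive_le total_variation_superadditive total_variation_nonneg)
     (auto intro: finite_variation_mono)

text \<open>
  Vitali's theorem selects countably many disjoint intervals of the cover that exhaust \<open>E\<close> up to a
  null set, and the bound for finite subfamilies passes to their union.
\<close>

lemma Vitali_outer_measure_le:
  fixes E :: "real set"
  assumes K: "\<And>u v. (u, v) \<in> K \<Longrightarrow> u < v"
    and fine: "\<And>x \<delta>. x \<in> E \<Longrightarrow> 0 < \<delta> \<Longrightarrow> \<exists>u v. (u, v) \<in> K \<and> x \<in> {u..v} \<and> v - u < \<delta>"
    and bound: "\<And>F. finite F \<Longrightarrow> F \<subseteq> K \<Longrightarrow>
      pairwise (\<lambda>I J. apart I J) F \<Longrightarrow> (\<Sum>I\<in>F. snd I - fst I) \<le> B"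
  shows "\<exists>T. E \<subseteq> T \<and> T \<in> lmeasurable \<and> measure lebesgue T \<le> B"
proof -
  have cb: "cball ((fst I + snd I) / 2) ((snd I - fst I) / 2) = {fst I..snd I}" for I :: "real \<times> real"
    by (auto simp: cball_eq_atLeastAtMost field_simps)
  obtain C where C: "countable C" "C \<subseteq> K"
     "pairwise (\<lambda>i j. disjnt {fst i..snd i} {fst j..snd j}) C"
     "negligible (E - (\<Union>i\<in>C. {fst i..snd i}))"
  proof (rule Vitali_covering_theorem_cballs[of K "\<lambda>I. (snd I - fst I) / 2" E "\<lambda>I. (fst I + snd I) / 2"])
    show "0 < (snd i - fst i) / 2" if "i \<in> K" for i using K[of "fst i" "snd i"] that by simp
    fix x d :: real assume "x \<in> E" "0 < d"
    then obtain u v where "(u, v) \<in> K" "x \<in> {u..v}" "v - u < d" using fine by blast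
    then show "\<exists>i. i \<in> K \<and> x \<in> cball ((fst i + snd i) / 2) ((snd i - fst i) / 2) \<and> (snd i - fst i) / 2 < d"
      unfolding cb using K[of u v] by (intro exI[of _ "(u,v)"]) auto
  qed (unfold cb, auto)
  let ?U = "\<Union>i\<in>C. {fst i..snd i}"
  have meas_le: "measure lebesgue (\<Union>i\<in>F. {fst i..snd i}) \<le> B" if "F \<subseteq> C" "finite F" for F
  proof -
    have "measure lebesgue (\<Union>i\<in>F. {fst i..snd i}) \<le> (\<Sum>i\<in>F. measure lebesgue {fst i..snd i})"
      using that by (intro measure_UNION_le) auto
    also have "\<dots> = (\<Sum>i\<in>F. snd i - fst i)"
      using C(2) K that by (intro sum.cong) (auto simp: subset_iff less_imp_le)
    also have "\<dots> \<le> B"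
      using that C by (intro bound) (auto intro: pairwise_subset)
    finally show ?thesis .
  qed
  have U: "?U \<in> lmeasurable" "measure lebesgue ?U \<le> B"
    using fmeasurable_UN_bound[of C "\<lambda>i. {fst i..snd i}" lebesgue B]
      measure_UN_bound[of C "\<lambda>i. {fst i..snd i}" lebesgue B] C(1) meas_le by auto
  let ?N = "E - ?U"
  have N: "?N \<in> null_sets lebesgue" using C(4) by (simp add: negligible_iff_null_sets)
  have "?U \<union> ?N \<in> lmeasurable" using U(1) negligible_imp_measurable[OF C(4)] by (rule fmeasurable.Un)
  moreover have "measure lebesgue (?U \<union> ?N) \<le> B"
    using U N by (subst measure_Un_null_set) auto
  ultimately show ?thesis by (intro exI[of _ "?U \<union> ?N"]) auto
qed

lemma disjnt_open_intervals:
  fixes a b p q :: real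
  shows "disjnt {a..b} {p..q} \<Longrightarrow> disjnt {a<..<b} {p<..<q}"
  unfolding disjnt_iff by (meson greaterThanLessThan_iff atLeastAtMost_iff less_imp_le)

lemma closed_disjnt_imp_disjoint_intervals:
  assumes "finite F" "\<And>I. I \<in> F \<Longrightarrow> c \<le> fst I \<and> fst I < snd I \<and> snd I \<le> d"
    "pairwise (\<lambda>I J. apart I J) F"
  shows "disjoint_intervals c d F"
proof -
  have "pairwise (\<lambda>I J. nonoverlapping I J) F"
    using assms(3) disjnt_open_intervals unfolding pairwise_def by blast
  then show ?thesis using assms by (auto simp: disjoint_intervals_def)
qed

text \<open>
  Disjoint intervals on which the mean slope is at least \<open>M\<close> in modulus have total length at most the
  variation divided by \<open>M\<close>, and \<open>M\<close> is arbitrary.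
\<close>

lemma negligible_infinite_slope:
  assumes fv: "finite_variation g c d" and cd: "c \<le> d"
    and fine: "\<And>x M \<delta>. x \<in> E \<Longrightarrow> 0 < \<delta> \<Longrightarrow>
      \<exists>u v. c \<le> u \<and> u < v \<and> v \<le> d \<and> x \<in> {u..v} \<and> v - u < \<delta> \<and> \<bar>g v - g u\<bar> \<ge> M * (v - u)"
  shows "negligible E"
proof (rule negligible_outer_le[THEN iffD2], intro allI impI)
  fix e :: real assume e: "0 < e"
  define M where "M = (total_variation g c d + 1) / e"
  have TV0: "0 \<le> total_variation g c d" using fv by (rule total_variation_nonneg)
  then have M0: "M > 0" using e by (simp add: M_def)
  have "\<exists>T. E \<subseteq> T \<and> T \<in> lmeasurable \<and> measure lebesgue T \<le> e"
  proof (rule Vitali_outer_measure_le[of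
      "{(u, v). c \<le> u \<and> u < v \<and> v \<le> d \<and> \<bar>g v - g u\<bar> \<ge> M * (v - u)}"])
    fix F assume F: "finite F" "F \<subseteq> {(u, v). c \<le> u \<and> u < v \<and> v \<le> d \<and> \<bar>g v - g u\<bar> \<ge> M * (v - u)}"
      "pairwise (\<lambda>I J. apart I J) F"
    have FD: "disjoint_intervals c d F"
      using F by (intro closed_disjnt_imp_disjoint_intervals) auto
    have "M * (\<Sum>I\<in>F. snd I - fst I) = (\<Sum>I\<in>F. M * (snd I - fst I))" by (simp add: sum_distrib_left)
    also have "\<dots> \<le> variation_sum g F"
      unfolding variation_sum_def using F(2) by (intro sum_mono) auto
    also have "\<dots> \<le> total_variation g c d" using fv FD by (rule variation_sum_le_total)
    also have "\<dots> \<le> M * e" using e by (simp add: M_def)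
    finally show "(\<Sum>I\<in>F. snd I - fst I) \<le> e" using M0 by simp
  next
    fix x \<delta> :: real assume "x \<in> E" "0 < \<delta>"
    then obtain u v where "c \<le> u" "u < v" "v \<le> d" "x \<in> {u..v}" "v - u < \<delta>" "\<bar>g v - g u\<bar> \<ge> M * (v - u)"
      using fine[of x \<delta> M] by blast
    then show "\<exists>u v. (u, v) \<in> {(u, v). c \<le> u \<and> u < v \<and> v \<le> d \<and> \<bar>g v - g u\<bar> \<ge> M * (v - u)} \<and>
        x \<in> {u..v} \<and> v - u < \<delta>" by (intro exI[of _ u] exI[of _ v]) simp
  qed auto
  then show "\<exists>T. E \<subseteq> T \<and> T \<in> lmeasurable \<and> measure lebesgue T \<le> e" .
qed

text \<open>
  Austin's argument. Take a disjoint family \<open>D\<close> whose increments almost exhaust the total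
  variation. Around a point of \<open>E\<close> inside some \<open>J\<close> of \<open>D\<close> choose a short interval on which \<open>g\<close> moves
  against its increment over \<open>J\<close>; such a detour adds to the variation over \<open>J\<close> in proportion to
  its length. Around a point outside all members of \<open>D\<close> choose a short interval with slope at least \<open>\<alpha>\<close>,
  which adds to the variation as well. Since little variation is left, disjoint intervals of this
  kind have small total length, and Vitali's theorem bounds the outer measure of \<open>E\<close>.
\<close>

lemma negligible_slopes_both_signs:
  assumes fv: "finite_variation g c d" and cd: "c \<le> d" and \<alpha>: "\<alpha> > 0"
    and up: "\<And>x \<delta>. x \<in> E \<Longrightarrow> 0 < \<delta> \<Longrightarrow>
      \<exists>u v. c \<le> u \<and> u < v \<and> v \<le> d \<and> x \<in> {u..v} \<and> v - u < \<delta> \<and> g v - g u \<ge> \<alpha> * (v - u)"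
    and down: "\<And>x \<delta>. x \<in> E \<Longrightarrow> 0 < \<delta> \<Longrightarrow>
      \<exists>u v. c \<le> u \<and> u < v \<and> v \<le> d \<and> x \<in> {u..v} \<and> v - u < \<delta> \<and> g v - g u \<le> - \<alpha> * (v - u)"
  shows "negligible E"
proof (rule negligible_outer_le[THEN iffD2], intro allI impI)
  fix e :: real assume e: "0 < e"
  let ?V = "total_variation g"
  have "\<exists>D. disjoint_intervals c d D \<and> ?V c d - \<alpha> * e < variation_sum g D"
  proof (rule ccontr)
    assume "\<not> ?thesis"
    then have *: "variation_sum g D \<le> ?V c d - \<alpha> * e" if "disjoint_intervals c d D" for D
      using that by (auto simp: not_less)
    have "Collect (disjoint_intervals c d) \<noteq> {}" using disjoint_intervals_empty by blast
    then have "(SUP D\<in>Collect (disjoint_intervals c d). variation_sum g D) \<le> ?V c d - \<alpha> * e"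
      by (rule cSUP_least) (use * in auto)
    then have "?V c d \<le> ?V c d - \<alpha> * e" by (simp add: total_variation_def)
    then show False using mult_pos_pos[OF \<alpha> e] by simp
  qed
  then obtain D where D: "disjoint_intervals c d D" and near: "?V c d - \<alpha> * e < variation_sum g D"
    by blast
  have finD: "finite D" using D by (simp add: disjoint_intervals_def)
  have Dbnd: "c \<le> fst J \<and> fst J < snd J \<and> snd J \<le> d" if "J \<in> D" for J
    using D that by (simp add: disjoint_intervals_def)
  \<comment> \<open>The endpoints are discarded so that every remaining point has a neighbourhood inside one member or outside all of them.\<close>
  define P where "P = fst ` D \<union> snd ` D"
  have P: "negligible P" unfolding P_def using finD by (intro negligible_finite) auto
  define sg where "sg J = (if g (snd J) \<ge> g (fst J) then 1 else - 1 :: real)" for J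
  define inside where "inside J = {(u, v). c \<le> u \<and> u < v \<and> v \<le> d \<and> {u..v} \<subseteq> {fst J<..<snd J} \<and>
      sg J * (g v - g u) \<le> - \<alpha> * (v - u)}" for J
  define gaps where "gaps = {(u, v). c \<le> u \<and> u < v \<and> v \<le> d \<and> (\<forall>J\<in>D. disjnt {u..v} {fst J..snd J}) \<and>
      g v - g u \<ge> \<alpha> * (v - u)}"
  let ?K = "gaps \<union> (\<Union>J\<in>D. inside J)"
  have "\<exists>T. E - P \<subseteq> T \<and> T \<in> lmeasurable \<and> measure lebesgue T \<le> e"
  proof (rule Vitali_outer_measure_le[of ?K])
    show "u < v" if "(u, v) \<in> ?K" for u v using that by (auto simp: gaps_def inside_def)
  next
    fix x \<delta> :: real assume x: "x \<in> E - P" and \<delta>: "0 < \<delta>"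
    show "\<exists>u v. (u, v) \<in> ?K \<and> x \<in> {u..v} \<and> v - u < \<delta>"
    proof (cases "\<exists>J\<in>D. x \<in> {fst J..snd J}")
      case True
      then obtain J where J: "J \<in> D" "x \<in> {fst J..snd J}" by blast
      with x have J': "fst J < x" "x < snd J" by (auto simp: P_def less_le)
      define \<rho> where "\<rho> = min \<delta> (min (x - fst J) (snd J - x))"
      have \<rho>: "\<rho> > 0" "\<rho> \<le> \<delta>" using J' \<delta> by (auto simp: \<rho>_def)
      have "\<exists>u v. c \<le> u \<and> u < v \<and> v \<le> d \<and> x \<in> {u..v} \<and> v - u < \<rho> \<and> sg J * (g v - g u) \<le> - \<alpha> * (v - u)"
      proof (cases "g (snd J) \<ge> g (fst J)")
        case True
        then have "sg J = 1" by (simp add: sg_def)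
        then show ?thesis using down[of x \<rho>] x \<rho>(1) by simp
      next
        case False
        then have sg: "sg J = - 1" by (simp add: sg_def)
        obtain u v where "c \<le> u" "u < v" "v \<le> d" "x \<in> {u..v}" "v - u < \<rho>" "g v - g u \<ge> \<alpha> * (v - u)"
          using up[of x \<rho>] x \<rho>(1) by blast
        then show ?thesis by (intro exI[of _ u] exI[of _ v]) (simp add: sg)
      qed
      then obtain u v where uv: "c \<le> u" "u < v" "v \<le> d" "x \<in> {u..v}" "v - u < \<rho>"
        "sg J * (g v - g u) \<le> - \<alpha> * (v - u)" by blast
      then have "{u..v} \<subseteq> {fst J<..<snd J}" by (auto simp: \<rho>_def)
      then have "(u, v) \<in> inside J" using uv by (auto simp: inside_def)
      then show ?thesis using uv \<rho> J(1) by (intro exI[of _ u] exI[of _ v]) auto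
    next
      case False
      define S where "S = - (\<Union>J\<in>D. {fst J..snd J})"
      have "open S" unfolding S_def using finD by (intro open_Compl closed_UN) auto
      moreover have "x \<in> S" using False by (auto simp: S_def)
      ultimately obtain \<rho> where \<rho>: "\<rho> > 0" "cball x \<rho> \<subseteq> S" using open_contains_cball by blast
      obtain u v where uv: "c \<le> u" "u < v" "v \<le> d" "x \<in> {u..v}" "v - u < min \<delta> \<rho>"
        "g v - g u \<ge> \<alpha> * (v - u)" using up[of x "min \<delta> \<rho>"] x \<delta> \<rho> by auto
      have "{u..v} \<subseteq> cball x \<rho>" using uv by (auto simp: dist_real_def)
      then have "{u..v} \<subseteq> S" using \<rho> by blast
      then have "disjnt {u..v} {fst J..snd J}" if "J \<in> D" for J
        using that unfolding S_def disjnt_iff by blast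
      then have "(u, v) \<in> gaps" using uv by (simp add: gaps_def)
      then show ?thesis using uv by (intro exI[of _ u] exI[of _ v]) auto
    qed
  next
    fix F assume F: "finite F" "F \<subseteq> ?K" "pairwise (\<lambda>I J. apart I J) F"
    define Fg where "Fg = F \<inter> gaps"
    define Fi where "Fi J = F \<inter> inside J" for J
    have Fb: "c \<le> fst I \<and> fst I < snd I \<and> snd I \<le> d" if "I \<in> F" for I
      using F(2) that by (auto simp: gaps_def inside_def)
    have split: "F = Fg \<union> (\<Union>J\<in>D. Fi J)" using F(2) by (auto simp: Fg_def Fi_def)
    have finF: "finite Fg" "\<And>J. finite (Fi J)" using F(1) by (auto simp: Fg_def Fi_def)
    have Dpw: "J = J'" if "J \<in> D" "J' \<in> D" "x \<in> {fst J<..<snd J}" "x \<in> {fst J'<..<snd J'}" for J J' x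
      using D that unfolding disjoint_intervals_def pairwise_def disjnt_iff by blast
    have "(\<Sum>I\<in>F. snd I - fst I) = (\<Sum>I\<in>Fg. snd I - fst I) + (\<Sum>I\<in>(\<Union>J\<in>D. Fi J). snd I - fst I)"
    proof (subst split, rule sum.union_disjoint)
      have "I \<notin> gaps" if "I \<in> inside J" "J \<in> D" for I J
      proof
        assume g: "I \<in> gaps"
        have I: "{fst I..snd I} \<subseteq> {fst J<..<snd J}" "fst I \<in> {fst I..snd I}"
          using that by (auto simp: inside_def)
        then have "fst I \<in> {fst J<..<snd J}" by (rule subsetD)
        then have m: "fst I \<in> {fst J..snd J}" by simp
        have "apart I J" using g that(2) by (auto simp: gaps_def)
        then show False using I(2) m by (meson disjnt_iff)
      qed
      then show "Fg \<inter> (\<Union>J\<in>D. Fi J) = {}" by (auto simp: Fg_def Fi_def)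
    qed (use finF finD in auto)
    also have "(\<Sum>I\<in>(\<Union>J\<in>D. Fi J). snd I - fst I) = (\<Sum>J\<in>D. \<Sum>I\<in>Fi J. snd I - fst I)"
    proof (rule sum.UNION_disjoint)
      have "J = J'" if J: "J \<in> D" "J' \<in> D" and I: "I \<in> Fi J" "I \<in> Fi J'" for J J' I
      proof (rule Dpw[OF J])
        have "{fst I..snd I} \<subseteq> {fst J<..<snd J}" "{fst I..snd I} \<subseteq> {fst J'<..<snd J'}"
          "fst I \<in> {fst I..snd I}"
          using I by (auto simp: Fi_def inside_def)
        then show "fst I \<in> {fst J<..<snd J}" "fst I \<in> {fst J'<..<snd J'}" by (blast dest: subsetD)+
      qed
      then show "\<forall>i\<in>D. \<forall>j\<in>D. i \<noteq> j \<longrightarrow> Fi i \<inter> Fi j = {}" by blast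
    qed (use finF finD in auto)
    finally have len: "(\<Sum>I\<in>F. snd I - fst I) =
        (\<Sum>I\<in>Fg. snd I - fst I) + (\<Sum>J\<in>D. \<Sum>I\<in>Fi J. snd I - fst I)" .
    have gap_le: "\<alpha> * (snd I - fst I) \<le> ?V (fst I) (snd I)" if "I \<in> Fg" for I
    proof -
      have "c \<le> fst I" "fst I < snd I" "snd I \<le> d" "\<alpha> * (snd I - fst I) \<le> g (snd I) - g (fst I)"
        using that by (auto simp: Fg_def gaps_def)
      then show ?thesis
        using abs_diff_le_total_variation[OF finite_variation_mono[OF fv]] by (smt (verit))
    qed
    \<comment> \<open>On an interval \<open>J\<close> of the family, the excess of the variation over the increment of
      \<open>sg J * g\<close> is itself superadditive, and each \<open>I\<close> inside \<open>J\<close> contributes to it.\<close>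
    have in_le: "\<bar>g (snd J) - g (fst J)\<bar> + \<alpha> * (\<Sum>I\<in>Fi J. snd I - fst I) \<le> ?V (fst J) (snd J)"
      if J: "J \<in> D" for J
    proof -
      define W where "W u v = ?V u v - sg J * (g v - g u)" for u v
      have fvJ: "finite_variation g (fst J) (snd J)"
        using Dbnd[OF J] fv by (auto intro: finite_variation_mono)
      have sgl: "sg J * x \<le> \<bar>x\<bar>" for x by (auto simp: sg_def)
      have "(\<Sum>I\<in>Fi J. W (fst I) (snd I)) \<le> W (fst J) (snd J)"
      proof (rule sum_superadditive_le)
        fix u v w assume "fst J \<le> u" "u \<le> v" "v \<le> w" "w \<le> snd J"
        then show "W u v + W v w \<le> W u w"
          using total_variation_superadditive[OF finite_variation_mono[OF fvJ], of u w v]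
          by (simp add: W_def algebra_simps)
      next
        fix u v assume "fst J \<le> u" "u \<le> v" "v \<le> snd J"
        then show "0 \<le> W u v"
          using abs_diff_le_total_variation[OF finite_variation_mono[OF fvJ], of u v] sgl[of "g v - g u"]
          by (simp add: W_def)
      next
        show "disjoint_intervals (fst J) (snd J) (Fi J)"
        proof (rule closed_disjnt_imp_disjoint_intervals)
          show "pairwise (\<lambda>I J. apart I J) (Fi J)"
            using F(3) by (rule pairwise_subset) (auto simp: Fi_def)
          fix I assume "I \<in> Fi J"
          then have "fst I < snd I" "{fst I..snd I} \<subseteq> {fst J<..<snd J}" by (auto simp: Fi_def inside_def)
          then show "fst J \<le> fst I \<and> fst I < snd I \<and> snd I \<le> snd J"
            by (auto simp: subset_iff less_imp_le)
        qed (use finF in auto)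
        show "fst J \<le> snd J" using Dbnd[OF J] by simp
      qed
      moreover have "\<alpha> * (snd I - fst I) \<le> W (fst I) (snd I)" if "I \<in> Fi J" for I
      proof -
        have I: "sg J * (g (snd I) - g (fst I)) \<le> - \<alpha> * (snd I - fst I)" "I \<in> F"
          using that by (auto simp: Fi_def inside_def)
        have "0 \<le> ?V (fst I) (snd I)"
          using Fb[OF I(2)] fv by (auto intro: total_variation_nonneg finite_variation_mono)
        then show ?thesis using I by (simp add: W_def)
      qed
      then have "\<alpha> * (\<Sum>I\<in>Fi J. snd I - fst I) \<le> (\<Sum>I\<in>Fi J. W (fst I) (snd I))"
        unfolding sum_distrib_left by (rule sum_mono)
      moreover have "sg J * (g (snd J) - g (fst J)) = \<bar>g (snd J) - g (fst J)\<bar>" by (auto simp: sg_def)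
      ultimately show ?thesis by (simp add: W_def)
    qed
    have disj: "disjoint_intervals c d (Fg \<union> D)"
      unfolding disjoint_intervals_def
    proof (intro conjI)
      show "finite (Fg \<union> D)" using finF finD by simp
      show "\<forall>I\<in>Fg \<union> D. c \<le> fst I \<and> fst I < snd I \<and> snd I \<le> d" using Fb Dbnd by (auto simp: Fg_def)

      have 1: "nonoverlapping I J" if "I \<in> Fg" "J \<in> D" for I J
        using that by (intro disjnt_open_intervals) (auto simp: Fg_def gaps_def)
      have 2: "nonoverlapping I J" if "I \<in> Fg" "J \<in> Fg" "I \<noteq> J" for I J
        using that F(3) by (intro disjnt_open_intervals) (auto simp: Fg_def pairwise_def)
      have 3: "nonoverlapping I J" if "I \<in> D" "J \<in> D" "I \<noteq> J" for I J
        using that D by (auto simp: disjoint_intervals_def pairwise_def)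
      show "pairwise (\<lambda>I J. nonoverlapping I J) (Fg \<union> D)"
        unfolding pairwise_def using 1 2 3 by (metis Un_iff disjnt_sym)
    qed
    have "Fg \<inter> D = {}"
    proof -
      have "I \<notin> D" if "I \<in> gaps" for I
      proof
        assume "I \<in> D"
        then have "disjnt {fst I..snd I} {fst I..snd I}" using that by (auto simp: gaps_def)
        then show False using Dbnd[OF \<open>I \<in> D\<close>] by (auto simp: disjnt_iff)
      qed
      then show ?thesis by (auto simp: Fg_def)
    qed
    then have "(\<Sum>I\<in>Fg. ?V (fst I) (snd I)) + (\<Sum>J\<in>D. ?V (fst J) (snd J)) \<le> ?V c d"
      using sum_total_variation_le[OF fv disj cd] finF finD by (simp add: sum.union_disjoint)
    moreover have "\<alpha> * (\<Sum>I\<in>Fg. snd I - fst I) \<le> (\<Sum>I\<in>Fg. ?V (fst I) (snd I))"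
      unfolding sum_distrib_left using gap_le by (rule sum_mono)
    moreover have "variation_sum g D + \<alpha> * (\<Sum>J\<in>D. \<Sum>I\<in>Fi J. snd I - fst I) \<le> (\<Sum>J\<in>D. ?V (fst J) (snd J))"
      unfolding variation_sum_def sum_distrib_left[of \<alpha>] sum.distrib[symmetric]
      using in_le by (intro sum_mono) (simp add: sum_distrib_left)
    ultimately have "\<alpha> * (\<Sum>I\<in>F. snd I - fst I) \<le> \<alpha> * e"
      unfolding len distrib_left using near by linarith
    then show "(\<Sum>I\<in>F. snd I - fst I) \<le> e" using \<alpha> by simp
  qed
  then obtain T where T: "E - P \<subseteq> T" "T \<in> lmeasurable" "measure lebesgue T \<le> e" by blast
  have "T \<union> P \<in> lmeasurable" using T(2) negligible_imp_measurable[OF P] by (rule fmeasurable.Un)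
  moreover have "measure lebesgue (T \<union> P) \<le> e"
    using T P by (subst measure_Un_null_set) (auto simp: negligible_iff_null_sets)
  ultimately show "\<exists>T. E \<subseteq> T \<and> T \<in> lmeasurable \<and> measure lebesgue T \<le> e"
    using T(1) by (intro exI[of _ "T \<union> P"]) auto
qed

lemma sum_length_le:
  assumes "disjoint_intervals c d D" "c \<le> d"
  shows "(\<Sum>I\<in>D. snd I - fst I) \<le> d - c"
  using sum_superadditive_le[of c d "\<lambda>u v. v - u" D] assms by simp

lemma finite_variation_diff_linear:
  assumes "finite_variation g c d" "c \<le> d"
  shows "finite_variation (\<lambda>x. g x - \<beta> * x) c d"
  unfolding finite_variation_def
proof (rule bdd_aboveI2)
  fix D assume "D \<in> Collect (disjoint_intervals c d)"
  then have D: "disjoint_intervals c d D" by simp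
  have "variation_sum (\<lambda>x. g x - \<beta> * x) D \<le> (\<Sum>I\<in>D. \<bar>g (snd I) - g (fst I)\<bar> + \<bar>\<beta>\<bar> * (snd I - fst I))"
    unfolding variation_sum_def
  proof (rule sum_mono)
    fix I assume "I \<in> D"
    then have "fst I < snd I" using D by (simp add: disjoint_intervals_def)
    then have "\<bar>\<beta>\<bar> * (snd I - fst I) = \<bar>\<beta> * (snd I - fst I)\<bar>" by (simp add: abs_mult)
    then show "\<bar>g (snd I) - \<beta> * snd I - (g (fst I) - \<beta> * fst I)\<bar>
        \<le> \<bar>g (snd I) - g (fst I)\<bar> + \<bar>\<beta>\<bar> * (snd I - fst I)"
      by (simp add: right_diff_distrib)
  qed
  also have "\<dots> = variation_sum g D + \<bar>\<beta>\<bar> * (\<Sum>I\<in>D. snd I - fst I)"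
    by (simp add: variation_sum_def sum.distrib sum_distrib_left)
  also have "\<dots> \<le> total_variation g c d + \<bar>\<beta>\<bar> * (d - c)"
    using variation_sum_le_total[OF assms(1) D] sum_length_le[OF D assms(2)]
    by (intro add_mono mult_left_mono) auto
  finally show "variation_sum (\<lambda>x. g x - \<beta> * x) D \<le> total_variation g c d + \<bar>\<beta>\<bar> * (d - c)" .
qed

text \<open>
  A difference quotient at \<open>x\<close> is the slope of an interval with \<open>x\<close> as its left or right endpoint; this
  translates limits of quotients into the language of interval covers.
\<close>

lemma frequently_slope_interval:
  fixes g :: "real \<Rightarrow> real"
  assumes freq: "\<exists>\<^sub>F h in at 0. P ((g (x + h) - g x) / h)"
    and x: "c < x" "x < d" and \<delta>: "0 < \<delta>"
  shows "\<exists>u v. c \<le> u \<and> u < v \<and> v \<le> d \<and> x \<in> {u..v} \<and> v - u < \<delta> \<and> P ((g v - g u) / (v - u))"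
proof -
  define \<rho> where "\<rho> = min \<delta> (min (x - c) (d - x))"
  have \<rho>: "\<rho> > 0" using x \<delta> by (simp add: \<rho>_def)
  have "\<forall>\<^sub>F h in at 0. h \<noteq> 0 \<and> \<bar>h\<bar> < \<rho>"
    using \<rho> unfolding eventually_at by (intro exI[of _ \<rho>]) (auto simp: dist_real_def)
  then have "\<exists>\<^sub>F h in at 0. P ((g (x + h) - g x) / h) \<and> h \<noteq> 0 \<and> \<bar>h\<bar> < \<rho>"
    using freq by (intro frequently_rev_mp[OF freq]) (auto elim: eventually_mono)
  then obtain h where h: "P ((g (x + h) - g x) / h)" "h \<noteq> 0" "\<bar>h\<bar> < \<rho>"
    using frequently_ex by blast
  show ?thesis
  proof (cases "h > 0")
    case True
    then show ?thesis using h by (intro exI[of _ x] exI[of _ "x + h"]) (auto simp: \<rho>_def)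
  next
    case False
    have "(g x - g (x + h)) / (- h) = (g (x + h) - g x) / h" using h(2) by (simp add: field_simps)
    then show ?thesis using False h by (intro exI[of _ "x + h"] exI[of _ x]) (auto simp: \<rho>_def)
  qed
qed

text \<open>
  If the quotients at \<open>x\<close> are bounded near \<open>0\<close> but have no limit, two rationals separate their limit
  inferior from their limit superior, so the exceptional set is a countable union of null sets.
\<close>

lemma finite_variation_imp_differentiable_ae:
  assumes fv: "finite_variation g c d" and cd: "c \<le> d"
  shows "negligible {x \<in> {c<..<d}. \<not> g differentiable (at x)}"
proof -
  define q where "q x h = (g (x + h) - g x) / h" for x h
  define Einf where "Einf = {x \<in> {c<..<d}. \<forall>M. \<exists>\<^sub>F h in at 0. \<bar>q x h\<bar> \<ge> M}"
  define E where "E r s = {x \<in> {c<..<d}. (\<exists>\<^sub>F h in at 0. q x h \<ge> s) \<and> (\<exists>\<^sub>F h in at 0. q x h \<le> r)}" for r s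
  have "negligible Einf"
  proof (rule negligible_infinite_slope[OF fv cd])
    fix x M \<delta> :: real assume "x \<in> Einf" "0 < \<delta>"
    then obtain u v where uv: "c \<le> u" "u < v" "v \<le> d" "x \<in> {u..v}" "v - u < \<delta>" "\<bar>(g v - g u) / (v - u)\<bar> \<ge> M"
      using frequently_slope_interval[of "\<lambda>y. \<bar>y\<bar> \<ge> M" g x c d \<delta>] by (auto simp: Einf_def q_def)
    then have "\<bar>g v - g u\<bar> \<ge> M * (v - u)" by (simp add: field_simps abs_divide)
    with uv show "\<exists>u v. c \<le> u \<and> u < v \<and> v \<le> d \<and> x \<in> {u..v} \<and> v - u < \<delta> \<and> \<bar>g v - g u\<bar> \<ge> M * (v - u)"
      by blast
  qed
  have "negligible (E r s)" if "r < s" for r s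
  proof (rule negligible_slopes_both_signs[where \<alpha> = "(s - r) / 2"])
    \<comment> \<open>Subtracting the linear function with the mean slope makes the two slopes opposite.\<close>
    show "finite_variation (\<lambda>x. g x - (r + s) / 2 * x) c d"
      using fv cd by (rule finite_variation_diff_linear)
    show "0 < (s - r) / 2" using that by simp
  next
    fix x \<delta> :: real assume "x \<in> E r s" "0 < \<delta>"
    then obtain u v where uv: "c \<le> u" "u < v" "v \<le> d" "x \<in> {u..v}" "v - u < \<delta>" "(g v - g u) / (v - u) \<ge> s"
      using frequently_slope_interval[of "\<lambda>y. y \<ge> s" g x c d \<delta>] by (auto simp: E_def q_def)
    then have "g v - g u \<ge> s * (v - u)" by (simp add: field_simps)
    then have "(g v - (r + s) / 2 * v) - (g u - (r + s) / 2 * u) \<ge> (s - r) / 2 * (v - u)"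
      by (simp add: field_simps)
    with uv show "\<exists>u v. c \<le> u \<and> u < v \<and> v \<le> d \<and> x \<in> {u..v} \<and> v - u < \<delta> \<and>
       (g v - (r + s) / 2 * v) - (g u - (r + s) / 2 * u) \<ge> (s - r) / 2 * (v - u)"
      by blast
  next
    fix x \<delta> :: real assume "x \<in> E r s" "0 < \<delta>"
    then obtain u v where uv: "c \<le> u" "u < v" "v \<le> d" "x \<in> {u..v}" "v - u < \<delta>" "(g v - g u) / (v - u) \<le> r"
      using frequently_slope_interval[of "\<lambda>y. y \<le> r" g x c d \<delta>] by (auto simp: E_def q_def)
    then have "g v - g u \<le> r * (v - u)" by (simp add: field_simps)
    then have "(g v - (r + s) / 2 * v) - (g u - (r + s) / 2 * u) \<le> - ((s - r) / 2) * (v - u)"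
      by (simp add: field_simps)
    with uv show "\<exists>u v. c \<le> u \<and> u < v \<and> v \<le> d \<and> x \<in> {u..v} \<and> v - u < \<delta> \<and>
       (g v - (r + s) / 2 * v) - (g u - (r + s) / 2 * u) \<le> - ((s - r) / 2) * (v - u)"
      by blast
  qed (use cd in auto)
  then have "negligible (\<Union>(r, s)\<in>{(r, s). r \<in> \<rat> \<and> s \<in> \<rat> \<and> r < s}. E r s)"
    by (intro negligible_countable_Union countable_image)
       (auto intro: countable_subset[OF _ countable_SIGMA[OF countable_rat countable_rat]])
  moreover have "{x \<in> {c<..<d}. \<not> g differentiable (at x)} \<subseteq>
      Einf \<union> (\<Union>(r, s)\<in>{(r, s). r \<in> \<rat> \<and> s \<in> \<rat> \<and> r < s}. E r s)"
  proof (rule subsetI, rule ccontr)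
    fix x assume x: "x \<in> {x \<in> {c<..<d}. \<not> g differentiable (at x)}"
      and not: "x \<notin> Einf \<union> (\<Union>(r, s)\<in>{(r, s). r \<in> \<rat> \<and> s \<in> \<rat> \<and> r < s}. E r s)"
    have "\<exists>M. \<not> (\<exists>\<^sub>F h in at 0. \<bar>q x h\<bar> \<ge> M)" using x not by (auto simp: Einf_def)
    then obtain M where M: "\<forall>\<^sub>F h in at 0. \<bar>q x h\<bar> < M" by (auto simp: not_frequently not_le)
    have rs: "(\<forall>\<^sub>F h in at 0. q x h < s) \<or> (\<forall>\<^sub>F h in at 0. r < q x h)" if "r \<in> \<rat>" "s \<in> \<rat>" "r < s" for r s
    proof -
      have "x \<notin> E r s" using not that by blast
      then show ?thesis using x by (auto simp: E_def not_frequently not_le)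
    qed
    \<comment> \<open>The infimum of the eventual upper bounds is the limit superior; the rationals show that it is the limit.\<close>
    define S where "S = {s. \<forall>\<^sub>F h in at 0. q x h < s}"
    have "M \<in> S" using M unfolding S_def mem_Collect_eq by (rule eventually_mono) simp
    have low: "- M \<le> s" if "s \<in> S" for s
    proof (rule ccontr)
      assume "\<not> - M \<le> s"
      have "\<forall>\<^sub>F h in at (0::real). False"
        using M that[unfolded S_def mem_Collect_eq] by eventually_elim (use \<open>\<not> - M \<le> s\<close> in linarith)
      then show False by (simp add: eventually_False)
    qed
    have "(q x \<longlongrightarrow> Inf S) (at 0)"
    proof (rule order_tendstoI)
      fix a assume "a < Inf S"
      then obtain r where r: "a < r" "r < Inf S" "r \<in> \<rat>" using Rats_dense_in_real by blast
      then obtain s where s: "r < s" "s < Inf S" "s \<in> \<rat>" using Rats_dense_in_real by blast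
      have "s \<notin> S"
      proof
        assume "s \<in> S"
        then have "Inf S \<le> s" by (rule cInf_lower) (use low in \<open>auto intro!: bdd_belowI[where m = "- M"]\<close>)
        then show False using s by simp
      qed
      then have "\<forall>\<^sub>F h in at 0. r < q x h" using rs r s by (auto simp: S_def)
      then show "\<forall>\<^sub>F h in at 0. a < q x h" by (rule eventually_mono) (use r in simp)
    next
      fix a assume "Inf S < a"
      then obtain s where s: "s \<in> S" "s < a" using \<open>M \<in> S\<close> by (metis cInf_lessD empty_iff)
      then show "\<forall>\<^sub>F h in at 0. q x h < a" unfolding S_def by (auto elim: eventually_mono)
    qed
    then have "(g has_field_derivative Inf S) (at x)"
      unfolding has_field_derivative_iff q_def by (simp add: LIM_offset_zero_iff[of x] )
    then show False using x by (auto simp: real_differentiable_def)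
  qed
  ultimately show ?thesis using \<open>negligible Einf\<close> by (meson negligible_Un negligible_subset)
qed

lemma absolutely_continuous_sum_intervals:
  assumes ac: "absolutely_continuous_on_interval a b g" and \<epsilon>: "\<epsilon> > 0"
  obtains \<delta> where "\<delta> > 0"
    "\<And>D. disjoint_intervals a b D \<Longrightarrow> (\<Sum>I\<in>D. snd I - fst I) < \<delta> \<Longrightarrow>
      (\<Sum>I\<in>D. cmod (g (snd I) - g (fst I))) < \<epsilon>"
proof -
  obtain \<delta> where \<delta>: "\<delta> > 0" and *: "\<And>(n::nat) (u::nat \<Rightarrow> real) v.
      (\<forall>i<n. a \<le> u i \<and> u i < v i \<and> v i \<le> b) \<Longrightarrow> disjoint_family_on (\<lambda>i. {u i<..<v i}) {..<n} \<Longrightarrow>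
      (\<Sum>i<n. v i - u i) < \<delta> \<Longrightarrow> (\<Sum>i<n. cmod (g (v i) - g (u i))) < \<epsilon>"
    using ac \<epsilon> unfolding absolutely_continuous_on_interval_def by meson
  show ?thesis
  proof (rule that[OF \<delta>])
    fix D assume D: "disjoint_intervals a b D" and len: "(\<Sum>I\<in>D. snd I - fst I) < \<delta>"
    have "finite D" using D by (simp add: disjoint_intervals_def)
    then obtain e where e: "bij_betw e {..<card D} D"
      using ex_bij_betw_nat_finite[of D] by (auto simp: atLeast0LessThan)
    have eD: "e i \<in> D" if "i < card D" for i using e that by (auto dest: bij_betwE)
    have "(\<Sum>i<card D. cmod (g (snd (e i)) - g (fst (e i)))) < \<epsilon>"
    proof (rule *)
      show "\<forall>i<card D. a \<le> fst (e i) \<and> fst (e i) < snd (e i) \<and> snd (e i) \<le> b"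
        using eD D by (auto simp: disjoint_intervals_def)
      show "disjoint_family_on (\<lambda>i. {fst (e i)<..<snd (e i)}) {..<card D}"
        unfolding disjoint_family_on_def
      proof (intro ballI impI)
        fix i j assume ij: "i \<in> {..<card D}" "j \<in> {..<card D}" "i \<noteq> j"
        then have "e i \<noteq> e j" using e by (auto simp: bij_betw_def inj_on_def)
        then show "{fst (e i)<..<snd (e i)} \<inter> {fst (e j)<..<snd (e j)} = {}"
          using D eD ij unfolding disjoint_intervals_def pairwise_def disjnt_def by blast
      qed
      show "(\<Sum>i<card D. snd (e i) - fst (e i)) < \<delta>"
        using len sum.reindex_bij_betw[OF e, of "\<lambda>I. snd I - fst I"] by simp
    qed
    then show "(\<Sum>I\<in>D. cmod (g (snd I) - g (fst I))) < \<epsilon>"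
      using sum.reindex_bij_betw[OF e, of "\<lambda>I. cmod (g (snd I) - g (fst I))"] by simp
  qed
qed

text \<open>
  On short intervals absolute continuity bounds the variation of the real and the imaginary part, and
  countably many rational short intervals cover the whole one.
\<close>

lemma absolutely_continuous_imp_differentiable_ae:
  assumes ac: "absolutely_continuous_on_interval a b g"
  shows "negligible {x \<in> {a<..<b}. \<not> g differentiable (at x)}"
proof -
  obtain \<delta> where \<delta>: "\<delta> > 0" and ac1: "\<And>D. disjoint_intervals a b D \<Longrightarrow> (\<Sum>I\<in>D. snd I - fst I) < \<delta> \<Longrightarrow>
      (\<Sum>I\<in>D. cmod (g (snd I) - g (fst I))) < 1"
    using absolutely_continuous_sum_intervals[OF ac zero_less_one] by metis
  \<comment> \<open>On intervals shorter than \<open>\<delta>\<close> the variation is at most \<open>1\<close>.\<close>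
  have fv: "finite_variation (\<lambda>x. Re (g x)) p q" "finite_variation (\<lambda>x. Im (g x)) p q"
    if pq: "a \<le> p" "p \<le> q" "q \<le> b" "q - p < \<delta>" for p q
  proof -
    have *: "(\<Sum>I\<in>D. cmod (g (snd I) - g (fst I))) < 1" if D: "disjoint_intervals p q D" for D
      using ac1 disjoint_intervals_mono[OF D] sum_length_le[OF D] pq by fastforce
    have "variation_sum (\<lambda>x. Re (g x)) D \<le> 1" if "disjoint_intervals p q D" for D
    proof -
      have "variation_sum (\<lambda>x. Re (g x)) D \<le> (\<Sum>I\<in>D. cmod (g (snd I) - g (fst I)))"
        unfolding variation_sum_def by (intro sum_mono) (metis abs_Re_le_cmod minus_complex.sel(1))
      then show ?thesis using *[OF that] by simp
    qed
    moreover have "variation_sum (\<lambda>x. Im (g x)) D \<le> 1" if "disjoint_intervals p q D" for D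
    proof -
      have "variation_sum (\<lambda>x. Im (g x)) D \<le> (\<Sum>I\<in>D. cmod (g (snd I) - g (fst I)))"
        unfolding variation_sum_def by (intro sum_mono) (metis abs_Im_le_cmod minus_complex.sel(2))
      then show ?thesis using *[OF that] by simp
    qed
    ultimately show "finite_variation (\<lambda>x. Re (g x)) p q" "finite_variation (\<lambda>x. Im (g x)) p q"
      unfolding finite_variation_def by (auto intro!: bdd_aboveI2[where M = 1])
  qed
  define N where "N p q = {x \<in> {p<..<q}. \<not> (\<lambda>x. Re (g x)) differentiable (at x)} \<union>
      {x \<in> {p<..<q}. \<not> (\<lambda>x. Im (g x)) differentiable (at x)}" for p q
  let ?J = "{(p, q). p \<in> \<rat> \<and> q \<in> \<rat> \<and> a \<le> p \<and> p \<le> q \<and> q \<le> b \<and> q - p < \<delta>}"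
  have "negligible (N p q)" if "(p, q) \<in> ?J" for p q
    unfolding N_def using that fv by (intro negligible_Un finite_variation_imp_differentiable_ae) auto
  then have "negligible (\<Union>(p, q)\<in>?J. N p q)"
    by (intro negligible_countable_Union countable_image)
       (auto intro: countable_subset[OF _ countable_SIGMA[OF countable_rat countable_rat]])
  moreover have "{x \<in> {a<..<b}. \<not> g differentiable (at x)} \<subseteq> (\<Union>(p, q)\<in>?J. N p q)"
  proof (rule subsetI)
    fix x assume x: "x \<in> {x \<in> {a<..<b}. \<not> g differentiable (at x)}"
    obtain p where p: "p \<in> \<rat>" "max a (x - \<delta> / 2) < p" "p < x"
      using Rats_dense_in_real[of "max a (x - \<delta> / 2)" x] x \<delta> by auto
    obtain q where q: "q \<in> \<rat>" "x < q" "q < min b (x + \<delta> / 2)"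
      using Rats_dense_in_real[of x "min b (x + \<delta> / 2)"] x \<delta> by auto
    have "(p, q) \<in> ?J" using p q by auto
    moreover have "x \<in> N p q"
    proof (rule ccontr)
      assume "x \<notin> N p q"
      then have "(\<lambda>x. Re (g x)) differentiable (at x)" "(\<lambda>x. Im (g x)) differentiable (at x)"
        using p q by (auto simp: N_def)
      then obtain r i where "((\<lambda>x. Re (g x)) has_vector_derivative r) (at x)"
        "((\<lambda>x. Im (g x)) has_vector_derivative i) (at x)"
        by (meson vector_derivative_works)
      then have "(g has_vector_derivative (Complex r i)) (at x)"
        by (simp add: has_vector_derivative_complex_iff has_real_derivative_iff_has_vector_derivative)
      then show False using x by (auto intro: differentiableI_vector)
    qed
    ultimately show "x \<in> (\<Union>(p, q)\<in>?J. N p q)" by blast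
  qed
  ultimately show ?thesis by (rule negligible_subset)
qed

section \<open>The fundamental theorem of calculus for absolutely continuous functions\<close>

lemma negligible_open_cover:
  fixes N :: "'a::euclidean_space set"
  assumes "negligible N" "0 < e"
  obtains U where "open U" "N \<subseteq> U" "U \<in> lmeasurable" "measure lebesgue U < e"
proof -
  have N: "N \<in> sets lebesgue" using assms(1) by (rule negligible_imp_sets)
  obtain T where T: "open T" "N \<subseteq> T" "T - N \<in> lmeasurable" "measure lebesgue (T - N) < e"
    using sets_lebesgue_outer_open[OF N assms(2)] by (metis emeasure_eq_measure2 ennreal_less_iff measure_nonneg)
  have "T = (T - N) \<union> N" using T by blast
  moreover have "(T - N) \<union> N \<in> lmeasurable"
    using T(3) negligible_imp_measurable[OF assms(1)] by (rule fmeasurable.Un)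
  moreover have "measure lebesgue ((T - N) \<union> N) < e"
    using T assms(1) by (subst measure_Un_null_set) (auto simp: negligible_iff_null_sets)
  ultimately show ?thesis using that T by metis
qed

text \<open>
  The gauge at a point outside \<open>N\<close> comes from the derivative; at a point of \<open>N\<close> it is an open
  set of small measure around \<open>N\<close>. In a tagged division the intervals tagged in \<open>N\<close> then have small
  total length, so absolute continuity makes their increments small, and the remaining terms
  telescope up to the error in the derivative.
\<close>

theorem absolutely_continuous_FTC:
  assumes ac: "absolutely_continuous_on_interval a b g" and ab: "a \<le> b" and N: "negligible N"
    and deriv: "\<And>x. x \<in> {a..b} - N \<Longrightarrow> (g has_vector_derivative f x) (at x within {a..b})"
  shows "(f has_integral (g b - g a)) {a..b}"
proof -
  \<comment> \<open>On \<open>N\<close> the values of \<open>f\<close> are arbitrary, so they are replaced by zero.\<close>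
  define f0 where "f0 x = (if x \<in> N then 0 else f x)" for x
  have "(f0 has_integral (g b - g a)) {a..b}"
    unfolding has_integral_real
  proof (intro allI impI)
    fix e :: real assume e: "e > 0"
    obtain \<delta> where \<delta>: "\<delta> > 0" and small: "\<And>D. disjoint_intervals a b D \<Longrightarrow> (\<Sum>I\<in>D. snd I - fst I) < \<delta> \<Longrightarrow>
      (\<Sum>I\<in>D. cmod (g (snd I) - g (fst I))) < e / 2"
      by (rule absolutely_continuous_sum_intervals[OF ac half_gt_zero[OF e]]) blast
    obtain U where U: "open U" "N \<subseteq> U" "U \<in> lmeasurable" "measure lebesgue U < \<delta>"
      using negligible_open_cover[OF N \<delta>] by blast
    define \<eta> where "\<eta> = e / (2 * (b - a + 1))"
    have \<eta>: "\<eta> > 0" "\<eta> * (b - a) < e / 2" using e ab by (auto simp: \<eta>_def field_simps)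
    have "\<exists>r>0. \<forall>y\<in>{a..b}. \<bar>y - x\<bar> < r \<longrightarrow> cmod (g y - g x - (y - x) *\<^sub>R f x) \<le> \<eta> * \<bar>y - x\<bar>"
      if "x \<in> {a..b} - N" for x
      using deriv[OF that] \<eta> unfolding has_vector_derivative_def has_derivative_within_alt by auto
    then obtain r where r: "\<And>x. x \<in> {a..b} - N \<Longrightarrow> r x > 0"
      "\<And>x y. x \<in> {a..b} - N \<Longrightarrow> y \<in> {a..b} \<Longrightarrow> \<bar>y - x\<bar> < r x \<Longrightarrow>
         cmod (g y - g x - (y - x) *\<^sub>R f x) \<le> \<eta> * \<bar>y - x\<bar>"
      by metis
    define G where "G x = (if x \<in> N then U else if x \<in> {a..b} then ball x (r x) else ball x 1)" for x
    show "\<exists>\<gamma>. gauge \<gamma> \<and> (\<forall>\<D>. \<D> tagged_division_of {a..b} \<and> \<gamma> fine \<D> \<longrightarrow>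
        norm ((\<Sum>(x, k)\<in>\<D>. measure lborel k *\<^sub>R f0 x) - (g b - g a)) < e)"
    proof (intro exI[of _ G] conjI allI impI)
      show "gauge G" unfolding gauge_def G_def using U r by auto
    next
      fix p assume "p tagged_division_of {a..b} \<and> G fine p"
      then have p: "p tagged_division_of {a..b}" and fine: "G fine p" by auto
      have finp: "finite p" using p by auto
      have p': "\<exists>u v. k = {u..v} \<and> u \<le> x \<and> x \<le> v \<and> a \<le> u \<and> v \<le> b" if xk: "(x, k) \<in> p" for x k
      proof -
        obtain u v where uv: "k = cbox u v" using tagged_division_ofD(4)[OF p xk] by blast
        moreover have "x \<in> k" "k \<subseteq> {a..b}" using tagged_division_ofD(2,3)[OF p xk] by auto
        ultimately show ?thesis by auto
      qed
      define S where "S = {(x, k) \<in> p. x \<in> N \<and> measure lborel k \<noteq> 0}"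
      define err where "err z = (case z of (x, k) \<Rightarrow> measure lborel k *\<^sub>R f0 x - (g (Sup k) - g (Inf k)))" for z
      define D where "D = (\<lambda>(x, k). (Inf k :: real, Sup k :: real)) ` S"
      have SN: "x \<in> N" "\<exists>u v. k = {u..v} \<and> u < v \<and> u \<le> x \<and> x \<le> v \<and> a \<le> u \<and> v \<le> b \<and> {u..v} \<subseteq> U"
        if "(x, k) \<in> S" for x k
      proof -
        have xk: "(x, k) \<in> p" "x \<in> N" "measure lborel k \<noteq> 0" using that by (auto simp: S_def)
        then show "x \<in> N" by simp
        obtain u v where uv: "k = {u..v}" "u \<le> x" "x \<le> v" "a \<le> u" "v \<le> b" using p' xk by blast
        have "u \<noteq> v" using xk uv by auto
        moreover have "k \<subseteq> G x" using fine xk by (auto simp: fine_def)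
        ultimately show "\<exists>u v. k = {u..v} \<and> u < v \<and> u \<le> x \<and> x \<le> v \<and> a \<le> u \<and> v \<le> b \<and> {u..v} \<subseteq> U"
          using uv xk by (intro exI[of _ u] exI[of _ v]) (auto simp: G_def)
      qed
      have disj: "disjnt {Inf k<..<Sup k} {Inf k'<..<Sup k'}"
        if S12: "(x, k) \<in> S" "(x', k') \<in> S" "(x, k) \<noteq> (x', k')" for x k x' k'
      proof -
        have "interior k \<inter> interior k' = {}"
          using S12 p by (intro tagged_division_ofD(5)[OF p, of x k x' k']) (auto simp: S_def)
        moreover obtain u v where "k = {u..v}" "u < v" using SN(2)[OF S12(1)] by blast
        moreover obtain u' v' where "k' = {u'..v'}" "u' < v'" using SN(2)[OF S12(2)] by blast
        ultimately show ?thesis by (auto simp: disjnt_def interior_atLeastAtMost_real)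
      qed
      have inj: "inj_on (\<lambda>(x, k). (Inf k :: real, Sup k :: real)) S"
      proof (rule inj_onI, clarify)
        fix x k x' k' assume z: "(x, k) \<in> S" "(x', k') \<in> S" "Inf k = Inf k'" "Sup k = Sup k'"
        obtain u v where "k = {u..v}" "u < v" using SN(2)[OF z(1)] by blast
        then have "(u + v) / 2 \<in> {Inf k<..<Sup k}" by simp
        then have "\<not> disjnt {Inf k<..<Sup k} {Inf k'<..<Sup k'}" using z(3,4) by (auto simp: disjnt_def)
        then show "x = x' \<and> k = k'" using disj[OF z(1,2)] by blast
      qed
      have finS: "finite S" using finp by (auto simp: S_def intro: finite_subset)
      have D: "disjoint_intervals a b D"
        unfolding disjoint_intervals_def
      proof (intro conjI ballI)
        show "finite D" using finS by (simp add: D_def)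
        show "pairwise (\<lambda>I J. nonoverlapping I J) D"
          unfolding pairwise_def D_def using disj by fastforce
        fix I assume "I \<in> D"
        then obtain x k where xk: "(x, k) \<in> S" "I = (Inf k, Sup k)" by (auto simp: D_def)
        then obtain u v where "k = {u..v}" "u < v" "a \<le> u" "v \<le> b" using SN(2) by blast
        then show "a \<le> fst I" "fst I < snd I" "snd I \<le> b" using xk by auto
      qed
      have "(\<Sum>I\<in>D. snd I - fst I) < \<delta>"
      proof -
        have lt: "fst I < snd I" "{fst I<..<snd I} \<subseteq> U" if I: "I \<in> D" for I
        proof -
          obtain x k where xk: "(x, k) \<in> S" "I = (Inf k, Sup k)" using I by (auto simp: D_def)
          then obtain u v where "k = {u..v}" "u < v" "{u..v} \<subseteq> U" using SN(2) by blast
          then show "fst I < snd I" "{fst I<..<snd I} \<subseteq> U" using xk by (auto simp: subset_iff)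
        qed
        have dfam: "disjoint_family_on (\<lambda>I. {fst I<..<snd I}) D"
          using D unfolding disjoint_intervals_def pairwise_def disjnt_def disjoint_family_on_def by blast
        have "(\<Sum>I\<in>D. snd I - fst I) = (\<Sum>I\<in>D. measure lebesgue {fst I<..<snd I})"
          using lt by (intro sum.cong) (auto simp: less_imp_le)
        also have "\<dots> = measure lebesgue (\<Union>I\<in>D. {fst I<..<snd I})"
          using dfam D lt
          by (intro measure_finite_Union[symmetric]) (auto simp: disjoint_intervals_def less_imp_le)
        also have "\<dots> \<le> measure lebesgue U"
        proof (rule measure_mono_fmeasurable)
          show "(\<Union>I\<in>D. {fst I<..<snd I}) \<subseteq> U" using lt by blast
          show "(\<Union>I\<in>D. {fst I<..<snd I}) \<in> sets lebesgue" by (auto simp: D_def intro!: sets.finite_UN finS)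
        qed (rule U)
        finally show ?thesis using U by simp
      qed
      from small[OF D this] have "(\<Sum>I\<in>D. cmod (g (snd I) - g (fst I))) < e / 2" .
      also have "(\<Sum>I\<in>D. cmod (g (snd I) - g (fst I))) = (\<Sum>z\<in>S. cmod (err z))"
        unfolding D_def sum.reindex[OF inj]
        using SN(1) by (intro sum.cong) (auto simp: err_def f0_def norm_minus_commute)
      finally have 1: "(\<Sum>z\<in>S. cmod (err z)) < e / 2" .
      have "cmod (err z) \<le> \<eta> * measure lborel (snd z)" if z: "z \<in> p - S" for z
      proof -
        obtain x k where zk: "z = (x, k)" by (cases z)
        then have xk: "(x, k) \<in> p" "x \<in> N \<Longrightarrow> measure lborel k = 0" using z by (auto simp: S_def)
        obtain u v where uv: "k = {u..v}" "u \<le> x" "x \<le> v" "a \<le> u" "v \<le> b" using p'[OF xk(1)] by blast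
        show ?thesis
        proof (cases "x \<in> N")
          case True
          then have "u = v" using xk uv by auto
          then show ?thesis using uv zk by (simp add: err_def)
        next
          case False
          then have x: "x \<in> {a..b} - N" using uv by auto
          have "k \<subseteq> G x" using fine xk by (auto simp: fine_def)
          moreover have "G x = ball x (r x)" using x by (simp add: G_def)
          ultimately have "k \<subseteq> ball x (r x)" by simp
          moreover have "u \<in> k" "v \<in> k" using uv by auto
          ultimately have "u \<in> ball x (r x)" "v \<in> ball x (r x)" by (blast dest: subsetD)+
          then have "\<bar>u - x\<bar> < r x" "\<bar>v - x\<bar> < r x" by (auto simp: dist_real_def)
          then have 1: "cmod (g u - g x - (u - x) *\<^sub>R f x) \<le> \<eta> * \<bar>u - x\<bar>"
            and 2: "cmod (g v - g x - (v - x) *\<^sub>R f x) \<le> \<eta> * \<bar>v - x\<bar>"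
            using r(2)[OF x, of u] r(2)[OF x, of v] uv by auto
          have "err z = (g u - g x - (u - x) *\<^sub>R f x) - (g v - g x - (v - x) *\<^sub>R f x)"
            using uv False zk by (simp add: err_def f0_def algebra_simps)
          then have "cmod (err z) \<le> \<eta> * \<bar>u - x\<bar> + \<eta> * \<bar>v - x\<bar>"
            using norm_triangle_le_diff[OF add_mono[OF 1 2]] by simp
          also have "\<dots> = \<eta> * measure lborel (snd z)" using uv zk by (simp add: algebra_simps)
          finally show ?thesis .
        qed
      qed
      then have "(\<Sum>z\<in>p - S. cmod (err z)) \<le> (\<Sum>z\<in>p - S. \<eta> * measure lborel (snd z))" by (rule sum_mono)
      also have "\<dots> \<le> (\<Sum>z\<in>p. \<eta> * measure lborel (snd z))"
        using finp \<eta> by (intro sum_mono2) auto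
      also have "\<dots> = \<eta> * (\<Sum>(x, k)\<in>p. measure lborel k)" by (simp add: sum_distrib_left case_prod_unfold)
      also have "\<dots> = \<eta> * (b - a)"
        using additive_content_tagged_division[of p a b] p ab by (simp add: cbox_interval)
      finally have 2: "(\<Sum>z\<in>p - S. cmod (err z)) < e / 2" using \<eta> by simp
      have "(\<Sum>(x, k)\<in>p. measure lborel k *\<^sub>R f0 x) - (g b - g a) = (\<Sum>z\<in>p. err z)"
        using additive_tagged_division_1[OF ab p, of g] by (simp add: err_def case_prod_unfold sum_subtractf)
      also have "norm \<dots> \<le> (\<Sum>z\<in>p. cmod (err z))" by (rule norm_sum)
      also have "\<dots> = (\<Sum>z\<in>p - S. cmod (err z)) + (\<Sum>z\<in>S. cmod (err z))"
        using finp by (intro sum.subset_diff) (auto simp: S_def)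
      finally show "norm ((\<Sum>(x, k)\<in>p. measure lborel k *\<^sub>R f0 x) - (g b - g a)) < e" using 1 2 by simp
    qed
  qed
  then show ?thesis by (rule has_integral_spike[OF N, rotated]) (simp add: f0_def)
qed

lemma absolutely_continuous_imp_continuous:
  assumes ac: "absolutely_continuous_on_interval a b g"
  shows "continuous_on {a..b} g"
  unfolding continuous_on_iff
proof (intro ballI allI impI)
  fix x e :: real assume x: "x \<in> {a..b}" and e: "0 < e"
  obtain \<delta> where \<delta>: "\<delta> > 0" and small: "\<And>D. disjoint_intervals a b D \<Longrightarrow> (\<Sum>I\<in>D. snd I - fst I) < \<delta> \<Longrightarrow>
      (\<Sum>I\<in>D. cmod (g (snd I) - g (fst I))) < e"
    using absolutely_continuous_sum_intervals[OF ac e] by metis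
  have *: "cmod (g v - g u) < e" if "a \<le> u" "u < v" "v \<le> b" "v - u < \<delta>" for u v
    using small[of "{(u, v)}"] that by (simp add: disjoint_intervals_def)
  have "dist (g y) (g x) < e" if "y \<in> {a..b}" "dist y x < \<delta>" for y
    using *[of x y] *[of y x] that x e by (cases x y rule: linorder_cases) (auto simp: dist_norm norm_minus_commute)
  then show "\<exists>d>0. \<forall>x'\<in>{a..b}. dist x' x < d \<longrightarrow> dist (g x') (g x) < e" using \<delta> by blast
qed

lemma absolutely_continuous_mult_C1:
  assumes ac: "absolutely_continuous_on_interval a b g" and ab: "a \<le> b"
    and \<phi>: "\<And>x. x \<in> {a..b} \<Longrightarrow> (\<phi> has_vector_derivative \<phi>' x) (at x within {a..b})"
    and \<phi>': "continuous_on {a..b} \<phi>'"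
  shows "absolutely_continuous_on_interval a b (\<lambda>x. \<phi> x * g x)"
  unfolding absolutely_continuous_on_interval_def
proof (intro allI impI)
  fix \<epsilon> :: real assume \<epsilon>: "\<epsilon> > 0"
  have cont: "continuous_on {a..b} g" "continuous_on {a..b} \<phi>"
    using absolutely_continuous_imp_continuous[OF ac] continuous_on_vector_derivative[OF \<phi>] by auto
  have bdd: "\<exists>B>0. \<forall>x\<in>{a..b}. cmod (f x) \<le> B" if "continuous_on {a..b} f" for f :: "real \<Rightarrow> complex"
    using compact_imp_bounded[OF compact_continuous_image[OF that compact_Icc]] by (auto simp: bounded_pos)
  obtain A B L where A: "A > 0" "\<And>x. x \<in> {a..b} \<Longrightarrow> cmod (\<phi> x) \<le> A"
    and B: "B > 0" "\<And>x. x \<in> {a..b} \<Longrightarrow> cmod (g x) \<le> B"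
    and L: "L > 0" "\<And>x. x \<in> {a..b} \<Longrightarrow> cmod (\<phi>' x) \<le> L"
    using bdd[OF cont(1)] bdd[OF cont(2)] bdd[OF \<phi>'] by metis
  have lip: "cmod (\<phi> v - \<phi> u) \<le> L * (v - u)" if "a \<le> u" "u < v" "v \<le> b" for u v
  proof -
    have "cmod (\<phi> v - \<phi> u) \<le> L * norm (v - u)"
    proof (rule differentiable_bound[of "{a..b}" \<phi> "\<lambda>x h. h *\<^sub>R \<phi>' x"])
      fix x assume x: "x \<in> {a..b}"
      then show "(\<phi> has_derivative (\<lambda>h. h *\<^sub>R \<phi>' x)) (at x within {a..b})"
        using \<phi> by (simp add: has_vector_derivative_def)
      show "onorm (\<lambda>h. h *\<^sub>R \<phi>' x) \<le> L"
      proof (rule onorm_le)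
        show "norm (y *\<^sub>R \<phi>' x) \<le> L * norm y" for y
          using mult_left_mono[OF L(2)[OF x], of "\<bar>y\<bar>"] by (simp add: mult.commute)
      qed
    qed (use that in auto)
    then show ?thesis using that by simp
  qed
  define \<eta> where "\<eta> = \<epsilon> / (2 * A)"
  have \<eta>: "\<eta> > 0" using A \<epsilon> by (simp add: \<eta>_def)
  obtain \<delta> where \<delta>: "\<delta> > 0" and small: "\<And>(n::nat) (u::nat \<Rightarrow> real) v.
      (\<forall>i<n. a \<le> u i \<and> u i < v i \<and> v i \<le> b) \<Longrightarrow> disjoint_family_on (\<lambda>i. {u i<..<v i}) {..<n} \<Longrightarrow>
      (\<Sum>i<n. v i - u i) < \<delta> \<Longrightarrow> (\<Sum>i<n. cmod (g (v i) - g (u i))) < \<eta>"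
    using ac \<eta> unfolding absolutely_continuous_on_interval_def by meson
  define \<delta>' where "\<delta>' = min \<delta> (\<epsilon> / (2 * (B * L)))"
  have \<delta>': "\<delta>' > 0" using \<delta> \<epsilon> B L by (simp add: \<delta>'_def)
  show "\<exists>\<delta>>0. \<forall>(n::nat) (u::nat \<Rightarrow> real) v. (\<forall>i<n. a \<le> u i \<and> u i < v i \<and> v i \<le> b) \<longrightarrow>
      disjoint_family_on (\<lambda>i. {u i<..<v i}) {..<n} \<longrightarrow> (\<Sum>i<n. v i - u i) < \<delta> \<longrightarrow>
      (\<Sum>i<n. cmod (\<phi> (v i) * g (v i) - \<phi> (u i) * g (u i))) < \<epsilon>"
  proof (intro exI[of _ \<delta>'] conjI allI impI \<delta>')
    fix n :: nat and u v :: "nat \<Rightarrow> real"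
    assume uv: "\<forall>i<n. a \<le> u i \<and> u i < v i \<and> v i \<le> b"
      and dis: "disjoint_family_on (\<lambda>i. {u i<..<v i}) {..<n}" and len: "(\<Sum>i<n. v i - u i) < \<delta>'"
    have "cmod (\<phi> (v i) * g (v i) - \<phi> (u i) * g (u i)) \<le> A * cmod (g (v i) - g (u i)) + B * L * (v i - u i)"
      if "i < n" for i
    proof -
      have uvi: "a \<le> u i" "u i < v i" "v i \<le> b" using uv that by auto
      have "\<phi> (v i) * g (v i) - \<phi> (u i) * g (u i) =
          \<phi> (v i) * (g (v i) - g (u i)) + g (u i) * (\<phi> (v i) - \<phi> (u i))"
        by (simp add: algebra_simps)
      also have "cmod \<dots> \<le> cmod (\<phi> (v i)) * cmod (g (v i) - g (u i)) + cmod (g (u i)) * cmod (\<phi> (v i) - \<phi> (u i))"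
        by (metis norm_mult norm_triangle_ineq)
      also have "\<dots> \<le> A * cmod (g (v i) - g (u i)) + B * (L * (v i - u i))"
        using uvi lip[OF uvi] A B by (intro add_mono mult_mono) auto
      finally show ?thesis by (simp add: mult.assoc)
    qed
    then have "(\<Sum>i<n. cmod (\<phi> (v i) * g (v i) - \<phi> (u i) * g (u i))) \<le>
        (\<Sum>i<n. A * cmod (g (v i) - g (u i)) + B * L * (v i - u i))" by (intro sum_mono) auto
    also have "\<dots> = A * (\<Sum>i<n. cmod (g (v i) - g (u i))) + B * L * (\<Sum>i<n. v i - u i)"
      by (simp add: sum.distrib sum_distrib_left)
    also have "\<dots> < A * \<eta> + B * L * \<delta>'"
    proof (rule add_strict_mono)
      show "A * (\<Sum>i<n. cmod (g (v i) - g (u i))) < A * \<eta>"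
        using small[OF uv dis] len A by (simp add: \<delta>'_def)
      show "B * L * (\<Sum>i<n. v i - u i) < B * L * \<delta>'" using len B L by simp
    qed
    also have "\<dots> \<le> \<epsilon> / 2 + \<epsilon> / 2"
    proof (rule add_mono)
      show "A * \<eta> \<le> \<epsilon> / 2" using A by (simp add: \<eta>_def)
      have "B * L * \<delta>' \<le> B * L * (\<epsilon> / (2 * (B * L)))" using B L by (intro mult_left_mono) (auto simp: \<delta>'_def)
      also have "\<dots> = \<epsilon> / 2" using B L by (simp add: field_simps)
      finally show "B * L * \<delta>' \<le> \<epsilon> / 2" .
    qed
    finally show "(\<Sum>i<n. cmod (\<phi> (v i) * g (v i) - \<phi> (u i) * g (u i))) < \<epsilon>" by simp
  qed
qed

text \<open>
  The product with a continuously differentiable factor is absolutely continuous, so the fundamental theorem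
  applies to it.
\<close>

lemma absolutely_continuous_integration_by_parts:
  assumes ac: "absolutely_continuous_on_interval a b g" and ab: "a \<le> b" and N: "negligible N"
    and g: "\<And>x. x \<in> {a..b} - N \<Longrightarrow> (g has_vector_derivative h x) (at x)"
    and \<phi>: "\<And>x. x \<in> {a..b} \<Longrightarrow> (\<phi> has_vector_derivative \<phi>' x) (at x within {a..b})"
    and \<phi>': "continuous_on {a..b} \<phi>'"
  shows "((\<lambda>x. \<phi> x * h x) has_integral (\<phi> b * g b - \<phi> a * g a - integral {a..b} (\<lambda>x. \<phi>' x * g x))) {a..b}"
proof -
  have "((\<lambda>x. \<phi> x * h x + \<phi>' x * g x) has_integral (\<phi> b * g b - \<phi> a * g a)) {a..b}"
  proof (rule absolutely_continuous_FTC[OF absolutely_continuous_mult_C1[OF ac ab \<phi> \<phi>'] ab N])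
    fix x assume x: "x \<in> {a..b} - N"
    show "((\<lambda>x. \<phi> x * g x) has_vector_derivative \<phi> x * h x + \<phi>' x * g x) (at x within {a..b})"
      using x by (intro has_vector_derivative_mult \<phi> has_vector_derivative_at_within[OF g]) auto
  qed auto
  moreover have "((\<lambda>x. \<phi>' x * g x) has_integral integral {a..b} (\<lambda>x. \<phi>' x * g x)) {a..b}"
    using \<phi>' absolutely_continuous_imp_continuous[OF ac]
    by (intro integrable_integral integrable_continuous_real continuous_on_mult)
  ultimately have "((\<lambda>x. \<phi> x * h x + \<phi>' x * g x - \<phi>' x * g x) has_integral
      (\<phi> b * g b - \<phi> a * g a - integral {a..b} (\<lambda>x. \<phi>' x * g x))) {a..b}"
    by (rule has_integral_diff)
  then show ?thesis by simp
qed

section \<open>Wirtinger derivatives of the Poisson kernel\<close>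

text \<open>
  The real differential of \<open>f\<close> at \<open>z\<close>, split into its complex linear and antilinear parts; \<open>a\<close> and \<open>b\<close>
  are the values of \<open>dz f\<close> and \<open>dzbar f\<close> at \<open>z\<close>.
\<close>

definition has_wirtinger :: "(complex \<Rightarrow> complex) \<Rightarrow> complex \<Rightarrow> complex \<Rightarrow> complex \<Rightarrow> bool" where
  "has_wirtinger f z a b \<longleftrightarrow> (f has_derivative (\<lambda>h. a * h + b * cnj h)) (at z)"

lemma has_wirtinger_const: "has_wirtinger (\<lambda>z. c) z 0 0"
  by (simp add: has_wirtinger_def)

lemma has_wirtinger_id: "has_wirtinger (\<lambda>z. z) z 1 0"
  by (simp add: has_wirtinger_def)

lemma has_wirtinger_cnj: "has_wirtinger cnj z 0 1"
  by (simp add: has_wirtinger_def bounded_linear_imp_has_derivative bounded_linear_cnj)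

lemma has_wirtinger_add:
  "has_wirtinger f z a b \<Longrightarrow> has_wirtinger g z a' b' \<Longrightarrow> has_wirtinger (\<lambda>z. f z + g z) z (a + a') (b + b')"
  unfolding has_wirtinger_def
  by (drule (1) has_derivative_add, erule has_derivative_eq_rhs) (auto simp: algebra_simps)

lemma has_wirtinger_mult:
  "has_wirtinger f z a b \<Longrightarrow> has_wirtinger g z a' b' \<Longrightarrow>
    has_wirtinger (\<lambda>z. f z * g z) z (a * g z + f z * a') (b * g z + f z * b')"
  unfolding has_wirtinger_def
  by (drule (1) has_derivative_mult, erule has_derivative_eq_rhs) (auto simp: algebra_simps)

lemma has_wirtinger_compose_holomorphic:
  assumes "has_wirtinger f z a b" "(F has_field_derivative d) (at (f z))"
  shows "has_wirtinger (\<lambda>z. F (f z)) z (d * a) (d * b)"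
proof -
  have "(F has_derivative (*) d) (at (f z))" using assms(2) by (simp add: has_field_derivative_def)
  from has_derivative_compose[OF assms(1)[unfolded has_wirtinger_def] this]
  show ?thesis unfolding has_wirtinger_def by (rule has_derivative_eq_rhs) (auto simp: algebra_simps)
qed

lemma has_wirtinger_transform:
  assumes "has_wirtinger f z a b" "open S" "z \<in> S" "\<And>w. w \<in> S \<Longrightarrow> f w = g w"
  shows "has_wirtinger g z a b"
  unfolding has_wirtinger_def
  by (rule has_derivative_transform_within_open[OF assms(1)[unfolded has_wirtinger_def] assms(2,3)])
     (use assms(4) in auto)

lemma has_wirtinger_directional:
  assumes "has_wirtinger f (z + c * of_real x) a b"
  shows "((\<lambda>t::real. f (z + c * of_real t)) has_vector_derivative (a * c + b * cnj c)) (at x)"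
proof -
  have "((\<lambda>t::real. z + c * of_real t) has_derivative (\<lambda>t. c * of_real t)) (at x)"
    by (auto intro!: derivative_eq_intros)
  moreover have "(f has_derivative (\<lambda>h. a * h + b * cnj h)) (at (z + c * of_real x))"
    using assms by (simp add: has_wirtinger_def)
  ultimately have "((\<lambda>t::real. f (z + c * of_real t)) has_derivative
      (\<lambda>t. a * (c * of_real t) + b * cnj (c * of_real t))) (at x)"
    by (rule has_derivative_compose)
  then show ?thesis
    unfolding has_vector_derivative_def
    by (rule has_derivative_eq_rhs) (auto simp: algebra_simps scaleR_conv_of_real)
qed

lemma has_wirtinger_imp:
  assumes "has_wirtinger f z a b"
  shows "dx f z = a + b" "dy f z = \<i> * (a - b)" "dz f z = a" "dzbar f z = b"
    "(\<lambda>t::real. f (z + of_real t)) differentiable (at 0)"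
    "(\<lambda>t::real. f (z + \<i> * of_real t)) differentiable (at 0)"
proof -
  have hz: "has_wirtinger f (z + c * of_real 0) a b" for c using assms by simp
  note x = has_wirtinger_directional[OF hz, of 1, simplified]
  note y = has_wirtinger_directional[OF hz, of "\<i>", simplified]
  show dx: "dx f z = a + b" unfolding dx_def using x by (rule vector_derivative_at)
  show dy: "dy f z = \<i> * (a - b)"
    unfolding dy_def using vector_derivative_at[OF y] by (simp add: algebra_simps)
  show "dz f z = a" "dzbar f z = b" unfolding dz_def dzbar_def dx dy by (auto simp: field_simps)
  show "(\<lambda>t::real. f (z + of_real t)) differentiable (at 0)"
    "(\<lambda>t::real. f (z + \<i> * of_real t)) differentiable (at 0)"
    using x y by (auto intro: differentiableI_vector)
qed

text \<open>
  A class of functions with closure rules, so that smoothness of a function given by a closed formula can be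
  read off the formula.
\<close>

definition wirtinger_C1 :: "complex set \<Rightarrow> (complex \<Rightarrow> complex) \<Rightarrow> bool" where
  "wirtinger_C1 S f \<longleftrightarrow> (\<exists>A B. (\<forall>z\<in>S. has_wirtinger f z (A z) (B z)) \<and> continuous_on S A \<and> continuous_on S B)"

lemma has_wirtinger_imp_continuous_on:
  "(\<And>z. z \<in> S \<Longrightarrow> has_wirtinger f z (A z) (B z)) \<Longrightarrow> continuous_on S f"
  unfolding has_wirtinger_def
  by (intro has_derivative_continuous_on) (blast intro: has_derivative_at_withinI)

lemma wirtinger_C1_imp_continuous:
  assumes "wirtinger_C1 S f"
  shows "continuous_on S f"
proof -
  obtain A B where "\<And>z. z \<in> S \<Longrightarrow> has_wirtinger f z (A z) (B z)"
    using assms by (auto simp: wirtinger_C1_def)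
  then show ?thesis by (rule has_wirtinger_imp_continuous_on)
qed

lemma wirtinger_C1_const: "wirtinger_C1 S (\<lambda>z. c)"
  unfolding wirtinger_C1_def using has_wirtinger_const by (intro exI[of _ "\<lambda>z. 0"]) auto

lemma wirtinger_C1_id: "wirtinger_C1 S (\<lambda>z. z)"
  unfolding wirtinger_C1_def using has_wirtinger_id
  by (intro exI[of _ "\<lambda>z. 1"] exI[of _ "\<lambda>z. 0"]) auto

lemma wirtinger_C1_cnj: "wirtinger_C1 S cnj"
  unfolding wirtinger_C1_def using has_wirtinger_cnj
  by (intro exI[of _ "\<lambda>z. 0"] exI[of _ "\<lambda>z. 1"]) auto

lemma wirtinger_C1_add: "wirtinger_C1 S f \<Longrightarrow> wirtinger_C1 S g \<Longrightarrow> wirtinger_C1 S (\<lambda>z. f z + g z)"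
  unfolding wirtinger_C1_def
proof (elim exE conjE)
  fix A B A' B'
  assume "\<forall>z\<in>S. has_wirtinger f z (A z) (B z)" "\<forall>z\<in>S. has_wirtinger g z (A' z) (B' z)"
    "continuous_on S A" "continuous_on S B" "continuous_on S A'" "continuous_on S B'"
  then show "\<exists>A B. (\<forall>z\<in>S. has_wirtinger (\<lambda>z. f z + g z) z (A z) (B z)) \<and> continuous_on S A \<and> continuous_on S B"
    by (intro exI[of _ "\<lambda>z. A z + A' z"] exI[of _ "\<lambda>z. B z + B' z"])
       (auto intro: has_wirtinger_add continuous_intros)
qed

lemma wirtinger_C1_mult: "wirtinger_C1 S f \<Longrightarrow> wirtinger_C1 S g \<Longrightarrow> wirtinger_C1 S (\<lambda>z. f z * g z)"
  unfolding wirtinger_C1_def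
proof (elim exE conjE)
  fix A B A' B'
  assume *: "\<forall>z\<in>S. has_wirtinger f z (A z) (B z)" "\<forall>z\<in>S. has_wirtinger g z (A' z) (B' z)"
    "continuous_on S A" "continuous_on S B" "continuous_on S A'" "continuous_on S B'"
  then have "continuous_on S f" "continuous_on S g" by (auto intro: has_wirtinger_imp_continuous_on)
  then show "\<exists>A B. (\<forall>z\<in>S. has_wirtinger (\<lambda>z. f z * g z) z (A z) (B z)) \<and> continuous_on S A \<and> continuous_on S B"
    using * by (intro exI[of _ "\<lambda>z. A z * g z + f z * A' z"] exI[of _ "\<lambda>z. B z * g z + f z * B' z"])
       (auto intro: has_wirtinger_mult continuous_intros)
qed

lemma wirtinger_C1_powr:
  assumes "wirtinger_C1 S f" "\<And>z. z \<in> S \<Longrightarrow> f z \<notin> \<real>\<^sub>\<le>\<^sub>0"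
  shows "wirtinger_C1 S (\<lambda>z. f z powr c)"
proof -
  obtain A B where *: "\<forall>z\<in>S. has_wirtinger f z (A z) (B z)" "continuous_on S A" "continuous_on S B"
    using assms(1) by (auto simp: wirtinger_C1_def)
  have f: "continuous_on S f" using * by (auto intro: has_wirtinger_imp_continuous_on)
  have 0: "f z \<noteq> 0" if "z \<in> S" for z using assms(2)[OF that] by auto
  show ?thesis unfolding wirtinger_C1_def
  proof (intro exI conjI ballI)
    fix z assume z: "z \<in> S"
    then have "has_wirtinger f z (A z) (B z)" using * by blast
    then show "has_wirtinger (\<lambda>z. f z powr c) z (c * f z powr (c - 1) * A z) (c * f z powr (c - 1) * B z)"
      by (rule has_wirtinger_compose_holomorphic) (use assms(2)[OF z] in \<open>auto intro: has_field_derivative_powr\<close>)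
  next
    have "continuous_on S (\<lambda>z. f z powr (c - 1))"
    proof (rule continuous_on_powr_complex)
      show "S \<subseteq> {z. Re (f z) \<ge> 0 \<or> Im (f z) \<noteq> 0}"
        using assms(2) by (fastforce simp: complex_nonpos_Reals_iff)
      show "\<And>z. z \<in> S \<Longrightarrow> f z = 0 \<Longrightarrow> 0 < Re (c - 1)" using 0 by blast
    qed (intro continuous_intros f)+
    then show "continuous_on S (\<lambda>z. c * f z powr (c - 1) * A z)" "continuous_on S (\<lambda>z. c * f z powr (c - 1) * B z)"
      by (intro continuous_on_mult continuous_on_const *(2,3), assumption)+
  qed
qed

lemma wirtinger_C1_imp_C1_on:
  assumes "wirtinger_C1 S f" "open S" "\<And>z. z \<in> S \<Longrightarrow> f z = g z"
  shows "C1_on S g"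
proof -
  obtain A B where *: "\<forall>z\<in>S. has_wirtinger f z (A z) (B z)" "continuous_on S A" "continuous_on S B"
    using assms(1) by (auto simp: wirtinger_C1_def)
  then have g: "has_wirtinger g z (A z) (B z)" if "z \<in> S" for z
    using assms has_wirtinger_transform that by blast
  have "continuous_on S (dx g)"
    using continuous_on_add[OF *(2,3)] by (rule continuous_on_eq) (use has_wirtinger_imp[OF g] in simp)
  moreover have "continuous_on S (\<lambda>z. \<i> * (A z - B z))" by (intro continuous_intros *)
  then have "continuous_on S (dy g)"
    by (rule continuous_on_eq) (use has_wirtinger_imp[OF g] in simp)
  ultimately show ?thesis unfolding C1_on_def using has_wirtinger_imp[OF g] by auto
qed

lemma wirtinger_C2:
  assumes f: "\<And>z. z \<in> S \<Longrightarrow> has_wirtinger f z (A z) (B z)" and S: "open S"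
    and A: "wirtinger_C1 S A" and B: "wirtinger_C1 S B"
  shows "C2_on S f"
  unfolding C2_on_def
proof (intro conjI)
  have "wirtinger_C1 S f"
    unfolding wirtinger_C1_def using f wirtinger_C1_imp_continuous[OF A] wirtinger_C1_imp_continuous[OF B] by blast
  then show "C1_on S f" using S by (rule wirtinger_C1_imp_C1_on) simp
  show "C1_on S (dx f)"
    using wirtinger_C1_add[OF A B] S by (rule wirtinger_C1_imp_C1_on) (simp add: has_wirtinger_imp[OF f])
  have "wirtinger_C1 S (\<lambda>z. \<i> * (A z + (- 1) * B z))"
    by (intro wirtinger_C1_mult wirtinger_C1_add wirtinger_C1_const A B)
  then show "C1_on S (dy f)" using S by (rule wirtinger_C1_imp_C1_on) (simp add: has_wirtinger_imp[OF f])
qed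

lemma norm_powr_of_real:
  fixes v :: complex
  shows "v \<noteq> 0 \<Longrightarrow> cmod (v powr of_real c) = cmod v powr c"
  by (simp add: powr_def)

text \<open>
  The Wirtinger derivatives of the kernel. Differences are written as sums with a factor \<open>- 1\<close> so
  that the closure rules of \<open>wirtinger_C1\<close> match them literally.
\<close>

definition kernel_dzbar :: "real \<Rightarrow> complex \<Rightarrow> complex" where
  "kernel_dzbar \<alpha> z = of_real (\<alpha> + 1) * ((1 + (- 1) * (z * cnj z)) powr of_real \<alpha> *
     (1 + (- 1) * cnj z) powr of_real (- (\<alpha> + 2)))"

definition kernel_dz :: "real \<Rightarrow> complex \<Rightarrow> complex" where
  "kernel_dz \<alpha> z = (1 + (- 1) * (z * cnj z)) powr of_real \<alpha> *
     ((1 + (- 1) * cnj z) powr of_real (- (\<alpha> + 1)) *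
     ((1 + (- 1) * z) powr (- 2) * (1 + (of_real \<alpha> * (z * cnj z) + of_real (- (\<alpha> + 1)) * cnj z))))"

lemma disk_pos:
  assumes "z \<in> ball 0 1"
  shows "0 < 1 - (cmod z)\<^sup>2" "1 - z * cnj z = of_real (1 - (cmod z)\<^sup>2)" "1 - z * cnj z \<notin> \<real>\<^sub>\<le>\<^sub>0"
    "1 - z \<notin> \<real>\<^sub>\<le>\<^sub>0" "1 - cnj z \<notin> \<real>\<^sub>\<le>\<^sub>0" "1 - z \<noteq> 0" "1 - cnj z \<noteq> 0"
proof -
  have z: "cmod z < 1" using assms by simp
  then show 1: "0 < 1 - (cmod z)\<^sup>2" by (simp add: abs_square_less_1)
  show 2: "1 - z * cnj z = of_real (1 - (cmod z)\<^sup>2)"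
    by (simp only: of_real_diff complex_norm_square of_real_1)
  show "1 - z * cnj z \<notin> \<real>\<^sub>\<le>\<^sub>0" unfolding 2 complex_nonpos_Reals_iff using 1 by simp
  have "Re z < 1" using z abs_Re_le_cmod[of z] by linarith
  then show "1 - z \<notin> \<real>\<^sub>\<le>\<^sub>0" "1 - cnj z \<notin> \<real>\<^sub>\<le>\<^sub>0" "1 - z \<noteq> 0" "1 - cnj z \<noteq> 0"
    by (auto simp: complex_nonpos_Reals_iff complex_eq_iff)
qed

lemma disk_powr:
  assumes "z \<in> ball 0 1"
  shows "(1 - z * cnj z) powr of_real c = of_real ((1 - (cmod z)\<^sup>2) powr c)"
  unfolding disk_pos(2)[OF assms] using disk_pos(1)[OF assms] by (intro powr_of_real) simp

text \<open>
  With \<open>u = 1 - z * cnj z\<close> and \<open>v = 1 - cnj z\<close> the kernel is \<open>u powr \<beta> * v powr (- \<beta>) / (1 - z)\<close>. In the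
  derivative with respect to \<open>cnj z\<close> the identity \<open>u - z * v = 1 - z\<close> cancels the denominator.
\<close>

lemma has_wirtinger_kernel:
  assumes z: "z \<in> ball 0 1"
  shows "has_wirtinger (alpha_poisson_kernel \<alpha>) z (kernel_dz \<alpha> z) (kernel_dzbar \<alpha> z)"
proof -
  let ?\<beta> = "complex_of_real (\<alpha> + 1)"
  define u where "u = 1 - z * cnj z"
  define v where "v = 1 - cnj z"
  note d = disk_pos[OF z, folded u_def v_def]
  have hu: "has_wirtinger (\<lambda>z. 1 + (- 1) * (z * cnj z)) z (- cnj z) (- z)"
    using has_wirtinger_add[OF has_wirtinger_const[of 1 z] has_wirtinger_mult[OF has_wirtinger_const[of "-1" z]
      has_wirtinger_mult[OF has_wirtinger_id has_wirtinger_cnj[of z]]]] by simp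
  have hv: "has_wirtinger (\<lambda>z. 1 + (- 1) * cnj z) z 0 (- 1)"
    using has_wirtinger_add[OF has_wirtinger_const[of 1 z] has_wirtinger_mult[OF has_wirtinger_const[of "-1" z]
      has_wirtinger_cnj[of z]]] by simp
  have hw: "has_wirtinger (\<lambda>z. 1 + (- 1) * z) z (- 1) 0"
    using has_wirtinger_add[OF has_wirtinger_const[of 1 z] has_wirtinger_mult[OF has_wirtinger_const[of "-1" z]
      has_wirtinger_id[of z]]] by simp
  have u': "1 + (- 1) * (z * cnj z) = u" and v': "1 + (- 1) * cnj z = v" by (simp_all add: u_def v_def)
  have HU: "has_wirtinger (\<lambda>z. (1 + (- 1) * (z * cnj z)) powr ?\<beta>) z
      (?\<beta> * u powr (?\<beta> - 1) * (- cnj z)) (?\<beta> * u powr (?\<beta> - 1) * (- z))"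
    by (rule has_wirtinger_compose_holomorphic[OF hu, unfolded u', OF has_field_derivative_powr[OF d(3)]])
  have HV: "has_wirtinger (\<lambda>z. (1 + (- 1) * cnj z) powr (- ?\<beta>)) z
      (- ?\<beta> * v powr (- ?\<beta> - 1) * 0) (- ?\<beta> * v powr (- ?\<beta> - 1) * (- 1))"
    by (rule has_wirtinger_compose_holomorphic[OF hv, unfolded v', OF has_field_derivative_powr[OF d(5)]])
  have HW: "has_wirtinger (\<lambda>z. inverse (1 + (- 1) * z)) z
      (- (inverse (1 - z) ^ 2) * (- 1)) (- (inverse (1 - z) ^ 2) * 0)"
    using d by (intro has_wirtinger_compose_holomorphic[OF hw])
      (auto intro!: derivative_eq_intros simp: power2_eq_square)
  have main: "has_wirtinger
    (\<lambda>z. (1 + (- 1) * (z * cnj z)) powr ?\<beta> * ((1 + (- 1) * cnj z) powr (- ?\<beta>) * inverse (1 + (- 1) * z))) z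
    (?\<beta> * u powr (?\<beta> - 1) * (- cnj z) * (v powr (- ?\<beta>) * inverse (1 - z)) +
       u powr ?\<beta> * (v powr (- ?\<beta>) * inverse (1 - z) ^ 2))
    (?\<beta> * u powr (?\<beta> - 1) * (- z) * (v powr (- ?\<beta>) * inverse (1 - z)) +
       u powr ?\<beta> * (?\<beta> * v powr (- ?\<beta> - 1) * inverse (1 - z)))"
    (is "has_wirtinger ?f z ?a ?b")
    using has_wirtinger_mult[OF HU has_wirtinger_mult[OF HV HW]] by (simp add: u_def v_def algebra_simps)
  have pu: "u powr ?\<beta> = u powr of_real \<alpha> * u" using d by (simp add: powr_add)
  have "v powr (- ?\<beta>) = v powr (- ?\<beta> - 1 + 1)" by (rule arg_cong[where f = "\<lambda>x. v powr x"]) simp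
  also have "\<dots> = v powr (- ?\<beta> - 1) * v" using d by (subst powr_add) simp
  finally have pv: "v powr (- ?\<beta>) = v powr (- ?\<beta> - 1) * v" .
  have b: "?b = kernel_dzbar \<alpha> z"
  proof -
    have zv: "- z * v + u = 1 - z" by (simp add: u_def v_def algebra_simps)
    have "?b = ?\<beta> * u powr of_real \<alpha> * v powr (- ?\<beta> - 1) * ((- z * v + u) * inverse (1 - z))"
      unfolding pu pv by (simp add: algebra_simps)
    also have "(- z * v + u) * inverse (1 - z) = 1" unfolding zv using d(6) by simp
    finally have "?b = ?\<beta> * u powr of_real \<alpha> * v powr (- ?\<beta> - 1)" by (simp only: mult_1_right)
    moreover have e: "- ?\<beta> - 1 = of_real (- (\<alpha> + 2))" by simp
    ultimately have "?b = ?\<beta> * u powr of_real \<alpha> * v powr of_real (- (\<alpha> + 2))" by (simp only: e)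
    then show ?thesis unfolding kernel_dzbar_def u' v' by (simp only: mult.assoc)
  qed
  have a: "?a = kernel_dz \<alpha> z"
  proof -
    have X: "?\<beta> * (- cnj z) * (1 - z) + u = 1 + (of_real \<alpha> * (z * cnj z) + of_real (- (\<alpha> + 1)) * cnj z)"
      by (simp add: u_def algebra_simps)
    have i: "inverse (1 - z) = (1 - z) * inverse (1 - z) ^ 2" using d by (simp add: power2_eq_square)
    have "?a = u powr of_real \<alpha> * (v powr (- ?\<beta>) * (?\<beta> * (- cnj z) * inverse (1 - z) + u * inverse (1 - z) ^ 2))"
      unfolding pu by (simp add: algebra_simps)
    also have "?\<beta> * (- cnj z) * inverse (1 - z) + u * inverse (1 - z) ^ 2 =
        inverse (1 - z) ^ 2 * (?\<beta> * (- cnj z) * (1 - z) + u)"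
      by (subst i) (simp add: algebra_simps)
    finally have "?a = u powr of_real \<alpha> * (v powr (- ?\<beta>) * (inverse (1 - z) ^ 2 * (?\<beta> * (- cnj z) * (1 - z) + u)))" .
    moreover have "inverse (1 - z) ^ 2 = (1 - z) powr (- 2)"
      using d by (simp add: powr_minus powr_numeral power_inverse)
    ultimately show ?thesis unfolding X by (simp add: kernel_dz_def u_def v_def)
  qed
  have "has_wirtinger ?f z (kernel_dz \<alpha> z) (kernel_dzbar \<alpha> z)" using main unfolding a b .
  then show ?thesis
  proof (rule has_wirtinger_transform[OF _ open_ball z])
    fix w :: complex assume w: "w \<in> ball 0 1"
    have "?f w = (1 - w * cnj w) powr ?\<beta> * ((1 - cnj w) powr (- ?\<beta>) * inverse (1 - w))" by simp
    also have "(1 - cnj w) powr (- ?\<beta>) = inverse ((1 - cnj w) powr ?\<beta>)" by (rule powr_minus)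
    finally show "?f w = alpha_poisson_kernel \<alpha> w"
      unfolding disk_powr[OF w] alpha_poisson_kernel_def by (simp add: divide_inverse mult_ac)
  qed
qed

lemma wirtinger_C1_kernel_derivs:
  "wirtinger_C1 (ball 0 1) (kernel_dz \<alpha>)" "wirtinger_C1 (ball 0 1) (kernel_dzbar \<alpha>)"
proof -
  have *: "1 + (- 1) * (z * cnj z) \<notin> \<real>\<^sub>\<le>\<^sub>0" "1 + (- 1) * cnj z \<notin> \<real>\<^sub>\<le>\<^sub>0" "1 + (- 1) * z \<notin> \<real>\<^sub>\<le>\<^sub>0"
    if "z \<in> ball 0 1" for z using disk_pos[OF that] by simp_all
  show "wirtinger_C1 (ball 0 1) (kernel_dz \<alpha>)" unfolding kernel_dz_def
    by (intro wirtinger_C1_mult wirtinger_C1_add wirtinger_C1_powr wirtinger_C1_const wirtinger_C1_id wirtinger_C1_cnj *)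
  show "wirtinger_C1 (ball 0 1) (kernel_dzbar \<alpha>)" unfolding kernel_dzbar_def
    by (intro wirtinger_C1_mult wirtinger_C1_add wirtinger_C1_powr wirtinger_C1_const wirtinger_C1_id wirtinger_C1_cnj *)
qed

text \<open>
  Multiplying \<open>kernel_dzbar\<close> by \<open>(1 - |w|\<^sup>2) powr (- \<alpha>)\<close> leaves a multiple of a power of \<open>1 - cnj w\<close>, which
  is antiholomorphic.
\<close>

lemma alpha_harmonic_kernel: "alpha_harmonic \<alpha> (alpha_poisson_kernel \<alpha>)"
  unfolding alpha_harmonic_def
proof (intro conjI ballI)
  show "C2_on (ball 0 1) (alpha_poisson_kernel \<alpha>)"
    using wirtinger_C2[OF has_wirtinger_kernel open_ball] wirtinger_C1_kernel_derivs by blast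
next
  fix z :: complex assume z: "z \<in> ball 0 1"
  let ?g = "\<lambda>w. of_real (\<alpha> + 1) * (1 + (- 1) * cnj w) powr of_real (- (\<alpha> + 2))"
  have hv: "has_wirtinger (\<lambda>z. 1 + (- 1) * cnj z) z 0 (- 1)"
    using has_wirtinger_add[OF has_wirtinger_const[of 1 z] has_wirtinger_mult[OF has_wirtinger_const[of "-1" z]
      has_wirtinger_cnj[of z]]] by simp
  have "1 + (- 1) * cnj z \<notin> \<real>\<^sub>\<le>\<^sub>0" using disk_pos[OF z] by simp
  from has_wirtinger_mult[OF has_wirtinger_const[of "of_real (\<alpha> + 1)" z]
      has_wirtinger_compose_holomorphic[OF hv has_field_derivative_powr[OF this, of "of_real (- (\<alpha> + 2))"]]]
  obtain b where "has_wirtinger ?g z 0 b" by auto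
  then have "has_wirtinger (\<lambda>w. of_real ((1 - (cmod w)\<^sup>2) powr (- \<alpha>)) * dzbar (alpha_poisson_kernel \<alpha>) w) z 0 b"
  proof (rule has_wirtinger_transform[OF _ open_ball z])
    fix w :: complex assume w: "w \<in> ball 0 1"
    let ?t = "1 - (cmod w)\<^sup>2"
    have t: "?t > 0" using disk_pos[OF w] by blast
    have u: "(1 + (- 1) * (w * cnj w)) powr of_real \<alpha> = complex_of_real (?t powr \<alpha>)"
      using disk_powr[OF w] by simp
    have one: "complex_of_real (?t powr (- \<alpha>)) * of_real (?t powr \<alpha>) = 1"
      using t unfolding of_real_mult[symmetric] powr_add[symmetric] by simp
    show "?g w = of_real (?t powr (- \<alpha>)) * dzbar (alpha_poisson_kernel \<alpha>) w"
    proof -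
      have "of_real (?t powr (- \<alpha>)) * dzbar (alpha_poisson_kernel \<alpha>) w =
          (of_real (?t powr (- \<alpha>)) * of_real (?t powr \<alpha>)) * ?g w"
        unfolding has_wirtinger_imp(4)[OF has_wirtinger_kernel[OF w]] kernel_dzbar_def u by (simp only: mult_ac)
      then show ?thesis unfolding one by simp
    qed
  qed
  then show "dz (\<lambda>w. of_real ((1 - (cmod w)\<^sup>2) powr (- \<alpha>)) * dzbar (alpha_poisson_kernel \<alpha>) w) z = 0"
    by (rule has_wirtinger_imp)
qed

lemma norm_one_minus_cnj: "cmod (1 - cnj z) = cmod (1 - z)"
  by (metis complex_cnj_diff complex_cnj_one complex_mod_cnj)

lemma norm_kernel_dzbar:
  assumes z: "z \<in> ball 0 1" and \<alpha>: "\<alpha> > -1"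
  shows "cmod (kernel_dzbar \<alpha> z) = (\<alpha> + 1) * ((1 - (cmod z)\<^sup>2) powr \<alpha> * cmod (1 - z) powr (- (\<alpha> + 2)))"
proof -
  have "cmod ((1 - z * cnj z) powr of_real \<alpha>) = (1 - (cmod z)\<^sup>2) powr \<alpha>"
    unfolding disk_powr[OF z] by simp
  moreover have "cmod ((1 - cnj z) powr of_real (- (\<alpha> + 2))) = cmod (1 - z) powr (- (\<alpha> + 2))"
    using disk_pos(7)[OF z] by (subst norm_powr_of_real) (auto simp: norm_one_minus_cnj)
  ultimately show ?thesis using \<alpha> by (simp add: kernel_dzbar_def norm_mult del: of_real_minus of_real_add)
qed

text \<open>
  Let \<open>X = 1 + \<alpha> |z|\<^sup>2 - (\<alpha> + 1) cnj z\<close> be the last factor of \<open>kernel_dz\<close>. For \<open>\<alpha> < 0\<close> its real part is at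
  least \<open>(\<alpha> + 1) (1 - Re z)\<close>, and its imaginary part is \<open>(\<alpha> + 1) Im z\<close>; hence \<open>|X| \<ge> (\<alpha> + 1) |1 - z|\<close>, and
  the modulus of \<open>kernel_dz\<close> is at least that of \<open>kernel_dzbar\<close>.
\<close>

lemma norm_kernel_dz_ge:
  assumes z: "z \<in> ball 0 1" and \<alpha>: "\<alpha> > -1" "\<alpha> < 0"
  shows "(\<alpha> + 1) * ((1 - (cmod z)\<^sup>2) powr \<alpha> * cmod (1 - z) powr (- (\<alpha> + 2))) \<le> cmod (kernel_dz \<alpha> z)"
proof -
  define X where "X = 1 + (of_real \<alpha> * (z * cnj z) + of_real (- (\<alpha> + 1)) * cnj z)"
  define R where "R = cmod (1 - z)"
  have R: "R > 0" using disk_pos(6)[OF z] by (simp add: R_def)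
  have XR: "(\<alpha> + 1) * R \<le> cmod X"
  proof -
    have r: "(cmod z)\<^sup>2 < 1" using disk_pos(1)[OF z] by simp
    have ReX: "Re X = 1 + \<alpha> * (cmod z)\<^sup>2 - (\<alpha> + 1) * Re z" and ImX: "Im X = (\<alpha> + 1) * Im z"
      by (auto simp: X_def complex_norm_square[symmetric] algebra_simps simp del: of_real_power)
    have "\<alpha> * (1 - (cmod z)\<^sup>2) \<le> 0" using \<alpha> r by (simp add: mult_le_0_iff)
    then have "(\<alpha> + 1) * (1 - Re z) \<le> Re X" unfolding ReX by (simp add: algebra_simps)
    moreover have "Re z \<le> 1" using z abs_Re_le_cmod[of z] by simp
    ultimately have "((\<alpha> + 1) * (1 - Re z))\<^sup>2 \<le> (Re X)\<^sup>2" using \<alpha> by (intro power_mono) auto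
    then have "((\<alpha> + 1) * R)\<^sup>2 \<le> (cmod X)\<^sup>2"
      by (simp add: R_def cmod_power2 ImX power_mult_distrib distrib_left)
    then show ?thesis by (rule power2_le_imp_le) simp
  qed
  have n1: "cmod ((1 - z * cnj z) powr of_real \<alpha>) = (1 - (cmod z)\<^sup>2) powr \<alpha>"
    unfolding disk_powr[OF z] by simp
  have n2: "cmod ((1 - cnj z) powr of_real (- (\<alpha> + 1))) = R powr (- (\<alpha> + 1))"
    using disk_pos(7)[OF z] by (subst norm_powr_of_real) (auto simp: norm_one_minus_cnj R_def)
  have n3: "cmod ((1 - z) powr (- 2)) = R powr (- 2)"
    using norm_powr_of_real[of "1 - z" "- 2"] disk_pos(6)[OF z] by (simp add: R_def)
  have "kernel_dz \<alpha> z = (1 - z * cnj z) powr of_real \<alpha> * ((1 - cnj z) powr of_real (- (\<alpha> + 1)) * ((1 - z) powr (- 2) * X))"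
    by (simp add: kernel_dz_def X_def)
  then have e1: "cmod (kernel_dz \<alpha> z) = (1 - (cmod z)\<^sup>2) powr \<alpha> * (R powr (- (\<alpha> + 1)) * (R powr (- 2) * cmod X))"
    by (simp only: norm_mult n1 n2 n3)
  have i1: "(1 - (cmod z)\<^sup>2) powr \<alpha> * (R powr (- (\<alpha> + 1)) * (R powr (- 2) * ((\<alpha> + 1) * R))) \<le>
      (1 - (cmod z)\<^sup>2) powr \<alpha> * (R powr (- (\<alpha> + 1)) * (R powr (- 2) * cmod X))"
    using XR by (intro mult_left_mono) auto
  have "R powr (- (\<alpha> + 1)) * (R powr (- 2) * R) = R powr (- (\<alpha> + 2))"
  proof -
    have "R powr (- (\<alpha> + 1)) * (R powr (- 2) * R powr 1) = R powr (- (\<alpha> + 2))"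
      unfolding powr_add[symmetric] by (rule arg_cong[where f = "\<lambda>x. R powr x"]) simp
    then show ?thesis using R by simp
  qed
  then have "(1 - (cmod z)\<^sup>2) powr \<alpha> * (R powr (- (\<alpha> + 1)) * (R powr (- 2) * ((\<alpha> + 1) * R))) =
      (\<alpha> + 1) * ((1 - (cmod z)\<^sup>2) powr \<alpha> * R powr (- (\<alpha> + 2)))"
    by (metis mult.assoc mult.left_commute)
  then show ?thesis using i1 unfolding e1 R_def[symmetric] by metis
qed

text \<open>
  One factor \<open>1 - |z|\<^sup>2 \<le> 2 |1 - z|\<close> is traded for a factor of the denominator.
\<close>

lemma norm_kernel_le:
  assumes z: "z \<in> ball 0 1" and \<alpha>: "\<alpha> > -1"
  shows "cmod (alpha_poisson_kernel \<alpha> z) \<le> 2 * ((1 - (cmod z)\<^sup>2) powr \<alpha> * cmod (1 - z) powr (- (\<alpha> + 1)))"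
proof -
  define R where "R = cmod (1 - z)"
  have R: "R > 0" using disk_pos(6)[OF z] by (simp add: R_def)
  define t where "t = 1 - (cmod z)\<^sup>2"
  have t: "t > 0" using disk_pos(1)[OF z] by (simp add: t_def)
  have n2: "cmod ((1 - cnj z) powr of_real (\<alpha> + 1)) = R powr (\<alpha> + 1)"
    using disk_pos(7)[OF z] by (subst norm_powr_of_real) (auto simp: norm_one_minus_cnj R_def)
  have "1 - cmod z \<le> R" unfolding R_def using norm_triangle_ineq2[of 1 z] by simp
  moreover have "t = (1 - cmod z) * (1 + cmod z)" by (simp add: t_def power2_eq_square algebra_simps)
  moreover have "(1 - cmod z) * (1 + cmod z) \<le> (1 - cmod z) * 2" using z by (intro mult_left_mono) auto
  ultimately have "1 - cmod z \<le> R" "t \<le> (1 - cmod z) * 2" by simp_all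
  then have tR: "t \<le> 2 * R" by (smt (verit))
  have "cmod (alpha_poisson_kernel \<alpha> z) = t powr (\<alpha> + 1) / (R * R powr (\<alpha> + 1))"
    unfolding alpha_poisson_kernel_def norm_divide norm_mult n2
    using t by (simp add: R_def t_def)
  also have "\<dots> = (t / R) * (t powr \<alpha> * R powr (- (\<alpha> + 1)))"
  proof -
    have "R powr (- (\<alpha> + 1)) = inverse (R powr (\<alpha> + 1))" by (rule powr_minus)
    moreover have "t powr (\<alpha> + 1) = t powr \<alpha> * t" using t by (simp add: powr_add)
    ultimately show ?thesis by (simp add: divide_simps)
  qed
  also have "\<dots> \<le> 2 * (t powr \<alpha> * R powr (- (\<alpha> + 1)))"
    using tR R by (intro mult_right_mono) (auto simp: field_simps)
  finally show ?thesis unfolding t_def R_def .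
qed

section \<open>Derivatives of Poisson integrals\<close>

lemma has_wirtinger_rotate:
  assumes "has_wirtinger f (z * e) a b"
  shows "has_wirtinger (\<lambda>z. f (z * e)) z (a * e) (b * cnj e)"
proof -
  have "((\<lambda>z. z * e) has_derivative (\<lambda>h. h * e)) (at z)" by (auto intro!: derivative_eq_intros)
  from has_derivative_compose[OF this assms[unfolded has_wirtinger_def]]
  show ?thesis unfolding has_wirtinger_def by (rule has_derivative_eq_rhs) (auto simp: algebra_simps)
qed

lemma rotate_in_disk: "z \<in> ball 0 1 \<Longrightarrow> z * cis t \<in> ball 0 1"
  by (simp add: norm_mult)

lemma continuous_on_rotate:
  assumes "continuous_on (ball 0 1) A" "z \<in> ball 0 1"
  shows "continuous_on S (\<lambda>\<theta>. A (z * cis (- \<theta>)))"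
  by (rule continuous_on_compose2[OF assms(1)])
     (use rotate_in_disk[OF assms(2)] in \<open>auto intro!: continuous_intros\<close>)

text \<open>
  Differentiation under the integral sign in the direction \<open>c\<close>. All rotated points stay in the disk as
  long as \<open>|t| < 1 - |z|\<close>.
\<close>

lemma integral_rotate_derivative:
  fixes k :: "complex \<Rightarrow> complex"
  assumes k: "\<And>z. z \<in> ball 0 1 \<Longrightarrow> has_wirtinger k z (A z) (B z)"
    and A: "continuous_on (ball 0 1) A" and B: "continuous_on (ball 0 1) B"
    and G: "continuous_on {0..2*pi} G" and z: "z \<in> ball 0 1" and c: "cmod c = 1"
  shows "((\<lambda>t::real. integral {0..2*pi} (\<lambda>\<theta>. k ((z + c * of_real t) * cis (- \<theta>)) * G \<theta>)) has_vector_derivative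
     integral {0..2*pi} (\<lambda>\<theta>. (A (z * cis (- \<theta>)) * cis (- \<theta>) * c + B (z * cis (- \<theta>)) * cis \<theta> * cnj c) * G \<theta>)) (at 0)"
proof -
  define \<epsilon> where "\<epsilon> = 1 - cmod z"
  have \<epsilon>: "\<epsilon> > 0" using z by (simp add: \<epsilon>_def)
  define U where "U = {- \<epsilon><..<\<epsilon>}"
  have inb: "z + c * of_real x \<in> ball 0 1" if "x \<in> U" for x
  proof -
    have "cmod (z + c * of_real x) \<le> cmod z + \<bar>x\<bar>"
      using norm_triangle_ineq[of z "c * of_real x"] by (simp add: norm_mult c)
    then show ?thesis using that by (auto simp: U_def \<epsilon>_def)
  qed
  have kc: "continuous_on (ball 0 1) k" using k by (rule has_wirtinger_imp_continuous_on)
  define fx where "fx x \<theta> = (A ((z + c * of_real x) * cis (- \<theta>)) * cis (- \<theta>) * c +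
      B ((z + c * of_real x) * cis (- \<theta>)) * cis \<theta> * cnj c) * G \<theta>" for x \<theta>
  have "((\<lambda>x. integral (cbox 0 (2*pi)) (\<lambda>\<theta>. k ((z + c * of_real x) * cis (- \<theta>)) * G \<theta>)) has_vector_derivative
      integral (cbox 0 (2*pi)) (fx 0)) (at 0 within U)"
  proof (rule leibniz_rule_vector_derivative)
    fix x \<theta> assume x: "x \<in> U" and "\<theta> \<in> cbox 0 (2 * pi)"
    have "has_wirtinger (\<lambda>z. k (z * cis (- \<theta>))) (z + c * of_real x)
        (A ((z + c * of_real x) * cis (- \<theta>)) * cis (- \<theta>)) (B ((z + c * of_real x) * cis (- \<theta>)) * cnj (cis (- \<theta>)))"
      using k[OF rotate_in_disk[OF inb[OF x]]] by (rule has_wirtinger_rotate)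
    from has_wirtinger_directional[OF this]
    have "((\<lambda>t. k ((z + c * of_real t) * cis (- \<theta>)) * G \<theta>) has_vector_derivative fx x \<theta>) (at x)"
      unfolding fx_def by (intro has_vector_derivative_mult_left) (simp add: cis_cnj)
    then show "((\<lambda>x. k ((z + c * of_real x) * cis (- \<theta>)) * G \<theta>) has_vector_derivative fx x \<theta>) (at x within U)"
      by (rule has_vector_derivative_at_within)
  next
    fix x assume x: "x \<in> U"
    show "(\<lambda>\<theta>. k ((z + c * of_real x) * cis (- \<theta>)) * G \<theta>) integrable_on cbox 0 (2 * pi)"
      using G by (intro integrable_continuous continuous_on_mult continuous_on_rotate[OF kc inb[OF x]]) auto
  next
    have arg: "continuous_on (U \<times> cbox 0 (2 * pi)) (\<lambda>p. (z + c * of_real (fst p)) * cis (- snd p))"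
      by (intro continuous_intros)
    have sub: "(\<lambda>p. (z + c * of_real (fst p)) * cis (- snd p)) ` (U \<times> cbox 0 (2 * pi)) \<subseteq> ball 0 1"
      using rotate_in_disk inb by auto
    have "continuous_on (U \<times> cbox 0 (2 * pi)) (\<lambda>p. G (snd p))"
      by (rule continuous_on_compose2[OF G]) (auto intro!: continuous_intros)
    moreover have "continuous_on (U \<times> cbox 0 (2 * pi)) (\<lambda>p. A ((z + c * of_real (fst p)) * cis (- snd p)))"
      by (rule continuous_on_compose2[OF A arg sub])
    moreover have "continuous_on (U \<times> cbox 0 (2 * pi)) (\<lambda>p. B ((z + c * of_real (fst p)) * cis (- snd p)))"
      by (rule continuous_on_compose2[OF B arg sub])
    ultimately show "continuous_on (U \<times> cbox 0 (2 * pi)) (\<lambda>(x, t). fx x t)"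
      unfolding fx_def case_prod_unfold
      by (intro continuous_on_mult continuous_on_add continuous_on_const continuous_on_cis continuous_on_minus
          continuous_on_snd continuous_on_id)
  qed (use \<epsilon> in \<open>auto simp: U_def\<close>)
  moreover have "at 0 within U = at 0" by (rule at_within_open) (use \<epsilon> in \<open>auto simp: U_def\<close>)
  moreover have "fx 0 = (\<lambda>\<theta>. (A (z * cis (- \<theta>)) * cis (- \<theta>) * c + B (z * cis (- \<theta>)) * cis \<theta> * cnj c) * G \<theta>)"
    by (simp add: fx_def fun_eq_iff)
  ultimately show ?thesis by (simp only: box_real)
qed

lemma alpha_poisson_eq_integral:
  assumes z: "z \<in> ball 0 1" and G: "continuous_on {0..2*pi} (\<lambda>\<theta>. F (cis \<theta>))"
  shows "alpha_poisson \<alpha> F z = of_real (1 / (2 * pi)) *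
    integral {0..2*pi} (\<lambda>\<theta>. alpha_poisson_kernel \<alpha> (z * cis (- \<theta>)) * F (cis \<theta>))"
proof -
  have kc: "continuous_on (ball 0 1) (alpha_poisson_kernel \<alpha>)"
    using has_wirtinger_kernel by (rule has_wirtinger_imp_continuous_on)
  have "continuous_on {0..2*pi} (\<lambda>\<theta>. alpha_poisson_kernel \<alpha> (z * cis (- \<theta>)) * F (cis \<theta>))"
    by (intro continuous_on_mult G continuous_on_rotate[OF kc z])
  then have int: "integrable (lebesgue_on {0..2*pi}) (\<lambda>\<theta>. alpha_poisson_kernel \<alpha> (z * cis (- \<theta>)) * F (cis \<theta>))"
    by (rule continuous_imp_integrable_real)
  have "{0..2*pi} \<in> sets lebesgue" by simp
  then show ?thesis unfolding alpha_poisson_def by (simp only: lebesgue_integral_eq_integral[OF int])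
qed

text \<open>
  The directional derivatives along \<open>1\<close> and \<open>\<i>\<close> determine \<open>dx\<close> and \<open>dy\<close>, and their Wirtinger combinations
  separate the two integrals.
\<close>

lemma alpha_poisson_derivs:
  assumes z: "z \<in> ball 0 1" and G: "continuous_on {0..2*pi} (\<lambda>\<theta>. F (cis \<theta>))"
  shows "dz (alpha_poisson \<alpha> F) z = of_real (1 / (2 * pi)) *
      integral {0..2*pi} (\<lambda>\<theta>. kernel_dz \<alpha> (z * cis (- \<theta>)) * cis (- \<theta>) * F (cis \<theta>))" (is "_ = _ * ?IA")
    and "dzbar (alpha_poisson \<alpha> F) z = of_real (1 / (2 * pi)) *
      integral {0..2*pi} (\<lambda>\<theta>. kernel_dzbar \<alpha> (z * cis (- \<theta>)) * cis \<theta> * F (cis \<theta>))" (is "_ = _ * ?IB")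
proof -
  define k where "k = complex_of_real (1 / (2 * pi))"
  have cA: "continuous_on (ball 0 1) (kernel_dz \<alpha>)" and cB: "continuous_on (ball 0 1) (kernel_dzbar \<alpha>)"
    using wirtinger_C1_kernel_derivs wirtinger_C1_imp_continuous by blast+
  have dir: "((\<lambda>t::real. alpha_poisson \<alpha> F (z + c * of_real t)) has_vector_derivative k * (?IA * c + ?IB * cnj c)) (at 0)"
    if c: "cmod c = 1" for c
  proof -
    have iA: "(\<lambda>\<theta>. kernel_dz \<alpha> (z * cis (- \<theta>)) * cis (- \<theta>) * F (cis \<theta>)) integrable_on {0..2*pi}"
      by (intro integrable_continuous_real continuous_on_mult G continuous_on_rotate[OF cA z] continuous_intros)
    have iB: "(\<lambda>\<theta>. kernel_dzbar \<alpha> (z * cis (- \<theta>)) * cis \<theta> * F (cis \<theta>)) integrable_on {0..2*pi}"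
      by (intro integrable_continuous_real continuous_on_mult G continuous_on_rotate[OF cB z] continuous_intros)
    have "integral {0..2*pi} (\<lambda>\<theta>. (kernel_dz \<alpha> (z * cis (- \<theta>)) * cis (- \<theta>) * c +
        kernel_dzbar \<alpha> (z * cis (- \<theta>)) * cis \<theta> * cnj c) * F (cis \<theta>)) =
      integral {0..2*pi} (\<lambda>\<theta>. kernel_dz \<alpha> (z * cis (- \<theta>)) * cis (- \<theta>) * F (cis \<theta>) * c +
        kernel_dzbar \<alpha> (z * cis (- \<theta>)) * cis \<theta> * F (cis \<theta>) * cnj c)"
      by (intro integral_cong) (simp add: algebra_simps)
    also have "\<dots> = ?IA * c + ?IB * cnj c"
      using iA iB by (subst integral_add) (auto intro: integrable_on_mult_left)
    finally have "((\<lambda>t::real. integral {0..2*pi} (\<lambda>\<theta>. alpha_poisson_kernel \<alpha> ((z + c * of_real t) * cis (- \<theta>)) * F (cis \<theta>)))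
        has_vector_derivative ?IA * c + ?IB * cnj c) (at 0)"
      using integral_rotate_derivative[OF has_wirtinger_kernel cA cB G z c] by simp
    from has_vector_derivative_mult_right[OF this, of k]
    show ?thesis
    proof (rule has_vector_derivative_transform_within_open)
      define \<epsilon> where "\<epsilon> = 1 - cmod z"
      show "open {- \<epsilon><..<\<epsilon>}" "0 \<in> {- \<epsilon><..<\<epsilon>}" using z by (auto simp: \<epsilon>_def)
      fix t assume "t \<in> {- \<epsilon><..<\<epsilon>}"
      then have "z + c * of_real t \<in> ball 0 1"
        using norm_triangle_ineq[of z "c * of_real t"] c by (auto simp: norm_mult \<epsilon>_def)
      then show "k * integral {0..2*pi} (\<lambda>\<theta>. alpha_poisson_kernel \<alpha> ((z + c * of_real t) * cis (- \<theta>)) * F (cis \<theta>)) =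
          alpha_poisson \<alpha> F (z + c * of_real t)"
        using alpha_poisson_eq_integral[OF _ G] by (simp add: k_def)
    qed
  qed
  have alg: "(k * (X + Y) - \<i> * (k * (X * \<i> - Y * \<i>))) / 2 = k * X"
    "(k * (X + Y) + \<i> * (k * (X * \<i> - Y * \<i>))) / 2 = k * Y" for X Y
    by (simp_all add: field_simps)
  have dx: "dx (alpha_poisson \<alpha> F) z = k * (?IA + ?IB)"
    unfolding dx_def using vector_derivative_at[OF dir[of 1]] by simp
  have dy: "dy (alpha_poisson \<alpha> F) z = k * (?IA * \<i> - ?IB * \<i>)"
    unfolding dy_def using vector_derivative_at[OF dir[of \<i>]] by simp
  show "dz (alpha_poisson \<alpha> F) z = of_real (1 / (2 * pi)) * ?IA"
    "dzbar (alpha_poisson \<alpha> F) z = of_real (1 / (2 * pi)) * ?IB"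
    unfolding dz_def dzbar_def k_def[symmetric] dx dy by (rule alg)+
qed

lemma continuous_on_integral_rotate:
  fixes A :: "complex \<Rightarrow> complex"
  assumes A: "continuous_on (ball 0 1) A" and G: "continuous_on {0..2*pi} G"
  shows "continuous_on (ball 0 1) (\<lambda>z. integral {0..2*pi} (\<lambda>\<theta>. A (z * cis (- \<theta>)) * G \<theta>))"
proof -
  have "continuous_on (ball 0 1 \<times> cbox 0 (2 * pi)) (\<lambda>p. A (fst p * cis (- snd p)) * G (snd p))"
  proof (intro continuous_on_mult)
    show "continuous_on (ball 0 1 \<times> cbox 0 (2 * pi)) (\<lambda>p. A (fst p * cis (- snd p)))"
      by (rule continuous_on_compose2[OF A]) (use rotate_in_disk in \<open>auto intro!: continuous_intros\<close>)
    show "continuous_on (ball 0 1 \<times> cbox 0 (2 * pi)) (\<lambda>p. G (snd p))"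
      by (rule continuous_on_compose2[OF G]) (auto intro!: continuous_intros)
  qed
  then have "continuous_on (ball 0 1) (\<lambda>z. integral (cbox 0 (2*pi)) (\<lambda>\<theta>. A (z * cis (- \<theta>)) * G \<theta>))"
    by (intro integral_continuous_on_param) (simp add: case_prod_unfold)
  then show ?thesis by simp
qed

lemma continuous_on_alpha_poisson_derivs:
  assumes G: "continuous_on {0..2*pi} (\<lambda>\<theta>. F (cis \<theta>))"
  shows "continuous_on (ball 0 1) (dz (alpha_poisson \<alpha> F))" "continuous_on (ball 0 1) (dzbar (alpha_poisson \<alpha> F))"
proof -
  have cA: "continuous_on (ball 0 1) (kernel_dz \<alpha>)" and cB: "continuous_on (ball 0 1) (kernel_dzbar \<alpha>)"
    using wirtinger_C1_kernel_derivs wirtinger_C1_imp_continuous by blast+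
  have "continuous_on (ball 0 1) (\<lambda>z. of_real (1 / (2 * pi)) *
      integral {0..2*pi} (\<lambda>\<theta>. kernel_dz \<alpha> (z * cis (- \<theta>)) * (cis (- \<theta>) * F (cis \<theta>))))"
    by (intro continuous_on_mult continuous_on_const continuous_on_integral_rotate[OF cA] G continuous_intros)
  then show "continuous_on (ball 0 1) (dz (alpha_poisson \<alpha> F))"
    by (rule continuous_on_eq) (simp add: alpha_poisson_derivs(1)[OF _ G] mult.assoc)
  have "continuous_on (ball 0 1) (\<lambda>z. of_real (1 / (2 * pi)) *
      integral {0..2*pi} (\<lambda>\<theta>. kernel_dzbar \<alpha> (z * cis (- \<theta>)) * (cis \<theta> * F (cis \<theta>))))"
    by (intro continuous_on_mult continuous_on_const continuous_on_integral_rotate[OF cB] G continuous_intros)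
  then show "continuous_on (ball 0 1) (dzbar (alpha_poisson \<alpha> F))"
    by (rule continuous_on_eq) (simp add: alpha_poisson_derivs(2)[OF _ G] mult.assoc)
qed

text \<open>
  The convolution, along the circle through \<open>z\<close>, of \<open>|h|\<close> with \<open>|1 - w| powr (- s)\<close>; it dominates both
  derivatives of the Poisson integral.
\<close>

definition kernel_mean :: "real \<Rightarrow> (real \<Rightarrow> complex) \<Rightarrow> complex \<Rightarrow> real" where
  "kernel_mean s h z = (LINT \<theta>|lebesgue_on {0..2*pi}. cmod (1 - z * cis (- \<theta>)) powr (- s) * cmod (h \<theta>))"

text \<open>
  The boundary terms cancel because both factors take equal values at \<open>0\<close> and \<open>2 * pi\<close>.
\<close>

lemma circle_integration_by_parts:
  assumes ac: "absolutely_continuous_on_circle F"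
    and \<phi>: "\<And>x. (\<phi> has_vector_derivative \<phi>' x) (at x)" and \<phi>': "continuous_on {0..2*pi} \<phi>'"
    and per: "\<phi> (2 * pi) = \<phi> 0"
  shows "((\<lambda>\<theta>. \<phi> \<theta> * circle_deriv F \<theta>) has_integral (- integral {0..2*pi} (\<lambda>\<theta>. \<phi>' \<theta> * F (cis \<theta>)))) {0..2*pi}"
proof -
  let ?N = "{x \<in> {0<..<2*pi}. \<not> (\<lambda>\<theta>. F (cis \<theta>)) differentiable (at x)} \<union> {0, 2 * pi}"
  have ac': "absolutely_continuous_on_interval 0 (2*pi) (\<lambda>\<theta>. F (cis \<theta>))"
    using ac by (simp add: absolutely_continuous_on_circle_def)
  have "((\<lambda>\<theta>. \<phi> \<theta> * circle_deriv F \<theta>) has_integral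
     (\<phi> (2*pi) * F (cis (2*pi)) - \<phi> 0 * F (cis 0) - integral {0..2*pi} (\<lambda>\<theta>. \<phi>' \<theta> * F (cis \<theta>)))) {0..2*pi}"
  proof (rule absolutely_continuous_integration_by_parts[OF ac'])
    show "negligible ?N"
      by (intro negligible_Un absolutely_continuous_imp_differentiable_ae[OF ac'] negligible_finite) simp
    fix x assume "x \<in> {0..2*pi} - ?N"
    then have "(\<lambda>\<theta>. F (cis \<theta>)) differentiable (at x)" by auto
    then show "((\<lambda>\<theta>. F (cis \<theta>)) has_vector_derivative circle_deriv F x) (at x)"
      unfolding circle_deriv_def by (simp add: vector_derivative_works)
  qed (use \<phi> \<phi>' in \<open>auto intro: has_vector_derivative_at_within\<close>)
  then show ?thesis by (simp add: per)
qed

lemma has_vector_derivative_cis: "(cis has_vector_derivative \<i> * cis x) (at x within S)"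
proof -
  have "((\<lambda>z. exp (\<i> * z)) has_field_derivative \<i> * exp (\<i> * of_real x)) (at (of_real x))"
    by (auto intro!: derivative_eq_intros)
  from has_vector_derivative_real_field[OF this] show ?thesis by (simp add: cis_conv_exp[abs_def])
qed

lemma has_vector_derivative_rotate:
  "((\<lambda>\<theta>. z * cis (- \<theta>)) has_vector_derivative - \<i> * (z * cis (- x))) (at x)"
proof -
  have "(uminus has_real_derivative - 1) (at x)" by (auto intro!: derivative_eq_intros)
  from vector_diff_chain_at[OF this[unfolded has_real_derivative_iff_has_vector_derivative] has_vector_derivative_cis]
  have "((\<lambda>\<theta>. cis (- \<theta>)) has_vector_derivative - (\<i> * cis (- x))) (at x)" by (simp add: o_def)
  from has_vector_derivative_mult_right[OF this, of z] show ?thesis by (simp add: mult_ac)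
qed

lemma integrable_continuous_times:
  fixes k u :: "real \<Rightarrow> 'b::{euclidean_space, real_normed_field}"
  assumes k: "continuous_on {0..2*pi} k" and u: "integrable (lebesgue_on {0..2*pi}) u"
  shows "integrable (lebesgue_on {0..2*pi}) (\<lambda>\<theta>. k \<theta> * u \<theta>)"
proof -
  obtain B where B: "\<forall>x\<in>{0..2*pi}. norm (k x) \<le> B"
    using compact_imp_bounded[OF compact_continuous_image[OF k compact_Icc]] by (auto simp: bounded_iff)
  show ?thesis
  proof (rule Bochner_Integration.integrable_bound[of _ "\<lambda>\<theta>. B * norm (u \<theta>)"])
    show "integrable (lebesgue_on {0..2*pi}) (\<lambda>\<theta>. B * norm (u \<theta>))" using u by simp
    show "(\<lambda>\<theta>. k \<theta> * u \<theta>) \<in> borel_measurable (lebesgue_on {0..2*pi})"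
      using k by (intro borel_measurable_times borel_measurable_integrable[OF u]
          continuous_imp_measurable_on_sets_lebesgue) auto
    have "norm (k x * u x) \<le> norm (B * norm (u x))" if x: "x \<in> {0..2*pi}" for x
    proof -
      have "norm (k x * u x) = norm (k x) * norm (u x)" by (rule norm_mult)
      also have "\<dots> \<le> B * norm (u x)" using B[rule_format, OF x] by (rule mult_right_mono) simp
      also have "\<dots> \<le> norm (B * norm (u x))" by simp
      finally show ?thesis .
    qed
    then show "AE x in lebesgue_on {0..2*pi}. norm (k x * u x) \<le> norm (B * norm (u x))"
      by (intro AE_I2) simp
  qed
qed

lemma norm_integral_times_deriv_le:
  assumes int: "((\<lambda>\<theta>. \<phi> \<theta> * h \<theta>) has_integral I) {0..2*pi}"
    and \<phi>: "continuous_on {0..2*pi} \<phi>" and h: "integrable (lebesgue_on {0..2*pi}) h"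
    and z: "z \<in> ball 0 1" and bound: "\<And>\<theta>. cmod (\<phi> \<theta>) \<le> C * cmod (1 - z * cis (- \<theta>)) powr (- s)"
  shows "cmod I \<le> C * kernel_mean s h z"
proof -
  have ne: "1 - z * cis (- \<theta>) \<noteq> 0" for \<theta> using disk_pos(6)[OF rotate_in_disk[OF z]] .
  have int2: "integrable (lebesgue_on {0..2*pi}) (\<lambda>\<theta>. cmod (1 - z * cis (- \<theta>)) powr (- s) * cmod (h \<theta>))"
    using h ne by (intro integrable_continuous_times continuous_on_powr continuous_intros) auto
  have int1: "integrable (lebesgue_on {0..2*pi}) (\<lambda>\<theta>. \<phi> \<theta> * h \<theta>)" by (rule integrable_continuous_times[OF \<phi> h])
  have "I = (LINT \<theta>|lebesgue_on {0..2*pi}. \<phi> \<theta> * h \<theta>)"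
    using has_integral_integral_lebesgue_on[OF int1] int by (auto intro: has_integral_unique)
  also have "cmod \<dots> \<le> (LINT \<theta>|lebesgue_on {0..2*pi}. cmod (\<phi> \<theta> * h \<theta>))" by (rule integral_norm_bound)
  also have "\<dots> \<le> (LINT \<theta>|lebesgue_on {0..2*pi}. C * (cmod (1 - z * cis (- \<theta>)) powr (- s) * cmod (h \<theta>)))"
  proof (rule integral_mono)
    show "integrable (lebesgue_on {0..2*pi}) (\<lambda>\<theta>. cmod (\<phi> \<theta> * h \<theta>))" using int1 by (rule integrable_norm)
    show "integrable (lebesgue_on {0..2*pi}) (\<lambda>\<theta>. C * (cmod (1 - z * cis (- \<theta>)) powr (- s) * cmod (h \<theta>)))"
      using int2 by simp
    show "cmod (\<phi> \<theta> * h \<theta>) \<le> C * (cmod (1 - z * cis (- \<theta>)) powr (- s) * cmod (h \<theta>))" for \<theta>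
      using mult_right_mono[OF bound, of "cmod (h \<theta>)" \<theta>] by (simp add: norm_mult mult.assoc)
  qed
  also have "\<dots> = C * kernel_mean s h z" by (simp add: kernel_mean_def)
  finally show ?thesis .
qed

text \<open>
  Two integrations by parts: \<open>\<phi>\<close> is the primitive that represents \<open>cnj z * dzbar f\<close>, and \<open>\<psi>\<close>, the kernel
  itself, represents \<open>z * dz f - cnj z * dzbar f\<close>. The second costs a factor \<open>2\<close> by \<open>norm_kernel_le\<close>, which
  explains the constant \<open>3\<close> for \<open>dz\<close>.
\<close>

lemma alpha_poisson_derivs_bound:
  assumes \<alpha>: "\<alpha> > -1" and ac: "absolutely_continuous_on_circle F"
    and h: "integrable (lebesgue_on {0..2*pi}) (circle_deriv F)" and z: "z \<in> ball 0 1"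
  defines "M \<equiv> (1 - (cmod z)\<^sup>2) powr \<alpha> * kernel_mean (\<alpha> + 1) (circle_deriv F) z"
  shows "cmod z * cmod (dzbar (alpha_poisson \<alpha> F) z) \<le> M" "cmod z * cmod (dz (alpha_poisson \<alpha> F) z) \<le> 3 * M"
proof -
  define t where "t = (1 - (cmod z)\<^sup>2) powr \<alpha>"
  have G: "continuous_on {0..2*pi} (\<lambda>\<theta>. F (cis \<theta>))"
    using ac absolutely_continuous_imp_continuous by (auto simp: absolutely_continuous_on_circle_def)
  note rd = rotate_in_disk[OF z]
  note nr = disk_pos[OF rd]
  have cA: "continuous_on (ball 0 1) (kernel_dz \<alpha>)" and cB: "continuous_on (ball 0 1) (kernel_dzbar \<alpha>)"
    using wirtinger_C1_kernel_derivs wirtinger_C1_imp_continuous by blast+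
  let ?K = "alpha_poisson_kernel \<alpha>"
  let ?k = "complex_of_real (1 / (2 * pi))"
  have k1: "cmod ?k * y \<le> y" if "y \<ge> 0" for y
  proof -
    have "cmod ?k = 1 / (2 * pi)" unfolding norm_of_real using pi_gt_zero by simp
    then show ?thesis using that pi_gt3 by (intro mult_left_le_one_le) auto
  qed
  have cnjw: "cnj (z * cis (- \<theta>)) = cnj z * cis \<theta>" for \<theta> by (simp add: cis_cnj)

  define \<phi> where "\<phi> \<theta> = (1 - cnj z * cis \<theta>) powr of_real (- (\<alpha> + 1))" for \<theta>
  define \<phi>' where "\<phi>' \<theta> = of_real (- (\<alpha> + 1)) * (1 - cnj z * cis \<theta>) powr of_real (- (\<alpha> + 2)) * (- (cnj z * (\<i> * cis \<theta>)))" for \<theta>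
  have d1: "((\<lambda>\<theta>. 1 - cnj z * cis \<theta>) has_vector_derivative - (cnj z * (\<i> * cis x))) (at x)" for x
    using has_vector_derivative_diff[OF has_vector_derivative_const
      has_vector_derivative_mult_right[OF has_vector_derivative_cis, of "cnj z"]] by simp
  have npr: "1 - cnj z * cis \<theta> \<notin> \<real>\<^sub>\<le>\<^sub>0" for \<theta> using nr(5)[of "- \<theta>"] unfolding cnjw .
  have dphi: "(\<phi> has_vector_derivative \<phi>' x) (at x)" for x
  proof -
    have "((\<lambda>u. u powr of_real (- (\<alpha> + 1))) has_field_derivative
        of_real (- (\<alpha> + 1)) * (1 - cnj z * cis x) powr (of_real (- (\<alpha> + 1)) - 1)) (at (1 - cnj z * cis x))"
      using npr by (rule has_field_derivative_powr)
    from field_vector_diff_chain_at[OF d1 this]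
    have "(\<phi> has_vector_derivative (- (cnj z * (\<i> * cis x))) *
        (of_real (- (\<alpha> + 1)) * (1 - cnj z * cis x) powr (of_real (- (\<alpha> + 1)) - 1))) (at x)"
      by (simp add: \<phi>_def[abs_def] o_def)
    moreover have "of_real (- (\<alpha> + 1)) - 1 = complex_of_real (- (\<alpha> + 2))" by simp
    ultimately show ?thesis unfolding \<phi>'_def by (simp only: mult_ac)
  qed
  have cphi': "continuous_on S \<phi>'" for S
  proof -
    have "continuous_on S (\<lambda>\<theta>. (1 - cnj z * cis \<theta>) powr of_real (- (\<alpha> + 2)))"
    proof (rule continuous_on_powr_complex)
      show "S \<subseteq> {\<theta>. Re (1 - cnj z * cis \<theta>) \<ge> 0 \<or> Im (1 - cnj z * cis \<theta>) \<noteq> 0}"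
        using npr by (fastforce simp: complex_nonpos_Reals_iff)
      show "\<theta> \<in> S \<Longrightarrow> 1 - cnj z * cis \<theta> = 0 \<Longrightarrow> 0 < Re (of_real (- (\<alpha> + 2)))" for \<theta>
        using npr[of \<theta>] by simp
    qed (intro continuous_intros)+
    then show ?thesis unfolding \<phi>'_def
      by (intro continuous_on_mult continuous_on_minus continuous_on_const continuous_on_cis continuous_on_id)
  qed
  have "((\<lambda>\<theta>. \<phi> \<theta> * circle_deriv F \<theta>) has_integral (- integral {0..2*pi} (\<lambda>\<theta>. \<phi>' \<theta> * F (cis \<theta>)))) {0..2*pi}"
    by (rule circle_integration_by_parts[OF ac dphi cphi']) (simp add: \<phi>_def)
  then have "cmod (- integral {0..2*pi} (\<lambda>\<theta>. \<phi>' \<theta> * F (cis \<theta>))) \<le> 1 * kernel_mean (\<alpha> + 1) (circle_deriv F) z"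
  proof (rule norm_integral_times_deriv_le[OF _ _ h z])
    show "continuous_on {0..2*pi} \<phi>" using dphi by (meson continuous_on_vector_derivative has_vector_derivative_at_within)
    fix \<theta>
    have "cmod (1 - cnj (z * cis (- \<theta>))) = cmod (1 - z * cis (- \<theta>))" by (rule norm_one_minus_cnj)
    then show "cmod (\<phi> \<theta>) \<le> 1 * cmod (1 - z * cis (- \<theta>)) powr (- (\<alpha> + 1))"
      using nr(7)[of "- \<theta>"] unfolding \<phi>_def cnjw by (subst norm_powr_of_real) auto
  qed
  then have B1: "cmod (integral {0..2*pi} (\<lambda>\<theta>. \<phi>' \<theta> * F (cis \<theta>))) \<le> kernel_mean (\<alpha> + 1) (circle_deriv F) z" by simp
  have t: "t \<ge> 0" by (simp add: t_def)
  have Bphi: "cnj z * (kernel_dzbar \<alpha> (z * cis (- \<theta>)) * cis \<theta> * F (cis \<theta>)) = - \<i> * of_real t * (\<phi>' \<theta> * F (cis \<theta>))" for \<theta>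
  proof -
    have p: "(1 - z * cis (- \<theta>) * cnj (z * cis (- \<theta>))) powr of_real \<alpha> = of_real t"
      unfolding disk_powr[OF rd] by (simp add: t_def norm_mult)
    have "kernel_dzbar \<alpha> (z * cis (- \<theta>)) = of_real (\<alpha> + 1) *
       ((1 - z * cis (- \<theta>) * cnj (z * cis (- \<theta>))) powr of_real \<alpha> * (1 - cnj (z * cis (- \<theta>))) powr of_real (- (\<alpha> + 2)))"
      by (simp add: kernel_dzbar_def)
    then have "kernel_dzbar \<alpha> (z * cis (- \<theta>)) = of_real (\<alpha> + 1) *
       (of_real t * (1 - cnj z * cis \<theta>) powr of_real (- (\<alpha> + 2)))"
      unfolding p unfolding cnjw .
    then show ?thesis by (simp add: \<phi>'_def algebra_simps)
  qed
  have "cnj z * dzbar (alpha_poisson \<alpha> F) z = ?k * (- \<i> * of_real t * integral {0..2*pi} (\<lambda>\<theta>. \<phi>' \<theta> * F (cis \<theta>)))"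
    unfolding alpha_poisson_derivs(2)[OF z G] integral_mult_right[symmetric] Bphi[symmetric]
    by (simp add: mult_ac)
  then have zb: "cmod (cnj z * dzbar (alpha_poisson \<alpha> F) z) = cmod ?k * (t * cmod (integral {0..2*pi} (\<lambda>\<theta>. \<phi>' \<theta> * F (cis \<theta>))))"
    by (simp only: norm_mult norm_minus_cancel norm_ii norm_of_real mult_1 abs_of_nonneg[OF t] mult.assoc)
  also have "\<dots> \<le> t * cmod (integral {0..2*pi} (\<lambda>\<theta>. \<phi>' \<theta> * F (cis \<theta>)))" using t by (intro k1) simp
  also have "\<dots> \<le> M" unfolding M_def t_def[symmetric] using t B1 by (intro mult_left_mono)
  finally have zbM: "cmod (cnj z * dzbar (alpha_poisson \<alpha> F) z) \<le> M" .
  then show "cmod z * cmod (dzbar (alpha_poisson \<alpha> F) z) \<le> M" by (simp add: norm_mult)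

  define \<psi> where "\<psi> \<theta> = ?K (z * cis (- \<theta>))" for \<theta>
  define \<psi>' where "\<psi>' \<theta> = kernel_dz \<alpha> (z * cis (- \<theta>)) * (- \<i> * (z * cis (- \<theta>))) +
    kernel_dzbar \<alpha> (z * cis (- \<theta>)) * cnj (- \<i> * (z * cis (- \<theta>)))" for \<theta>
  have dpsi: "(\<psi> has_vector_derivative \<psi>' x) (at x)" for x
  proof -
    have "((\<lambda>\<theta>. z * cis (- \<theta>)) has_derivative (\<lambda>y. y *\<^sub>R (- \<i> * (z * cis (- x))))) (at x)"
      using has_vector_derivative_rotate unfolding has_vector_derivative_def .
    from has_derivative_compose[OF this has_wirtinger_kernel[OF rd, unfolded has_wirtinger_def]]
    have "(\<psi> has_derivative (\<lambda>y. kernel_dz \<alpha> (z * cis (- x)) * (y *\<^sub>R (- \<i> * (z * cis (- x)))) +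
        kernel_dzbar \<alpha> (z * cis (- x)) * cnj (y *\<^sub>R (- \<i> * (z * cis (- x)))))) (at x)"
      by (simp only: \<psi>_def[abs_def])
    then show ?thesis unfolding has_vector_derivative_def \<psi>'_def
      by (rule has_derivative_eq_rhs) (auto simp: algebra_simps scaleR_conv_of_real)
  qed
  have cpsi': "continuous_on S \<psi>'" for S unfolding \<psi>'_def
    by (intro continuous_intros continuous_on_rotate[OF cA z] continuous_on_rotate[OF cB z])
  have "((\<lambda>\<theta>. \<psi> \<theta> * circle_deriv F \<theta>) has_integral (- integral {0..2*pi} (\<lambda>\<theta>. \<psi>' \<theta> * F (cis \<theta>)))) {0..2*pi}"
    by (rule circle_integration_by_parts[OF ac dpsi cpsi']) (simp add: \<psi>_def cis_cnj[symmetric])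
  then have "cmod (- integral {0..2*pi} (\<lambda>\<theta>. \<psi>' \<theta> * F (cis \<theta>))) \<le> (2 * t) * kernel_mean (\<alpha> + 1) (circle_deriv F) z"
  proof (rule norm_integral_times_deriv_le[OF _ _ h z])
    show "continuous_on {0..2*pi} \<psi>" using dpsi by (meson continuous_on_vector_derivative has_vector_derivative_at_within)
    show "cmod (\<psi> \<theta>) \<le> (2 * t) * cmod (1 - z * cis (- \<theta>)) powr (- (\<alpha> + 1))" for \<theta>
      using norm_kernel_le[OF rd \<alpha>, of "- \<theta>"] by (simp add: \<psi>_def t_def norm_mult mult.assoc)
  qed
  then have B2: "cmod (integral {0..2*pi} (\<lambda>\<theta>. \<psi>' \<theta> * F (cis \<theta>))) \<le> 2 * M" by (simp add: M_def t_def)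
  have "z * dz (alpha_poisson \<alpha> F) z - cnj z * dzbar (alpha_poisson \<alpha> F) z =
      ?k * (integral {0..2*pi} (\<lambda>\<theta>. z * (kernel_dz \<alpha> (z * cis (- \<theta>)) * cis (- \<theta>) * F (cis \<theta>))) -
        integral {0..2*pi} (\<lambda>\<theta>. cnj z * (kernel_dzbar \<alpha> (z * cis (- \<theta>)) * cis \<theta> * F (cis \<theta>))))"
    unfolding alpha_poisson_derivs[OF z G] integral_mult_right by (simp only: right_diff_distrib mult_ac)
  also have "\<dots> = ?k * integral {0..2*pi} (\<lambda>\<theta>. z * (kernel_dz \<alpha> (z * cis (- \<theta>)) * cis (- \<theta>) * F (cis \<theta>)) -
        cnj z * (kernel_dzbar \<alpha> (z * cis (- \<theta>)) * cis \<theta> * F (cis \<theta>)))"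
    by (subst integral_diff)
       (auto intro!: integrable_continuous_real continuous_intros G continuous_on_rotate[OF cA z] continuous_on_rotate[OF cB z])
  also have "\<dots> = ?k * integral {0..2*pi} (\<lambda>\<theta>. \<i> * (\<psi>' \<theta> * F (cis \<theta>)))"
    by (intro arg_cong[where f = "\<lambda>x. ?k * x"] integral_cong) (simp add: \<psi>'_def cis_cnj algebra_simps)
  finally have "cmod (z * dz (alpha_poisson \<alpha> F) z - cnj z * dzbar (alpha_poisson \<alpha> F) z) =
      cmod ?k * cmod (integral {0..2*pi} (\<lambda>\<theta>. \<psi>' \<theta> * F (cis \<theta>)))"
    by (simp only: norm_mult norm_ii mult_1 integral_mult_right)
  also have "\<dots> \<le> 2 * M" using k1[of "cmod (integral {0..2*pi} (\<lambda>\<theta>. \<psi>' \<theta> * F (cis \<theta>)))"] B2 by simp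
  finally have "cmod (z * dz (alpha_poisson \<alpha> F) z - cnj z * dzbar (alpha_poisson \<alpha> F) z) \<le> 2 * M" .
  then have "cmod (z * dz (alpha_poisson \<alpha> F) z) \<le> 3 * M"
    using zbM norm_triangle_sub[of "z * dz (alpha_poisson \<alpha> F) z" "cnj z * dzbar (alpha_poisson \<alpha> F) z"] by simp
  then show "cmod z * cmod (dz (alpha_poisson \<alpha> F) z) \<le> 3 * M" by (simp add: norm_mult)
qed

section \<open>The mass of the kernel on circles\<close>

definition circle_kernel :: "real \<Rightarrow> real \<Rightarrow> real \<Rightarrow> real" where
  "circle_kernel s r x = cmod (1 - of_real r * cis x) powr (- s)"

text \<open>
  The window \<open>{-2*pi..2*pi}\<close> contains every difference of two angles in \<open>{0..2*pi}\<close>, so translates of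
  the kernel over one period are controlled without invoking periodicity.
\<close>

definition circle_kernel_mass :: "real \<Rightarrow> real \<Rightarrow> ennreal" where
  "circle_kernel_mass s r = (\<integral>\<^sup>+x\<in>{-2*pi..2*pi}. ennreal (circle_kernel s r x) \<partial>lborel)"

lemma sin_ge_half:
  assumes "0 \<le> y" "y \<le> pi / 2"
  shows "y / 2 \<le> sin y"
proof (cases "y \<le> pi / 3")
  case True
  show ?thesis
  proof (cases "y = 0")
    case False
    then have "\<exists>\<xi>. 0 < \<xi> \<and> \<xi> < y \<and> sin y - sin 0 = (y - 0) * cos \<xi>"
      using assms by (intro MVT2) (auto intro!: derivative_eq_intros)
    then obtain \<xi> where \<xi>: "0 < \<xi>" "\<xi> < y" "sin y = y * cos \<xi>" by auto
    have "cos (pi / 3) \<le> cos \<xi>" using \<xi> True pi_gt_zero by (subst cos_mono_le_eq) auto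
    then have "y * (1 / 2) \<le> y * cos \<xi>" using assms by (intro mult_left_mono) (auto simp: cos_60)
    then show ?thesis using \<xi> by simp
  qed simp
next
  case False
  have "sin (pi / 3) \<le> sin y"
    using assms False pi_gt_zero by (intro sin_monotone_2pi_le) auto
  moreover have "8 / 5 \<le> sqrt 3" by (rule real_le_rsqrt) (simp add: power2_eq_square)
  moreover have "pi / 4 \<le> 4 / 5" using pi_less_4 pi_approx by simp
  ultimately show ?thesis using assms by (simp add: sin_60)
qed

text \<open>
  The point \<open>r * cis x\<close> is within \<open>1 - r\<close> of \<open>cis x\<close> and at least \<open>1 - r\<close> away from \<open>1\<close>, so its distance to \<open>1\<close>
  is at least half of the chord \<open>|1 - cis x|\<close>.
\<close>

lemma norm_one_minus_cis_ge:
  assumes r: "0 \<le> r" "r < 1" and x: "\<bar>x\<bar> \<le> 2 * pi"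
  shows "1 - r \<le> cmod (1 - of_real r * cis x)" "min \<bar>x\<bar> (2 * pi - \<bar>x\<bar>) / 4 \<le> cmod (1 - of_real r * cis x)"
proof -
  have rr: "cmod (of_real r * cis x) = r" using r by (simp add: norm_mult)
  show 1: "1 - r \<le> cmod (1 - of_real r * cis x)"
    using norm_triangle_ineq2[of 1 "of_real r * cis x"] rr by simp
  have "1 - cis x = (1 - of_real r * cis x) - of_real (1 - r) * cis x" by (simp add: algebra_simps)
  then have "cmod (1 - cis x) \<le> cmod (1 - of_real r * cis x) + cmod (of_real (1 - r) * cis x)"
    by (metis norm_triangle_ineq4)
  also have "cmod (of_real (1 - r) * cis x) = 1 - r" using r unfolding norm_mult norm_of_real by simp
  finally have 2: "cmod (1 - cis x) \<le> 2 * cmod (1 - of_real r * cis x)" using 1 by simp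
  have "cmod (1 - cis x) = 2 * \<bar>sin (x / 2)\<bar>"
    using dist_exp_i_1[of x] by (simp add: cis_conv_exp norm_minus_commute)
  also have "\<bar>sin (x / 2)\<bar> = \<bar>sin (\<bar>x\<bar> / 2)\<bar>" by (auto simp: abs_if)
  finally have 3: "cmod (1 - cis x) = 2 * \<bar>sin (\<bar>x\<bar> / 2)\<bar>" .
  define d where "d = min \<bar>x\<bar> (2 * pi - \<bar>x\<bar>)"
  have "d / 4 \<le> \<bar>sin (\<bar>x\<bar> / 2)\<bar>"
  proof (cases "\<bar>x\<bar> \<le> pi")
    case True
    then show ?thesis using sin_ge_half[of "\<bar>x\<bar> / 2"] by (simp add: d_def)
  next
    case False
    have "sin (\<bar>x\<bar> / 2) = sin (pi - \<bar>x\<bar> / 2)" by simp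
    moreover have "(pi - \<bar>x\<bar> / 2) / 2 \<le> sin (pi - \<bar>x\<bar> / 2)" using False x by (intro sin_ge_half) auto
    moreover have "d / 4 = (pi - \<bar>x\<bar> / 2) / 2" using False by (simp add: d_def)
    ultimately show ?thesis by (smt (verit))
  qed
  then show "min \<bar>x\<bar> (2 * pi - \<bar>x\<bar>) / 4 \<le> cmod (1 - of_real r * cis x)"
    unfolding d_def[symmetric] using 2 3 by linarith
qed

lemma circle_kernel_le:
  assumes r: "0 \<le> r" "r < 1" and x: "\<bar>x\<bar> \<le> 2 * pi" and s: "s > 0"
  shows "circle_kernel s r x \<le> 2 powr s * (((1 - r) + \<bar>x\<bar> / 4) powr (- s) + ((1 - r) + (2 * pi - \<bar>x\<bar>) / 4) powr (- s))"
proof -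
  define d where "d = min \<bar>x\<bar> (2 * pi - \<bar>x\<bar>)"
  have d: "d \<ge> 0" using x by (simp add: d_def)
  have "((1 - r) + d / 4) / 2 \<le> cmod (1 - of_real r * cis x)"
    using norm_one_minus_cis_ge[OF r x] by (simp add: d_def)
  moreover have pos: "0 < ((1 - r) + d / 4) / 2" using r d by simp
  ultimately have "circle_kernel s r x \<le> (((1 - r) + d / 4) / 2) powr (- s)"
    unfolding circle_kernel_def using s by (intro powr_mono2') auto
  also have "\<dots> = 2 powr s * ((1 - r) + d / 4) powr (- s)"
    using pos by (subst powr_divide) (auto simp: powr_minus divide_simps)
  also have "((1 - r) + d / 4) powr (- s) \<le>
      ((1 - r) + \<bar>x\<bar> / 4) powr (- s) + ((1 - r) + (2 * pi - \<bar>x\<bar>) / 4) powr (- s)"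
    by (cases "\<bar>x\<bar> \<le> 2 * pi - \<bar>x\<bar>") (auto simp: d_def min_def)
  finally show ?thesis by simp
qed

text \<open>
  On the four quarters of the window the distance of \<open>x\<close> to the nearest multiple of \<open>2 * pi\<close> is
  \<open>x\<close>, \<open>- x\<close>, \<open>2 * pi - x\<close> or \<open>2 * pi + x\<close>. The kernel is therefore dominated by four isometric copies of one
  function with an explicit primitive.
\<close>

lemma circle_kernel_mass_le_integral:
  assumes r: "0 \<le> r" "r < 1" and s: "s > 0" "s \<noteq> 1"
  shows "circle_kernel_mass s r \<le> ennreal (2 powr s * (4 * (4 / (1 - s) *
    ((1 - r + pi / 2) powr (1 - s) - (1 - r) powr (1 - s)))))"
proof -
  define g where "g x = ennreal (((1 - r) + x / 4) powr (- s)) * indicator {0..2*pi} x" for x :: real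
  have [measurable]: "g \<in> borel_measurable borel" unfolding g_def by measurable
  define J where "J = 4 / (1 - s) * ((1 - r + pi / 2) powr (1 - s) - (1 - r) powr (1 - s))"
  have "(\<integral>\<^sup>+x. g x \<partial>lborel) = ennreal (4 / (1 - s) * ((1 - r) + 2 * pi / 4) powr (1 - s) - 4 / (1 - s) * ((1 - r) + 0 / 4) powr (1 - s))"
    unfolding g_def
  proof (rule nn_integral_FTC_Icc)
    show "(\<lambda>x. (1 - r + x / 4) powr - s) \<in> borel_measurable borel" by measurable
    fix x :: real assume x: "x \<in> {0..2*pi}"
    then have pos: "0 < 1 - r + x / 4" using r by (simp add: add_pos_nonneg)
    show "((\<lambda>x. 4 / (1 - s) * (1 - r + x / 4) powr (1 - s)) has_real_derivative (1 - r + x / 4) powr - s) (at x)"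
    proof -
      have "((\<lambda>x. (1 - r + x / 4) powr (1 - s)) has_real_derivative (1 - s) * (1 - r + x / 4) powr (1 - s - 1) * (1 / 4)) (at x)"
        using pos by (auto intro!: derivative_eq_intros)
      from DERIV_cmult[OF this, of "4 / (1 - s)"] show ?thesis using s by simp
    qed
  qed (use r in auto)
  then have J: "(\<integral>\<^sup>+x. g x \<partial>lborel) = ennreal J" by (simp add: J_def right_diff_distrib)
  have J0: "J \<ge> 0"
  proof (cases "s < 1")
    case True
    then have "(1 - r) powr (1 - s) \<le> (1 - r + pi / 2) powr (1 - s)" using r by (intro powr_mono2) auto
    then show ?thesis unfolding J_def using True by simp
  next
    case False
    then have "(1 - r + pi / 2) powr (1 - s) \<le> (1 - r) powr (1 - s)" using r s by (intro powr_mono2') auto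
    then show ?thesis unfolding J_def using False by (intro mult_nonpos_nonpos) auto
  qed
  have "circle_kernel_mass s r \<le> (\<integral>\<^sup>+x. ennreal (2 powr s) * (g x + g (0 + (- 1) * x) + g (2*pi + (- 1) * x) + g (2*pi + 1 * x)) \<partial>lborel)"
    unfolding circle_kernel_mass_def
  proof (rule nn_integral_mono)
    fix x :: real
    show "ennreal (circle_kernel s r x) * indicator {-2*pi..2*pi} x \<le>
      ennreal (2 powr s) * (g x + g (0 + (- 1) * x) + g (2*pi + (- 1) * x) + g (2*pi + 1 * x))"
    proof (cases "\<bar>x\<bar> \<le> 2 * pi")
      case True
      have le: "ennreal (circle_kernel s r x) \<le> ennreal (2 powr s) * (g \<bar>x\<bar> + g (2 * pi - \<bar>x\<bar>))"
        using circle_kernel_le[OF r True s(1)] True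
        by (simp add: g_def ennreal_mult[symmetric] ennreal_plus[symmetric] ennreal_leI del: ennreal_plus)
      have "g \<bar>x\<bar> + g (2 * pi - \<bar>x\<bar>) \<le> g x + g (0 + (- 1) * x) + g (2*pi + (- 1) * x) + g (2*pi + 1 * x)"
      proof (cases "x \<ge> 0")
        case True
        have "g x + g (2 * pi - x) \<le> (g x + g (2 * pi - x)) + (g (- x) + g (2 * pi + x))" by simp
        then show ?thesis using True by (simp add: ac_simps)
      next
        case False
        have "g (- x) + g (2 * pi + x) \<le> (g (- x) + g (2 * pi + x)) + (g x + g (2 * pi - x))" by simp
        then show ?thesis using False by (simp add: ac_simps)
      qed
      then have "ennreal (2 powr s) * (g \<bar>x\<bar> + g (2 * pi - \<bar>x\<bar>)) \<le> ennreal (2 powr s) * (g x + g (0 + (- 1) * x) + g (2*pi + (- 1) * x) + g (2*pi + 1 * x))"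
        by (rule mult_left_mono) simp
      with le have "ennreal (circle_kernel s r x) \<le> ennreal (2 powr s) * (g x + g (0 + (- 1) * x) + g (2*pi + (- 1) * x) + g (2*pi + 1 * x))"
        by (rule order_trans)
      moreover have "indicator {-2*pi..2*pi} x = (1::ennreal)" using True by (auto simp: indicator_def)
      ultimately show ?thesis by simp
    next
      case False
      then have "indicator {-2*pi..2*pi} x = (0::ennreal)" by (auto simp: indicator_def)
      then show ?thesis by simp
    qed
  qed
  also have "\<dots> = ennreal (2 powr s) * ((\<integral>\<^sup>+x. g x \<partial>lborel) + (\<integral>\<^sup>+x. g (0 + (- 1) * x) \<partial>lborel) +
      (\<integral>\<^sup>+x. g (2*pi + (- 1) * x) \<partial>lborel) + (\<integral>\<^sup>+x. g (2*pi + 1 * x) \<partial>lborel))"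
    by (simp add: nn_integral_cmult nn_integral_add)
  also have "(\<integral>\<^sup>+x. g (0 + (- 1) * x) \<partial>lborel) = ennreal J"
    using nn_integral_real_affine[of g "- 1" 0] J by simp
  also have "(\<integral>\<^sup>+x. g (2*pi + (- 1) * x) \<partial>lborel) = ennreal J"
    using nn_integral_real_affine[of g "- 1" "2*pi"] J by simp
  also have "(\<integral>\<^sup>+x. g (2*pi + 1 * x) \<partial>lborel) = ennreal J"
    using nn_integral_real_affine[of g 1 "2*pi"] J by simp
  finally have "circle_kernel_mass s r \<le> ennreal (2 powr s) * (ennreal J + ennreal J + ennreal J + ennreal J)"
    unfolding J .
  also have "\<dots> = ennreal (2 powr s * (4 * J))"
    using J0 by (simp add: ennreal_mult[symmetric] ennreal_plus[symmetric] del: ennreal_plus)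
  finally show ?thesis unfolding J_def .
qed

text \<open>
  The primitive of \<open>t powr (- \<alpha> - 1)\<close> is dominated by its value at the lower end \<open>1 - r\<close> for \<open>\<alpha> > 0\<close>, and by its
  bounded value at the upper end for \<open>\<alpha> < 0\<close>.
\<close>

lemma circle_kernel_mass_bound:
  assumes \<alpha>: "\<alpha> > -1" "\<alpha> \<noteq> 0"
  obtains C where "C > 0" "\<And>r. 0 \<le> r \<Longrightarrow> r < 1 \<Longrightarrow> \<exists>B>0. circle_kernel_mass (\<alpha> + 1) r \<le> ennreal B \<and>
    (1 - r\<^sup>2) powr \<alpha> * B \<le> C * (1 - r\<^sup>2) powr (min \<alpha> 0)"
proof (cases "\<alpha> > 0")
  case True
  define C where "C = 2 powr (\<alpha> + 1) * (4 * (4 / \<alpha> * 2 powr \<alpha>))"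
  show ?thesis
  proof (rule that[of C])
    show "C > 0" using True by (simp add: C_def)
    fix r :: real assume r: "0 \<le> r" "r < 1"
    define B where "B = 2 powr (\<alpha> + 1) * (4 * (4 / \<alpha> * (1 - r) powr (- \<alpha>)))"
    have B: "B > 0" using True r by (simp add: B_def)
    have "circle_kernel_mass (\<alpha> + 1) r \<le> ennreal (2 powr (\<alpha> + 1) * (4 * (4 / (1 - (\<alpha> + 1)) *
        ((1 - r + pi / 2) powr (1 - (\<alpha> + 1)) - (1 - r) powr (1 - (\<alpha> + 1))))))"
      using r \<alpha> by (intro circle_kernel_mass_le_integral) auto
    also have "\<dots> \<le> ennreal B"
    proof (intro ennreal_leI)
      have "4 / (1 - (\<alpha> + 1)) * ((1 - r + pi / 2) powr (1 - (\<alpha> + 1)) - (1 - r) powr (1 - (\<alpha> + 1))) =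
          4 / \<alpha> * ((1 - r) powr (- \<alpha>) - (1 - r + pi / 2) powr (- \<alpha>))"
        using \<alpha> by (simp add: field_simps)
      also have "\<dots> \<le> 4 / \<alpha> * (1 - r) powr (- \<alpha>)" using True by (intro mult_left_mono) auto
      finally show "2 powr (\<alpha> + 1) * (4 * (4 / (1 - (\<alpha> + 1)) *
          ((1 - r + pi / 2) powr (1 - (\<alpha> + 1)) - (1 - r) powr (1 - (\<alpha> + 1))))) \<le> B"
        unfolding B_def by (intro mult_left_mono) auto
    qed
    finally have 1: "circle_kernel_mass (\<alpha> + 1) r \<le> ennreal B" .
    have e: "1 - r\<^sup>2 = (1 - r) * (1 + r)" by (simp add: power2_eq_square algebra_simps)
    have "(1 - r\<^sup>2) powr \<alpha> * (1 - r) powr (- \<alpha>) = (1 + r) powr \<alpha> * ((1 - r) powr \<alpha> * (1 - r) powr (- \<alpha>))"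
      unfolding e using r by (simp add: powr_mult mult_ac)
    also have "\<dots> = (1 + r) powr \<alpha>" using r by (simp add: powr_add[symmetric])
    also have "\<dots> \<le> 2 powr \<alpha>" using True r by (intro powr_mono2) auto
    finally have "2 powr (\<alpha> + 1) * (4 * (4 / \<alpha> * ((1 - r\<^sup>2) powr \<alpha> * (1 - r) powr (- \<alpha>)))) \<le> C"
      unfolding C_def using True by (intro mult_left_mono) auto
    then have "(1 - r\<^sup>2) powr \<alpha> * B \<le> C" by (simp add: B_def mult_ac)
    moreover have "r\<^sup>2 < 1" using r by (simp add: power_less_one_iff abs_square_less_1)
    ultimately show "\<exists>B>0. circle_kernel_mass (\<alpha> + 1) r \<le> ennreal B \<and>
        (1 - r\<^sup>2) powr \<alpha> * B \<le> C * (1 - r\<^sup>2) powr (min \<alpha> 0)"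
      using 1 B True by (intro exI[of _ B]) simp
  qed
next
  case False
  then have neg: "\<alpha> < 0" using \<alpha> by simp
  define C where "C = 2 powr (\<alpha> + 1) * (4 * (4 / (- \<alpha>) * 3 powr (- \<alpha>)))"
  show ?thesis
  proof (rule that[of C])
    show C: "C > 0" unfolding C_def using neg by (intro mult_pos_pos divide_pos_pos) auto
    fix r :: real assume r: "0 \<le> r" "r < 1"
    have "circle_kernel_mass (\<alpha> + 1) r \<le> ennreal (2 powr (\<alpha> + 1) * (4 * (4 / (1 - (\<alpha> + 1)) *
        ((1 - r + pi / 2) powr (1 - (\<alpha> + 1)) - (1 - r) powr (1 - (\<alpha> + 1))))))"
      using r \<alpha> by (intro circle_kernel_mass_le_integral) auto
    also have "\<dots> \<le> ennreal C"
    proof (intro ennreal_leI)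
      have "(1 - r + pi / 2) powr (- \<alpha>) \<le> 3 powr (- \<alpha>)" using neg r pi_less_4 by (intro powr_mono2) auto
      then have "(1 - r + pi / 2) powr (1 - (\<alpha> + 1)) - (1 - r) powr (1 - (\<alpha> + 1)) \<le> 3 powr (- \<alpha>)"
      proof -
        assume *: "(1 - r + pi / 2) powr (- \<alpha>) \<le> 3 powr (- \<alpha>)"
        have e: "1 - (\<alpha> + 1) = - \<alpha>" by simp
        show ?thesis unfolding e using * powr_ge_zero[of "1 - r" "- \<alpha>"] by linarith
      qed
      then have "4 / (- \<alpha>) * ((1 - r + pi / 2) powr (1 - (\<alpha> + 1)) - (1 - r) powr (1 - (\<alpha> + 1))) \<le> 4 / (- \<alpha>) * 3 powr (- \<alpha>)"
        using neg by (intro mult_left_mono) (auto simp: divide_nonneg_neg)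
      then show "2 powr (\<alpha> + 1) * (4 * (4 / (1 - (\<alpha> + 1)) *
          ((1 - r + pi / 2) powr (1 - (\<alpha> + 1)) - (1 - r) powr (1 - (\<alpha> + 1))))) \<le> C"
        unfolding C_def by (intro mult_left_mono) auto
    qed
    finally show "\<exists>B>0. circle_kernel_mass (\<alpha> + 1) r \<le> ennreal B \<and>
        (1 - r\<^sup>2) powr \<alpha> * B \<le> C * (1 - r\<^sup>2) powr (min \<alpha> 0)"
      using C neg by (intro exI[of _ C]) (simp add: mult_ac)
  qed
qed

section \<open>A Young inequality on circles\<close>

lemma powr_ge_tangent:
  fixes x m q :: real
  assumes q: "q \<ge> 1" and x: "x \<ge> 0" and m: "m \<ge> 0"
  shows "m powr q + q * m powr (q - 1) * (x - m) \<le> x powr q"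
proof -
  consider "m = 0" | "m > 0" "x = 0" | "m > 0" "x > 0" using x m by linarith
  then show ?thesis
  proof cases
    case 1
    then show ?thesis by simp
  next
    case 2
    have "m powr (q - 1) * m = m powr q" using 2 by (simp add: powr_diff)
    then have "m powr q + q * m powr (q - 1) * (x - m) = (1 - q) * m powr q"
      using 2 by (simp add: algebra_simps)
    also have "\<dots> \<le> 0" using q by (intro mult_nonpos_nonneg) auto
    finally show ?thesis using 2 by simp
  next
    case 3
    have "(x powr q) powr (1 / q) * (m powr q) powr (1 - 1 / q) \<le> 1 / q * x powr q + (1 - 1 / q) * m powr q"
      using q 3 by (intro Youngs_inequality_0) auto
    moreover have "(x powr q) powr (1 / q) = x" using q 3 by (simp add: powr_powr)
    moreover have "(m powr q) powr (1 - 1 / q) = m powr (q - 1)"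
      using q by (simp add: powr_powr right_diff_distrib)
    ultimately have "x * m powr (q - 1) \<le> 1 / q * x powr q + (1 - 1 / q) * m powr q" by simp
    then have "q * (x * m powr (q - 1)) \<le> q * (1 / q * x powr q + (1 - 1 / q) * m powr q)"
      using q by (intro mult_left_mono) auto
    also have "\<dots> = x powr q + (q - 1) * m powr q" using q by (simp add: field_simps)
    finally have ineq: "q * (x * m powr (q - 1)) \<le> x powr q + q * m powr q - m powr q" by (simp add: left_diff_distrib)
    have e: "m powr (q - 1) * m = m powr q" using 3 by (simp add: powr_diff)
    have "m powr q + q * m powr (q - 1) * (x - m) = m powr q + q * (x * m powr (q - 1)) - q * (m powr (q - 1) * m)"
      by (simp add: algebra_simps)
    also have "\<dots> \<le> x powr q" unfolding e using ineq by linarith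
    finally show ?thesis .
  qed
qed

text \<open>
  Jensen's inequality for the probability density \<open>k / \<integral> k\<close>, by integrating the inequality between
  \<open>x powr q\<close> and its tangent at the weighted mean of \<open>u\<close>.
\<close>

lemma integral_powr_le_weighted:
  fixes k u :: "'a \<Rightarrow> real"
  assumes k: "integrable M k" "\<And>x. k x \<ge> 0" "(LINT x|M. k x) > 0" and u: "\<And>x. u x \<ge> 0"
    and ku: "integrable M (\<lambda>x. k x * u x)" and kuq: "integrable M (\<lambda>x. k x * u x powr q)" and q: "q \<ge> 1"
  shows "(LINT x|M. k x * u x) powr q \<le> (LINT x|M. k x) powr (q - 1) * (LINT x|M. k x * u x powr q)"
proof -
  define n where "n = (LINT x|M. k x)"
  define m where "m = (LINT x|M. k x * u x) / n"
  have n: "n > 0" using k by (simp add: n_def)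
  have I: "(LINT x|M. k x * u x) = m * n" using n by (simp add: m_def)
  have "(LINT x|M. k x * u x) \<ge> 0" using k u by (intro integral_nonneg_AE) auto
  then have m: "m \<ge> 0" using n by (simp add: m_def)
  have "m powr q * n = (LINT x|M. m powr q * k x + q * m powr (q - 1) * (k x * u x - m * k x))"
    using k ku by (simp add: n_def[symmetric] I)
  also have "\<dots> \<le> (LINT x|M. k x * u x powr q)"
  proof (rule integral_mono)
    fix x
    have "k x * (m powr q + q * m powr (q - 1) * (u x - m)) \<le> k x * u x powr q"
      using powr_ge_tangent[OF q u m] k(2) by (intro mult_left_mono)
    then show "m powr q * k x + q * m powr (q - 1) * (k x * u x - m * k x) \<le> k x * u x powr q"
      by (simp add: algebra_simps)
  qed (use k ku kuq in auto)
  finally have *: "m powr q * n \<le> (LINT x|M. k x * u x powr q)" .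
  have "(m * n) powr q = m powr q * n powr q" using m n by (simp add: powr_mult)
  also have "n powr q = n powr (q - 1) * n" using n by (simp add: powr_diff)
  finally have "(m * n) powr q = n powr (q - 1) * (m powr q * n)" by simp
  also have "\<dots> \<le> n powr (q - 1) * (LINT x|M. k x * u x powr q)" using * by (intro mult_left_mono) auto
  finally show ?thesis unfolding I n_def .
qed

lemma circle_kernel_rotate:
  "cmod (1 - (of_real r * cis \<phi>) * cis (- \<theta>)) powr (- s) = circle_kernel s r (\<phi> - \<theta>)"
  by (simp add: circle_kernel_def cis_mult mult.assoc)

lemma circle_kernel_pos:
  assumes "0 \<le> r" "r < 1"
  shows "circle_kernel s r x > 0"
proof -
  have "1 - r \<le> cmod (1 - of_real r * cis x)"
    using norm_triangle_ineq2[of 1 "of_real r * cis x"] assms by (simp add: norm_mult)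
  then have "cmod (1 - of_real r * cis x) > 0" using assms by linarith
  then show ?thesis by (simp add: circle_kernel_def)
qed

lemma continuous_circle_kernel:
  assumes "0 \<le> r" "r < 1"
  shows "continuous_on S (circle_kernel s r)"
proof -
  have "1 - of_real r * cis x \<noteq> 0" for x
    using circle_kernel_pos[OF assms, of 1 x] by (auto simp: circle_kernel_def)
  then show ?thesis unfolding circle_kernel_def[abs_def]
    by (intro continuous_on_powr continuous_intros) auto
qed

lemma nn_integral_lebesgue_on:
  assumes "S \<in> sets lebesgue"
  shows "(\<integral>\<^sup>+x. f x \<partial>lebesgue_on S) = (\<integral>\<^sup>+x. f x * indicator S x \<partial>lborel)"
  using assms by (subst nn_integral_restrict_space) (auto simp: nn_integral_completion)

lemma circle_kernel_shift_le_mass: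
  assumes r: "0 \<le> r" "r < 1"
  shows "\<theta> \<in> {0..2*pi} \<Longrightarrow> (\<integral>\<^sup>+\<phi>\<in>{0..2*pi}. ennreal (circle_kernel s r (\<phi> - \<theta>)) \<partial>lborel) \<le> circle_kernel_mass s r"
    and "\<phi> \<in> {0..2*pi} \<Longrightarrow> (\<integral>\<^sup>+\<theta>\<in>{0..2*pi}. ennreal (circle_kernel s r (\<phi> - \<theta>)) \<partial>lborel) \<le> circle_kernel_mass s r"
proof -
  define g where "g x = ennreal (circle_kernel s r x) * indicator {-2*pi..2*pi} x" for x
  have [measurable]: "circle_kernel s r \<in> borel_measurable borel"
    by (rule borel_measurable_continuous_onI) (rule continuous_circle_kernel[OF r])
  have [measurable]: "g \<in> borel_measurable borel" unfolding g_def by measurable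
  { assume \<theta>: "\<theta> \<in> {0..2*pi}"
    have "(\<integral>\<^sup>+\<phi>\<in>{0..2*pi}. ennreal (circle_kernel s r (\<phi> - \<theta>)) \<partial>lborel) \<le> (\<integral>\<^sup>+\<phi>. g (- \<theta> + 1 * \<phi>) \<partial>lborel)"
      using \<theta> by (intro nn_integral_mono) (auto simp: g_def indicator_def)
    also have "\<dots> = circle_kernel_mass s r"
      using nn_integral_real_affine[of g 1 "- \<theta>"] by (simp add: circle_kernel_mass_def g_def)
    finally show "(\<integral>\<^sup>+\<phi>\<in>{0..2*pi}. ennreal (circle_kernel s r (\<phi> - \<theta>)) \<partial>lborel) \<le> circle_kernel_mass s r" . }
  { assume \<phi>: "\<phi> \<in> {0..2*pi}"
    have "(\<integral>\<^sup>+\<theta>\<in>{0..2*pi}. ennreal (circle_kernel s r (\<phi> - \<theta>)) \<partial>lborel) \<le> (\<integral>\<^sup>+\<theta>. g (\<phi> + (- 1) * \<theta>) \<partial>lborel)"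
      using \<phi> by (intro nn_integral_mono) (auto simp: g_def indicator_def)
    also have "\<dots> = circle_kernel_mass s r"
      using nn_integral_real_affine[of g "- 1" "\<phi>"] by (simp add: circle_kernel_mass_def g_def)
    finally show "(\<integral>\<^sup>+\<theta>\<in>{0..2*pi}. ennreal (circle_kernel s r (\<phi> - \<theta>)) \<partial>lborel) \<le> circle_kernel_mass s r" . }
qed

lemma circle_kernel_total:
  assumes r: "0 \<le> r" "r < 1" and \<phi>: "\<phi> \<in> {0..2*pi}" and B: "circle_kernel_mass s r \<le> ennreal B" "B > 0"
  shows "integrable (lebesgue_on {0..2*pi}) (\<lambda>\<theta>. circle_kernel s r (\<phi> - \<theta>))"
    "(LINT \<theta>|lebesgue_on {0..2*pi}. circle_kernel s r (\<phi> - \<theta>)) \<le> B"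
    "0 < (LINT \<theta>|lebesgue_on {0..2*pi}. circle_kernel s r (\<phi> - \<theta>))"
proof -
  have c: "continuous_on {0..2*pi} (\<lambda>\<theta>. circle_kernel s r (\<phi> - \<theta>))"
    by (rule continuous_on_compose2[OF continuous_circle_kernel[OF r, of UNIV]]) (auto intro!: continuous_intros)
  then show int: "integrable (lebesgue_on {0..2*pi}) (\<lambda>\<theta>. circle_kernel s r (\<phi> - \<theta>))"
    by (rule continuous_imp_integrable_real)
  have nn: "0 \<le> circle_kernel s r (\<phi> - \<theta>)" for \<theta> by (simp add: circle_kernel_def)
  have "ennreal (LINT \<theta>|lebesgue_on {0..2*pi}. circle_kernel s r (\<phi> - \<theta>)) =
      (\<integral>\<^sup>+\<theta>. ennreal (circle_kernel s r (\<phi> - \<theta>)) \<partial>lebesgue_on {0..2*pi})"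
    using int nn by (subst nn_integral_eq_integral) auto
  also have "\<dots> = (\<integral>\<^sup>+\<theta>\<in>{0..2*pi}. ennreal (circle_kernel s r (\<phi> - \<theta>)) \<partial>lborel)"
    by (rule nn_integral_lebesgue_on) simp
  also have "\<dots> \<le> ennreal B" using circle_kernel_shift_le_mass(2)[OF r \<phi>] B(1) by (rule order_trans)
  finally show "(LINT \<theta>|lebesgue_on {0..2*pi}. circle_kernel s r (\<phi> - \<theta>)) \<le> B" using B(2) by simp
  obtain m where m: "m > 0" "\<And>\<theta>. \<theta> \<in> {0..2*pi} \<Longrightarrow> m \<le> circle_kernel s r (\<phi> - \<theta>)"
  proof -
    have "\<exists>x\<in>{0..2*pi}. \<forall>y\<in>{0..2*pi}. circle_kernel s r (\<phi> - x) \<le> circle_kernel s r (\<phi> - y)"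
      using c by (intro continuous_attains_inf) auto
    then show thesis using that circle_kernel_pos[OF r] by blast
  qed
  have "0 < m * measure (lebesgue_on {0..2*pi}) (space (lebesgue_on {0..2*pi}))"
    using m(1) by (simp add: measure_restrict_space)
  also have "\<dots> = (LINT \<theta>|lebesgue_on {0..2*pi}. m)" by simp
  also have "\<dots> \<le> (LINT \<theta>|lebesgue_on {0..2*pi}. circle_kernel s r (\<phi> - \<theta>))"
    using m int by (intro integral_mono) (auto intro: continuous_imp_integrable_real)
  finally show "0 < (LINT \<theta>|lebesgue_on {0..2*pi}. circle_kernel s r (\<phi> - \<theta>))" .
qed

text \<open>
  The case of the exponent \<open>\<infinity>\<close> in Young's inequality.
\<close>

lemma kernel_mean_sup_bound:
  assumes r: "0 \<le> r" "r < 1" and \<phi>: "\<phi> \<in> {0..2*pi}" and B: "circle_kernel_mass s r \<le> ennreal B" "B > 0"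
    and h: "integrable (lebesgue_on {0..2*pi}) h" and C: "AE \<theta> in lebesgue_on {0..2*pi}. cmod (h \<theta>) \<le> C" "C \<ge> 0"
  shows "kernel_mean s h (of_real r * cis \<phi>) \<le> C * B"
proof -
  note T = circle_kernel_total[OF r \<phi> B]
  have c: "continuous_on {0..2*pi} (\<lambda>\<theta>. circle_kernel s r (\<phi> - \<theta>))"
    by (rule continuous_on_compose2[OF continuous_circle_kernel[OF r, of UNIV]]) (auto intro!: continuous_intros)
  have "kernel_mean s h (of_real r * cis \<phi>) = (LINT \<theta>|lebesgue_on {0..2*pi}. circle_kernel s r (\<phi> - \<theta>) * cmod (h \<theta>))"
    by (simp only: kernel_mean_def circle_kernel_rotate)
  also have "\<dots> \<le> (LINT \<theta>|lebesgue_on {0..2*pi}. C * circle_kernel s r (\<phi> - \<theta>))"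
  proof (rule integral_mono_AE)
    show "integrable (lebesgue_on {0..2*pi}) (\<lambda>\<theta>. circle_kernel s r (\<phi> - \<theta>) * cmod (h \<theta>))"
      using c h by (intro integrable_continuous_times) auto
    show "integrable (lebesgue_on {0..2*pi}) (\<lambda>\<theta>. C * circle_kernel s r (\<phi> - \<theta>))" using T(1) by simp
    show "AE \<theta> in lebesgue_on {0..2*pi}. circle_kernel s r (\<phi> - \<theta>) * cmod (h \<theta>) \<le> C * circle_kernel s r (\<phi> - \<theta>)"
      using C(1) by eventually_elim (metis circle_kernel_pos[OF r] less_imp_le mult.commute mult_left_mono)
  qed
  also have "\<dots> \<le> C * B" using T(2) C(2) by (simp add: mult_left_mono)
  finally show ?thesis .
qed

text \<open>
  Young's inequality for convolution with a kernel of mass \<open>B\<close>: Jensen's inequality at each angle, then an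
  exchange of the order of integration. Since \<open>h\<close> is only Lebesgue measurable, \<open>|h| powr q\<close> is first replaced by a
  Borel function \<open>u'\<close> that agrees with it almost everywhere, so that the integrand is measurable on the product.
\<close>

lemma kernel_mean_circle_bound:
  assumes r: "0 \<le> r" "r < 1" and q: "q \<ge> 1" and B: "circle_kernel_mass s r \<le> ennreal B" "B > 0"
    and h: "integrable (lebesgue_on {0..2*pi}) h" and hq: "integrable (lebesgue_on {0..2*pi}) (\<lambda>\<theta>. cmod (h \<theta>) powr q)"
  shows "(\<integral>\<^sup>+\<phi>\<in>{0..2*pi}. ennreal (kernel_mean s h (of_real r * cis \<phi>) powr q) \<partial>lborel) \<le>
    ennreal (B powr q * (LINT \<theta>|lebesgue_on {0..2*pi}. cmod (h \<theta>) powr q))"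
proof -
  define \<kappa> where "\<kappa> = circle_kernel s r"
  have [measurable]: "\<kappa> \<in> borel_measurable borel"
    unfolding \<kappa>_def by (rule borel_measurable_continuous_onI) (rule continuous_circle_kernel[OF r])
  define u where "u \<theta> = ennreal (cmod (h \<theta>) powr q) * indicator {0..2*pi} \<theta>" for \<theta>
  have "u \<in> borel_measurable lebesgue"
  proof -
    have "(\<lambda>\<theta>. indicator {0..2*pi} \<theta> *\<^sub>R (cmod (h \<theta>) powr q)) \<in> borel_measurable lebesgue"
      using borel_measurable_integrable[OF hq] by (subst borel_measurable_restrict_space_iff[symmetric]) auto
    then have "(\<lambda>\<theta>. ennreal (indicator {0..2*pi} \<theta> *\<^sub>R (cmod (h \<theta>) powr q))) \<in> borel_measurable lebesgue"
      by simp
    also have "(\<lambda>\<theta>. ennreal (indicator {0..2*pi} \<theta> *\<^sub>R (cmod (h \<theta>) powr q))) = u"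
      by (auto simp: u_def indicator_def fun_eq_iff)
    finally show ?thesis .
  qed
  then obtain u' where [measurable]: "u' \<in> borel_measurable lborel" and u': "AE \<theta> in lborel. u \<theta> = u' \<theta>"
    using completion_ex_borel_measurable by blast
  have pt: "ennreal (kernel_mean s h (of_real r * cis \<phi>) powr q) \<le>
      ennreal (B powr (q - 1)) * (\<integral>\<^sup>+\<theta>. ennreal (\<kappa> (\<phi> - \<theta>)) * u' \<theta> \<partial>lborel)" if \<phi>: "\<phi> \<in> {0..2*pi}" for \<phi>
  proof -
    note T = circle_kernel_total[OF r \<phi> B, folded \<kappa>_def]
    have c: "continuous_on {0..2*pi} (\<lambda>\<theta>. \<kappa> (\<phi> - \<theta>))" unfolding \<kappa>_def
      by (rule continuous_on_compose2[OF continuous_circle_kernel[OF r, of UNIV]]) (auto intro!: continuous_intros)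
    have int: "integrable (lebesgue_on {0..2*pi}) (\<lambda>\<theta>. \<kappa> (\<phi> - \<theta>) * cmod (h \<theta>) powr q)"
      using c hq by (rule integrable_continuous_times)
    have nn: "0 \<le> \<kappa> x" for x by (simp add: \<kappa>_def circle_kernel_def)
    have "kernel_mean s h (of_real r * cis \<phi>) powr q = (LINT \<theta>|lebesgue_on {0..2*pi}. \<kappa> (\<phi> - \<theta>) * cmod (h \<theta>)) powr q"
      by (simp only: kernel_mean_def circle_kernel_rotate \<kappa>_def)
    also have "\<dots> \<le> (LINT \<theta>|lebesgue_on {0..2*pi}. \<kappa> (\<phi> - \<theta>)) powr (q - 1) *
        (LINT \<theta>|lebesgue_on {0..2*pi}. \<kappa> (\<phi> - \<theta>) * cmod (h \<theta>) powr q)"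
    proof (rule integral_powr_le_weighted)
      show "integrable (lebesgue_on {0..2*pi}) (\<lambda>\<theta>. \<kappa> (\<phi> - \<theta>) * cmod (h \<theta>))"
        by (rule integrable_continuous_times[OF c integrable_norm[OF h]])
    qed (use T nn q int in auto)
    also have "\<dots> \<le> B powr (q - 1) * (LINT \<theta>|lebesgue_on {0..2*pi}. \<kappa> (\<phi> - \<theta>) * cmod (h \<theta>) powr q)"
      using T q nn by (intro mult_right_mono powr_mono2 integral_nonneg_AE) auto
    finally have "ennreal (kernel_mean s h (of_real r * cis \<phi>) powr q) \<le>
        ennreal (B powr (q - 1) * (LINT \<theta>|lebesgue_on {0..2*pi}. \<kappa> (\<phi> - \<theta>) * cmod (h \<theta>) powr q))"
      by (rule ennreal_leI)
    also have "\<dots> = ennreal (B powr (q - 1)) * ennreal (LINT \<theta>|lebesgue_on {0..2*pi}. \<kappa> (\<phi> - \<theta>) * cmod (h \<theta>) powr q)"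
      using nn by (intro ennreal_mult integral_nonneg_AE) auto
    also have "ennreal (LINT \<theta>|lebesgue_on {0..2*pi}. \<kappa> (\<phi> - \<theta>) * cmod (h \<theta>) powr q) =
        (\<integral>\<^sup>+\<theta>. ennreal (\<kappa> (\<phi> - \<theta>) * cmod (h \<theta>) powr q) \<partial>lebesgue_on {0..2*pi})"
      using int nn by (subst nn_integral_eq_integral) auto
    also have "\<dots> = (\<integral>\<^sup>+\<theta>\<in>{0..2*pi}. ennreal (\<kappa> (\<phi> - \<theta>) * cmod (h \<theta>) powr q) \<partial>lborel)"
      by (rule nn_integral_lebesgue_on) simp
    also have "\<dots> = (\<integral>\<^sup>+\<theta>. ennreal (\<kappa> (\<phi> - \<theta>)) * u \<theta> \<partial>lborel)"
      using nn by (intro nn_integral_cong) (simp add: u_def ennreal_mult mult.assoc)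
    also have "\<dots> = (\<integral>\<^sup>+\<theta>. ennreal (\<kappa> (\<phi> - \<theta>)) * u' \<theta> \<partial>lborel)"
      using u' by (intro nn_integral_cong_AE) auto
    finally show ?thesis .
  qed
  have "(\<integral>\<^sup>+\<phi>\<in>{0..2*pi}. ennreal (kernel_mean s h (of_real r * cis \<phi>) powr q) \<partial>lborel) \<le>
      (\<integral>\<^sup>+\<phi>. ennreal (B powr (q - 1)) * (\<integral>\<^sup>+\<theta>. ennreal (\<kappa> (\<phi> - \<theta>)) * u' \<theta> \<partial>lborel) * indicator {0..2*pi} \<phi> \<partial>lborel)"
    using pt by (intro nn_integral_mono) (auto simp: indicator_def)
  also have "\<dots> = ennreal (B powr (q - 1)) * (\<integral>\<^sup>+\<phi>. (\<integral>\<^sup>+\<theta>. ennreal (\<kappa> (\<phi> - \<theta>)) * u' \<theta> * indicator {0..2*pi} \<phi> \<partial>lborel) \<partial>lborel)"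
  proof -
    have "(\<integral>\<^sup>+\<phi>. ennreal (B powr (q - 1)) * (\<integral>\<^sup>+\<theta>. ennreal (\<kappa> (\<phi> - \<theta>)) * u' \<theta> \<partial>lborel) * indicator {0..2*pi} \<phi> \<partial>lborel) =
        (\<integral>\<^sup>+\<phi>. ennreal (B powr (q - 1)) * (\<integral>\<^sup>+\<theta>. ennreal (\<kappa> (\<phi> - \<theta>)) * u' \<theta> * indicator {0..2*pi} \<phi> \<partial>lborel) \<partial>lborel)"
      by (intro nn_integral_cong) (subst nn_integral_multc, measurable, simp add: mult.assoc)
    then show ?thesis by (simp add: nn_integral_cmult)
  qed
  also have "(\<integral>\<^sup>+\<phi>. (\<integral>\<^sup>+\<theta>. ennreal (\<kappa> (\<phi> - \<theta>)) * u' \<theta> * indicator {0..2*pi} \<phi> \<partial>lborel) \<partial>lborel) =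
      (\<integral>\<^sup>+\<theta>. (\<integral>\<^sup>+\<phi>\<in>{0..2*pi}. ennreal (\<kappa> (\<phi> - \<theta>)) * u' \<theta> \<partial>lborel) \<partial>lborel)"
    by (rule lborel_pair.Fubini') measurable
  also have "\<dots> = (\<integral>\<^sup>+\<theta>. u' \<theta> * (\<integral>\<^sup>+\<phi>\<in>{0..2*pi}. ennreal (\<kappa> (\<phi> - \<theta>)) \<partial>lborel) \<partial>lborel)"
    by (intro nn_integral_cong) (subst nn_integral_cmult[symmetric], measurable, simp add: mult_ac)
  also have "\<dots> = (\<integral>\<^sup>+\<theta>. u \<theta> * (\<integral>\<^sup>+\<phi>\<in>{0..2*pi}. ennreal (\<kappa> (\<phi> - \<theta>)) \<partial>lborel) \<partial>lborel)"
    using u' by (intro nn_integral_cong_AE) auto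
  also have "\<dots> \<le> (\<integral>\<^sup>+\<theta>. u \<theta> * ennreal B \<partial>lborel)"
  proof (rule nn_integral_mono)
    fix \<theta>
    have "(\<integral>\<^sup>+\<phi>\<in>{0..2*pi}. ennreal (\<kappa> (\<phi> - \<theta>)) \<partial>lborel) \<le> ennreal B" if "\<theta> \<in> {0..2*pi}"
      unfolding \<kappa>_def using circle_kernel_shift_le_mass(1)[OF r that] B(1) by (rule order_trans)
    then show "u \<theta> * (\<integral>\<^sup>+\<phi>\<in>{0..2*pi}. ennreal (\<kappa> (\<phi> - \<theta>)) \<partial>lborel) \<le> u \<theta> * ennreal B"
      by (cases "\<theta> \<in> {0..2*pi}") (auto simp: u_def intro: mult_left_mono)
  qed
  also have "\<dots> = (\<integral>\<^sup>+\<theta>. u' \<theta> * ennreal B \<partial>lborel)" using u' by (intro nn_integral_cong_AE) auto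
  also have "\<dots> = (\<integral>\<^sup>+\<theta>. u' \<theta> \<partial>lborel) * ennreal B" by (rule nn_integral_multc) simp
  also have "(\<integral>\<^sup>+\<theta>. u' \<theta> \<partial>lborel) = (\<integral>\<^sup>+\<theta>. u \<theta> \<partial>lborel)" using u' by (intro nn_integral_cong_AE) auto
  also have "\<dots> = (\<integral>\<^sup>+\<theta>. ennreal (cmod (h \<theta>) powr q) \<partial>lebesgue_on {0..2*pi})"
    unfolding u_def by (rule nn_integral_lebesgue_on[symmetric]) simp
  also have "\<dots> = ennreal (LINT \<theta>|lebesgue_on {0..2*pi}. cmod (h \<theta>) powr q)"
    using hq by (subst nn_integral_eq_integral) auto
  finally have "(\<integral>\<^sup>+\<phi>\<in>{0..2*pi}. ennreal (kernel_mean s h (of_real r * cis \<phi>) powr q) \<partial>lborel) \<le>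
      ennreal (B powr (q - 1)) * (ennreal (LINT \<theta>|lebesgue_on {0..2*pi}. cmod (h \<theta>) powr q) * ennreal B)"
    by (simp add: mult_left_mono)
  also have "\<dots> = ennreal (B powr (q - 1) * B * (LINT \<theta>|lebesgue_on {0..2*pi}. cmod (h \<theta>) powr q))"
  proof -
    have "0 \<le> (LINT \<theta>|lebesgue_on {0..2*pi}. cmod (h \<theta>) powr q)" by (intro integral_nonneg_AE) auto
    then show ?thesis using B(2) by (simp add: ennreal_mult[symmetric] mult_ac)
  qed
  also have "B powr (q - 1) * B = B powr q" using B(2) by (simp add: powr_diff)
  finally show ?thesis .
qed

section \<open>Integration over the disk\<close>

text \<open>
  The plane is identified with \<open>real ^ 2\<close>, where orthogonal transformations preserve Lebesgue measure, in
  order to see that rotations preserve the measure on the complex numbers.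
\<close>

definition real2_of_complex :: "complex \<Rightarrow> real ^ 2" where
  "real2_of_complex z = vector [Re z, Im z]"

definition complex_of_real2 :: "real ^ 2 \<Rightarrow> complex" where
  "complex_of_real2 v = Complex (v $ 1) (v $ 2)"

lemma complex_real2_inverse [simp]:
  "complex_of_real2 (real2_of_complex z) = z" "real2_of_complex (complex_of_real2 v) = v"
  by (auto simp: complex_of_real2_def real2_of_complex_def vec_eq_iff forall_2)

lemma linear_real2: "linear real2_of_complex" "linear complex_of_real2"
  by (auto intro!: linearI simp: real2_of_complex_def complex_of_real2_def vec_eq_iff forall_2 complex_eq_iff)

lemma norm_real2: "norm (real2_of_complex z) = cmod z"
  by (simp add: norm_vec_def L2_set_def real2_of_complex_def sum_2 cmod_def)

lemma measurable_real2 [measurable]: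
  "real2_of_complex \<in> borel_measurable borel" "complex_of_real2 \<in> borel_measurable borel"
  by (auto intro!: borel_measurable_continuous_onI linear_continuous_on linear_conv_bounded_linear[THEN iffD1] linear_real2)

lemma Basis_real2: "Basis = {axis 1 (1::real), axis 2 1 :: real ^ 2}"
  by (auto simp: Basis_vec_def UNIV_2)

lemma distr_complex_of_real2: "distr lborel borel complex_of_real2 = lborel"
proof (rule lborel_eqI[symmetric])
  fix l u :: complex assume le: "\<And>b. b \<in> Basis \<Longrightarrow> l \<bullet> b \<le> u \<bullet> b"
  have "Re l \<le> Re u" "Im l \<le> Im u" using le[of 1] le[of \<i>] by (auto simp: Basis_complex_def)
  moreover have vim: "complex_of_real2 -` box l u = box (real2_of_complex l) (real2_of_complex u)"
    by (auto simp: mem_box Basis_real2 Basis_complex_def inner_axis real2_of_complex_def complex_of_real2_def)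
  ultimately have "emeasure lborel (box (real2_of_complex l) (real2_of_complex u)) =
      (\<Prod>b\<in>Basis. (real2_of_complex u - real2_of_complex l) \<bullet> b)"
    by (intro emeasure_lborel_box) (auto simp: Basis_real2 inner_axis real2_of_complex_def)
  note box = this
  have "emeasure (distr lborel borel complex_of_real2) (box l u) =
      emeasure lborel (box (real2_of_complex l) (real2_of_complex u))"
    by (subst emeasure_distr) (auto simp: vim)
  also have "\<dots> = (\<Prod>b\<in>Basis. (real2_of_complex u - real2_of_complex l) \<bullet> b)"
    by (rule box)
  also have "\<dots> = (\<Prod>b\<in>Basis. (u - l) \<bullet> b)"
    by (simp add: Basis_real2 Basis_complex_def inner_axis real2_of_complex_def axis_eq_axis)
  finally show "emeasure (distr lborel borel complex_of_real2) (box l u) = (\<Prod>b\<in>Basis. (u - l) \<bullet> b)" .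
qed simp

lemma distr_lborel_orthogonal:
  fixes f g :: "real ^ 2 \<Rightarrow> real ^ 2"
  assumes g: "orthogonal_transformation g" and f: "\<And>x. f (g x) = x" "\<And>x. g (f x) = x"
    and [measurable]: "f \<in> borel_measurable borel"
  shows "distr lborel borel f = lborel"
proof (rule lborel_eqI[symmetric])
  fix l u :: "real ^ 2" assume le: "\<And>b. b \<in> Basis \<Longrightarrow> l \<bullet> b \<le> u \<bullet> b"
  have vim: "f -` box l u = g ` box l u"
  proof (intro set_eqI iffI)
    fix x assume "x \<in> f -` box l u"
    then show "x \<in> g ` box l u" using f(2)[of x] by (metis image_eqI vimageD)
  next
    fix x assume "x \<in> g ` box l u"
    then show "x \<in> f -` box l u" using f(1) by auto
  qed
  have m: "g ` box l u \<in> lmeasurable" "measure lebesgue (g ` box l u) = measure lebesgue (box l u)"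
    using measurable_orthogonal_image[OF g, of "box l u"] measure_orthogonal_image[OF g, of "box l u"] by auto
  have b: "g ` box l u \<in> sets borel"
    using measurable_sets_borel[of f borel "box l u"] by (simp add: vim[symmetric])
  have "emeasure (distr lborel borel f) (box l u) = emeasure lborel (g ` box l u)"
    by (subst emeasure_distr) (auto simp: vim)
  also have "\<dots> = emeasure lebesgue (g ` box l u)" using b by simp
  also have "\<dots> = ennreal (measure lebesgue (g ` box l u))" using m(1) by (rule emeasure_eq_measure2)
  also have "\<dots> = emeasure lebesgue (box l u)" unfolding m(2)
    by (rule emeasure_eq_measure2[symmetric]) simp
  also have "\<dots> = emeasure lborel (box l u)" by simp
  also have "\<dots> = (\<Prod>b\<in>Basis. (u - l) \<bullet> b)" using le by (rule emeasure_lborel_box)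
  finally show "emeasure (distr lborel borel f) (box l u) = (\<Prod>b\<in>Basis. (u - l) \<bullet> b)" .
qed simp

lemma distr_lborel_rotation:
  assumes e: "cmod e = 1"
  shows "distr lborel borel (\<lambda>z. z * e) = (lborel :: complex measure)"
proof -
  define rot where "rot a v = real2_of_complex (complex_of_real2 v * a)" for a v
  have lin: "linear (rot a)" for a
  proof -
    have "linear (\<lambda>z::complex. z * a)" by (auto intro!: linearI simp: algebra_simps)
    then have "linear (real2_of_complex \<circ> ((\<lambda>z. z * a) \<circ> complex_of_real2))"
      by (intro linear_compose linear_real2)
    then show ?thesis by (simp add: rot_def[abs_def] o_def)
  qed
  have n: "norm (complex_of_real2 v) = norm v" for v by (metis complex_real2_inverse(2) norm_real2)
  have orth: "orthogonal_transformation (rot (cnj e))"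
    unfolding orthogonal_transformation using lin e by (simp add: rot_def norm_real2 norm_mult n)
  have ee: "e * cnj e = 1" using e complex_norm_square[of e] by simp
  have inv: "rot e (rot (cnj e) x) = x" "rot (cnj e) (rot e x) = x" for x
    using ee by (simp_all add: rot_def mult.assoc mult.commute[of "cnj e" e])
  have [measurable]: "rot e \<in> borel_measurable borel" unfolding rot_def by measurable
  have "(lborel :: complex measure) = distr (distr lborel borel (rot e)) borel complex_of_real2"
    using distr_lborel_orthogonal[OF orth inv] distr_complex_of_real2 by simp
  also have "\<dots> = distr lborel borel (complex_of_real2 \<circ> rot e)" by (rule distr_distr) measurable
  also have "complex_of_real2 \<circ> rot e = (\<lambda>z. z * e) \<circ> complex_of_real2" by (auto simp: rot_def)
  also have "distr lborel borel ((\<lambda>z. z * e) \<circ> complex_of_real2) = distr (distr lborel borel complex_of_real2) borel (\<lambda>z. z * e)"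
    by (rule distr_distr[symmetric]) measurable
  finally show ?thesis by (simp add: distr_complex_of_real2)
qed

lemma nn_integral_rotation:
  fixes f :: "complex \<Rightarrow> ennreal"
  assumes [measurable]: "f \<in> borel_measurable borel" and e: "cmod e = 1"
  shows "(\<integral>\<^sup>+z. f (z * e) \<partial>lborel) = (\<integral>\<^sup>+z. f z \<partial>lborel)"
proof -
  have "(\<integral>\<^sup>+z. f z \<partial>lborel) = (\<integral>\<^sup>+z. f z \<partial>distr lborel borel (\<lambda>z. z * e))"
    by (simp add: distr_lborel_rotation[OF e])
  also have "\<dots> = (\<integral>\<^sup>+z. f (z * e) \<partial>lborel)" by (rule nn_integral_distr) measurable
  finally show ?thesis ..
qed

text \<open>
  The disk \<open>{z. 1 - |z|\<^sup>2 > x}\<close> has area \<open>pi * (1 - x)\<close> for \<open>0 \<le> x \<le> 1\<close>. So area measure on the unit disk is pushed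
  forward by \<open>1 - |z|\<^sup>2\<close> to \<open>pi\<close> times Lebesgue measure on \<open>{0<..1}\<close>.
\<close>

lemma nn_integral_disk_radial:
  fixes w :: "real \<Rightarrow> ennreal"
  assumes [measurable]: "w \<in> borel_measurable borel"
  shows "(\<integral>\<^sup>+z\<in>ball 0 1. w (1 - (cmod z)\<^sup>2) \<partial>lborel) =
    ennreal pi * (\<integral>\<^sup>+t\<in>{0<..1}. w t \<partial>lborel)"
proof -
  let ?R = "\<lambda>z. 1 - (cmod z)\<^sup>2"
  have [measurable]: "(indicator (ball 0 1) :: complex \<Rightarrow> ennreal) \<in> borel_measurable borel"
    by (rule borel_measurable_indicator) simp
  define M where "M = distr (density lborel (indicator (ball 0 1))) borel ?R"
  define N where "N = density lborel (\<lambda>t::real. ennreal pi * indicator {0<..1} t)"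
  have eM: "emeasure M {x<..} = ennreal (pi * max 0 (1 - max x 0))" for x
  proof -
    have [measurable]: "?R -` {x<..} \<in> sets borel"
      using measurable_sets_borel[of ?R borel "{x<..}"] by simp
    have "emeasure M {x<..} = emeasure (density lborel (indicator (ball 0 1))) (?R -` {x<..})"
      unfolding M_def by (subst emeasure_distr) auto
    also have "\<dots> = (\<integral>\<^sup>+z. indicator (ball 0 1) z * indicator (?R -` {x<..}) z \<partial>lborel)"
      by (subst emeasure_density) auto
    also have "\<dots> = (\<integral>\<^sup>+z. indicator (ball 0 1 \<inter> (?R -` {x<..})) z \<partial>lborel)"
      by (simp add: indicator_inter_arith)
    also have "\<dots> = emeasure lborel (ball 0 1 \<inter> (?R -` {x<..}))" by (rule nn_integral_indicator) simp
    also have "ball 0 1 \<inter> (?R -` {x<..}) = ball 0 (sqrt (max 0 (1 - max x 0)))"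
    proof (intro set_eqI)
      fix z :: complex
      have "z \<in> ball 0 1 \<longleftrightarrow> (cmod z)\<^sup>2 < 1" by (simp add: abs_square_less_1)
      moreover have "cmod z < sqrt (max 0 (1 - max x 0)) \<longleftrightarrow> (cmod z)\<^sup>2 < max 0 (1 - max x 0)"
        using real_sqrt_less_iff[of "(cmod z)\<^sup>2" "max 0 (1 - max x 0)"] by simp
      ultimately show "z \<in> ball 0 1 \<inter> (?R -` {x<..}) \<longleftrightarrow> z \<in> ball 0 (sqrt (max 0 (1 - max x 0)))"
        by (smt (verit) IntE IntI greaterThan_iff mem_ball_0 vimageE vimageI zero_le_power2)
    qed
    also have "emeasure lborel (ball (0::complex) (sqrt (max 0 (1 - max x 0)))) = ennreal (pi * max 0 (1 - max x 0))"
      by (subst emeasure_ball) (auto simp: unit_ball_vol_2)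
    finally show ?thesis .
  qed
  have eN: "emeasure N {x<..} = ennreal (pi * max 0 (1 - max x 0))" for x
  proof -
    have "emeasure N {x<..} = (\<integral>\<^sup>+t\<in>{x<..}. ennreal pi * indicator {0<..1} t \<partial>lborel)"
      unfolding N_def by (subst emeasure_density) auto
    also have "\<dots> = (\<integral>\<^sup>+t\<in>{max x 0<..1}. ennreal pi \<partial>lborel)"
      by (intro nn_integral_cong) (auto simp: indicator_def)
    also have "\<dots> = ennreal pi * emeasure lborel {max x 0<..1}" by (rule nn_integral_cmult_indicator) simp
    also have "emeasure lborel {max x 0<..1} = ennreal (max 0 (1 - max x 0))"
      by (cases "max x 0 \<le> 1") (auto simp: ennreal_neg)
    finally show ?thesis by (simp add: ennreal_mult)
  qed
  have "M = N"
    by (rule measure_eqI_lessThan) (auto simp: eM eN, auto simp: M_def N_def)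
  have "(\<integral>\<^sup>+z\<in>ball 0 1. w (?R z) \<partial>lborel) = (\<integral>\<^sup>+z. w (?R z) \<partial>density lborel (indicator (ball 0 1)))"
    by (subst nn_integral_density) (auto simp: mult.commute)
  also have "\<dots> = (\<integral>\<^sup>+t. w t \<partial>M)" unfolding M_def by (subst nn_integral_distr) auto
  also have "\<dots> = (\<integral>\<^sup>+t. ennreal pi * indicator {0<..1} t * w t \<partial>lborel)"
    unfolding \<open>M = N\<close> N_def by (subst nn_integral_density) auto
  also have "\<dots> = ennreal pi * (\<integral>\<^sup>+t\<in>{0<..1}. w t \<partial>lborel)"
    by (subst nn_integral_cmult[symmetric]) (auto simp: mult_ac)
  finally show ?thesis .
qed

lemma nn_integral_powr_unit_finite:
  assumes "a > -1"
  shows "(\<integral>\<^sup>+t\<in>{0<..1}. ennreal (t powr a) \<partial>lborel) < \<infinity>"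
proof -
  have "((\<lambda>t. t powr a) has_integral (1 powr (a + 1) / (a + 1))) {0..1}"
    using assms by (intro has_integral_powr_from_0) auto
  from nn_integral_has_integral_lebesgue[OF _ this]
  have "(\<integral>\<^sup>+t. ennreal (indicator {0..1} t * t powr a) \<partial>lborel) = ennreal (1 powr (a + 1) / (a + 1))"
    by (simp add: nn_integral_completion)
  moreover have "(\<integral>\<^sup>+t\<in>{0<..1}. ennreal (t powr a) \<partial>lborel) \<le>
      (\<integral>\<^sup>+t. ennreal (indicator {0..1} t * t powr a) \<partial>lborel)"
    by (intro nn_integral_mono) (auto simp: indicator_def)
  ultimately show ?thesis by (simp add: le_less_trans)
qed

lemma nn_integral_powr_unit_infinite:
  assumes "a \<le> -1"
  shows "(\<integral>\<^sup>+t\<in>{0<..1}. ennreal (t powr a) \<partial>lborel) = \<infinity>"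
proof (rule ccontr)
  assume "\<not> ?thesis"
  then obtain K where K: "(\<integral>\<^sup>+t\<in>{0<..1}. ennreal (t powr a) \<partial>lborel) = ennreal K" "K \<ge> 0"
    by (cases "\<integral>\<^sup>+t. ennreal (t powr a) * indicator {0<..1} t \<partial>lborel") auto
  \<comment> \<open>The integral of \<open>1 / t\<close> from this point to \<open>1\<close> is \<open>K + 1\<close>.\<close>
  define \<epsilon> where "\<epsilon> = exp (- (K + 1))"
  have \<epsilon>: "0 < \<epsilon>" "\<epsilon> \<le> 1" using K by (auto simp: \<epsilon>_def)
  have "ennreal (ln 1 - ln \<epsilon>) = (\<integral>\<^sup>+t\<in>{\<epsilon>..1}. ennreal (1 / t) \<partial>lborel)"
    using \<epsilon> by (intro nn_integral_FTC_Icc[symmetric]) (auto intro!: derivative_eq_intros)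
  also have "\<dots> \<le> (\<integral>\<^sup>+t\<in>{0<..1}. ennreal (t powr a) \<partial>lborel)"
  proof (rule nn_integral_mono)
    fix t :: real
    show "ennreal (1 / t) * indicator {\<epsilon>..1} t \<le> ennreal (t powr a) * indicator {0<..1} t"
    proof (cases "t \<in> {\<epsilon>..1}")
      case True
      then have t: "0 < t" "t \<le> 1" using \<epsilon> by auto
      have "t powr (- 1) \<le> t powr a" using assms t by (intro powr_mono') auto
      then have "1 / t \<le> t powr a" using t by (simp add: powr_minus_divide)
      then show ?thesis using t True by (simp add: ennreal_leI)
    qed simp
  qed
  also have "\<dots> = ennreal K" by (rule K)
  finally have "ennreal (K + 1) \<le> ennreal K" by (simp add: \<epsilon>_def add.commute)
  then show False using K(2) by simp
qed

text \<open>
  A translate of \<open>{0..2*pi}\<close> by \<open>\<psi>\<close> is covered by three consecutive periods. The constant \<open>3\<close> is harmless, as the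
  lemma only serves to compare upper bounds and to transfer null sets.
\<close>

lemma nn_integral_circle_shift:
  fixes w :: "complex \<Rightarrow> ennreal"
  assumes [measurable]: "w \<in> borel_measurable borel" and \<psi>: "\<bar>\<psi>\<bar> \<le> 2 * pi"
  shows "(\<integral>\<^sup>+\<phi>\<in>{0..2*pi}. w (a * cis \<psi> * cis \<phi>) \<partial>lborel) \<le>
    3 * (\<integral>\<^sup>+\<phi>\<in>{0..2*pi}. w (a * cis \<phi>) \<partial>lborel)"
proof -
  define g where "g \<phi> = w (a * cis \<phi>) * indicator {0..2*pi} \<phi>" for \<phi>
  have [measurable]: "cis \<in> borel_measurable borel" by (intro borel_measurable_continuous_onI continuous_intros)
  have [measurable]: "g \<in> borel_measurable borel" unfolding g_def by measurable
  have "(\<integral>\<^sup>+\<phi>\<in>{0..2*pi}. w (a * cis \<psi> * cis \<phi>) \<partial>lborel) \<le>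
      (\<integral>\<^sup>+\<phi>. g (\<psi> + 1 * \<phi>) + g (\<psi> - 2 * pi + 1 * \<phi>) + g (\<psi> + 2 * pi + 1 * \<phi>) \<partial>lborel)"
  proof (rule nn_integral_mono)
    fix \<phi> :: real
    have c: "cis (\<psi> - 2 * pi + \<phi>) = cis (\<psi> + \<phi>)" "cis (\<psi> + 2 * pi + \<phi>) = cis (\<psi> + \<phi>)"
      by (simp_all add: cis_mult[symmetric] cis_divide[symmetric])
    have e: "a * cis \<psi> * cis \<phi> = a * cis (\<psi> + \<phi>)" by (simp add: cis_mult mult.assoc)
    have "indicator {0..2*pi} \<phi> \<le> (indicator {0..2*pi} (\<psi> + \<phi>) +
        indicator {0..2*pi} (\<psi> - 2 * pi + \<phi>) + indicator {0..2*pi} (\<psi> + 2 * pi + \<phi>) :: ennreal)"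
      using \<psi> by (auto simp: indicator_def)
    then have "w (a * cis \<psi> * cis \<phi>) * indicator {0..2*pi} \<phi> \<le> w (a * cis (\<psi> + \<phi>)) * (indicator {0..2*pi} (\<psi> + \<phi>) +
        indicator {0..2*pi} (\<psi> - 2 * pi + \<phi>) + indicator {0..2*pi} (\<psi> + 2 * pi + \<phi>))"
      unfolding e by (rule mult_left_mono) simp
    also have "\<dots> = g (\<psi> + 1 * \<phi>) + g (\<psi> - 2 * pi + 1 * \<phi>) + g (\<psi> + 2 * pi + 1 * \<phi>)"
      unfolding g_def mult_1 c by (simp add: distrib_left)
    finally show "w (a * cis \<psi> * cis \<phi>) * indicator {0..2*pi} \<phi> \<le> g (\<psi> + 1 * \<phi>) + g (\<psi> - 2 * pi + 1 * \<phi>) + g (\<psi> + 2 * pi + 1 * \<phi>)" .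
  qed
  also have "\<dots> = (\<integral>\<^sup>+\<phi>. g (\<psi> + 1 * \<phi>) \<partial>lborel) + (\<integral>\<^sup>+\<phi>. g (\<psi> - 2 * pi + 1 * \<phi>) \<partial>lborel) +
      (\<integral>\<^sup>+\<phi>. g (\<psi> + 2 * pi + 1 * \<phi>) \<partial>lborel)"
    by (simp add: nn_integral_add)
  also have "\<dots> = (\<integral>\<^sup>+\<phi>. g \<phi> \<partial>lborel) + (\<integral>\<^sup>+\<phi>. g \<phi> \<partial>lborel) + (\<integral>\<^sup>+\<phi>. g \<phi> \<partial>lborel)"
    using nn_integral_real_affine[of g 1 \<psi>] nn_integral_real_affine[of g 1 "\<psi> - 2 * pi"]
      nn_integral_real_affine[of g 1 "\<psi> + 2 * pi"] by simp
  also have "\<dots> = 3 * (\<integral>\<^sup>+\<phi>. g \<phi> \<partial>lborel)"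
  proof -
    have "x + x + x = 3 * x" for x :: ennreal
      by (metis add.commute distrib_right mult_1 numeral_Bit1 numeral_One one_add_one)
    then show ?thesis by blast
  qed
  finally show ?thesis by (simp only: g_def)
qed

text \<open>
  By rotation invariance the area integral equals its average over all rotations of the integrand;
  after exchanging the integrals the inner one is an integral over the circle through \<open>z\<close>, and the outer one is
  radial. The function \<open>u\<close> is replaced by a Borel function \<open>v'\<close>; by the same exchange, almost every circle meets the
  set where they differ in a null set of angles.
\<close>

lemma nn_integral_disk_le_circle_means:
  fixes u :: "complex \<Rightarrow> ennreal" and c :: "real \<Rightarrow> ennreal"
  assumes u: "(\<lambda>z. u z * indicator (ball 0 1) z) \<in> borel_measurable lebesgue"
    and [measurable]: "c \<in> borel_measurable borel"
    and mean: "\<And>r. 0 < r \<Longrightarrow> r < 1 \<Longrightarrow>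
      (\<integral>\<^sup>+\<phi>\<in>{0..2*pi}. u (of_real r * cis \<phi>) \<partial>lborel) \<le> c (1 - r\<^sup>2)"
  shows "ennreal (2 * pi) * (\<integral>\<^sup>+z\<in>ball 0 1. u z \<partial>lborel) \<le>
    3 * (ennreal pi * (\<integral>\<^sup>+t\<in>{0<..1}. c t \<partial>lborel))"
proof -
  have [measurable]: "cis \<in> borel_measurable borel" by (intro borel_measurable_continuous_onI continuous_intros)
  have [measurable]: "(indicator (ball 0 1) :: complex \<Rightarrow> ennreal) \<in> borel_measurable borel"
    by (rule borel_measurable_indicator) simp
  define v where "v z = u z * indicator (ball 0 1) z" for z
  obtain v' where [measurable]: "v' \<in> borel_measurable lborel" and v': "AE z in lborel. v z = v' z"
    using completion_ex_borel_measurable u unfolding v_def by blast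
  obtain N where N: "{z. v z \<noteq> v' z} \<subseteq> N" "N \<in> null_sets lborel"
    using v' by (auto elim!: AE_E simp: null_sets_def)
  then have [measurable]: "N \<in> sets borel" by (auto simp: null_sets_def)
  have rot: "(\<integral>\<^sup>+\<phi>. (\<integral>\<^sup>+z. w (z * cis \<phi>) * indicator {0..2*pi} \<phi> \<partial>lborel) \<partial>lborel) = ennreal (2 * pi) * (\<integral>\<^sup>+z. w z \<partial>lborel)"
    if [measurable]: "w \<in> borel_measurable borel" for w :: "complex \<Rightarrow> ennreal"
  proof -
    have "(\<integral>\<^sup>+\<phi>. (\<integral>\<^sup>+z. w (z * cis \<phi>) * indicator {0..2*pi} \<phi> \<partial>lborel) \<partial>lborel) =
        (\<integral>\<^sup>+\<phi>. (\<integral>\<^sup>+z. w z \<partial>lborel) * indicator {0..2*pi} \<phi> \<partial>lborel)"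
      by (intro nn_integral_cong) (simp add: nn_integral_multc nn_integral_rotation)
    also have "\<dots> = (\<integral>\<^sup>+z. w z \<partial>lborel) * emeasure lborel {0..2*pi}" by (rule nn_integral_cmult_indicator) simp
    finally show ?thesis by (simp add: mult.commute)
  qed
  have fub: "(\<integral>\<^sup>+\<phi>. (\<integral>\<^sup>+z. w (z * cis \<phi>) * indicator {0..2*pi} \<phi> \<partial>lborel) \<partial>lborel) =
      (\<integral>\<^sup>+z. (\<integral>\<^sup>+\<phi>\<in>{0..2*pi}. w (z * cis \<phi>) \<partial>lborel) \<partial>lborel)"
    if [measurable]: "w \<in> borel_measurable borel" for w :: "complex \<Rightarrow> ennreal"
    by (rule lborel_pair.Fubini') measurable

  have "(\<integral>\<^sup>+z. (\<integral>\<^sup>+\<phi>\<in>{0..2*pi}. indicator N (z * cis \<phi>) \<partial>lborel) \<partial>lborel) = 0"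
    using rot[of "indicator N"] fub[of "indicator N"] N(2) by (simp add: null_sets_def)
  moreover have "(\<lambda>z. \<integral>\<^sup>+\<phi>. w (z * cis \<phi>) * indicator {0..2*pi} \<phi> \<partial>lborel) \<in> borel_measurable lborel"
    if [measurable]: "w \<in> borel_measurable borel" for w :: "complex \<Rightarrow> ennreal"
    by measurable
  ultimately have "AE z in lborel. (\<integral>\<^sup>+\<phi>\<in>{0..2*pi}. indicator N (z * cis \<phi>) \<partial>lborel) = (0::ennreal)"
    using nn_integral_0_iff_AE[of "\<lambda>z. \<integral>\<^sup>+\<phi>. indicator N (z * cis \<phi>) * indicator {0..2*pi} \<phi> \<partial>lborel" lborel] by simp
  moreover have "AE z in lborel. z \<noteq> (0::complex)" by (rule AE_lborel_singleton)
  ultimately have "AE z in lborel. (\<integral>\<^sup>+\<phi>\<in>{0..2*pi}. v' (z * cis \<phi>) \<partial>lborel) \<le>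
      3 * (c (1 - (cmod z)\<^sup>2) * indicator (ball 0 1) z)"
  proof eventually_elim
    fix z :: complex
    assume z0: "(\<integral>\<^sup>+\<phi>\<in>{0..2*pi}. indicator N (z * cis \<phi>) \<partial>lborel) = (0::ennreal)" and z: "z \<noteq> 0"
    define \<psi> where "\<psi> = Arg z"
    have \<psi>: "\<bar>\<psi>\<bar> \<le> 2 * pi" using Arg_bounded[of z] pi_gt_zero by (auto simp: \<psi>_def)
    have zp: "z = of_real (cmod z) * cis \<psi>" using rcis_cmod_Arg[of z] by (simp add: rcis_def \<psi>_def)
    then have zm: "of_real (cmod z) = z * cis (- \<psi>)" by (metis cis_mult cis_zero mult.assoc mult.right_neutral add.right_inverse)
    have "(\<integral>\<^sup>+\<phi>\<in>{0..2*pi}. indicator N (of_real (cmod z) * cis \<phi>) \<partial>lborel) \<le>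
        3 * (\<integral>\<^sup>+\<phi>\<in>{0..2*pi}. indicator N (z * cis \<phi>) \<partial>lborel)"
      unfolding zm using \<psi> by (intro nn_integral_circle_shift) auto
    then have "(\<integral>\<^sup>+\<phi>\<in>{0..2*pi}. indicator N (of_real (cmod z) * cis \<phi>) \<partial>lborel) = (0::ennreal)"
      unfolding z0 by simp
    then have "AE \<phi> in lborel. indicator N (of_real (cmod z) * cis \<phi>) * indicator {0..2*pi} \<phi> = (0::ennreal)"
      by (subst (asm) nn_integral_0_iff_AE) auto
    then have ae: "AE \<phi> in lborel. v' (of_real (cmod z) * cis \<phi>) * indicator {0..2*pi} \<phi> =
        v (of_real (cmod z) * cis \<phi>) * indicator {0..2*pi} \<phi>"
    proof eventually_elim
      fix \<phi> :: real
      assume *: "indicator N (of_real (cmod z) * cis \<phi>) * indicator {0..2*pi} \<phi> = (0::ennreal)"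
      have "v x = v' x" if "x \<notin> N" for x using N(1) that by blast
      then show "v' (of_real (cmod z) * cis \<phi>) * indicator {0..2*pi} \<phi> = v (of_real (cmod z) * cis \<phi>) * indicator {0..2*pi} \<phi>"
        using * by (cases "of_real (cmod z) * cis \<phi> \<in> N") (auto simp: indicator_def split: if_splits)
    qed
    have "(\<integral>\<^sup>+\<phi>\<in>{0..2*pi}. v' (z * cis \<phi>) \<partial>lborel) \<le>
        3 * (\<integral>\<^sup>+\<phi>\<in>{0..2*pi}. v' (of_real (cmod z) * cis \<phi>) \<partial>lborel)"
      using nn_integral_circle_shift[of v' \<psi> "of_real (cmod z)"] \<psi> zp[symmetric] by simp
    also have "(\<integral>\<^sup>+\<phi>\<in>{0..2*pi}. v' (of_real (cmod z) * cis \<phi>) \<partial>lborel) =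
        (\<integral>\<^sup>+\<phi>\<in>{0..2*pi}. v (of_real (cmod z) * cis \<phi>) \<partial>lborel)"
      using ae by (rule nn_integral_cong_AE)
    also have "\<dots> \<le> c (1 - (cmod z)\<^sup>2) * indicator (ball 0 1) z"
    proof (cases "z \<in> ball 0 1")
      case True
      then have "(\<integral>\<^sup>+\<phi>\<in>{0..2*pi}. u (of_real (cmod z) * cis \<phi>) \<partial>lborel) \<le> c (1 - (cmod z)\<^sup>2)"
        using z by (intro mean) auto
      then show ?thesis using True by (simp add: v_def norm_mult)
    next
      case False
      then show ?thesis by (simp add: v_def norm_mult)
    qed
    finally show "(\<integral>\<^sup>+\<phi>\<in>{0..2*pi}. v' (z * cis \<phi>) \<partial>lborel) \<le>
      3 * (c (1 - (cmod z)\<^sup>2) * indicator (ball 0 1) z)"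
      by (simp add: mult_left_mono)
  qed
  then have "(\<integral>\<^sup>+z. (\<integral>\<^sup>+\<phi>\<in>{0..2*pi}. v' (z * cis \<phi>) \<partial>lborel) \<partial>lborel) \<le>
      (\<integral>\<^sup>+z. 3 * (c (1 - (cmod z)\<^sup>2) * indicator (ball 0 1) z) \<partial>lborel)"
    by (rule nn_integral_mono_AE)
  also have "\<dots> = 3 * (\<integral>\<^sup>+z\<in>ball 0 1. c (1 - (cmod z)\<^sup>2) \<partial>lborel)"
    by (rule nn_integral_cmult) measurable
  also have "\<dots> = 3 * (ennreal pi * (\<integral>\<^sup>+t\<in>{0<..1}. c t \<partial>lborel))"
    by (subst nn_integral_disk_radial) simp_all
  finally have "ennreal (2 * pi) * (\<integral>\<^sup>+z. v' z \<partial>lborel) \<le> 3 * (ennreal pi * (\<integral>\<^sup>+t\<in>{0<..1}. c t \<partial>lborel))"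
    using rot[of v'] fub[of v'] by simp
  moreover have "(\<integral>\<^sup>+z. v' z \<partial>lborel) = (\<integral>\<^sup>+z. v z \<partial>lborel)" using v' by (intro nn_integral_cong_AE) auto
  ultimately show ?thesis by (simp add: v_def)
qed

lemma integrable_disk_powr_of_circle_means:
  fixes f :: "complex \<Rightarrow> complex"
  assumes f: "f \<in> borel_measurable (lebesgue_on (ball 0 1))" and a: "a > -1"
    and mean: "\<And>r. 0 < r \<Longrightarrow> r < 1 \<Longrightarrow>
      (\<integral>\<^sup>+\<phi>\<in>{0..2*pi}. ennreal (cmod (f (of_real r * cis \<phi>)) powr q) \<partial>lborel) \<le> ennreal (D * (1 - r\<^sup>2) powr a)"
  shows "integrable (lebesgue_on (ball 0 1)) (\<lambda>z. cmod (f z) powr q)"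
proof (rule integrableI_bounded)
  show m: "(\<lambda>z. cmod (f z) powr q) \<in> borel_measurable (lebesgue_on (ball 0 1))" using f by measurable
  let ?c = "\<lambda>t. ennreal \<bar>D\<bar> * ennreal (t powr a)"
  have "(\<lambda>z. ennreal (indicator (ball 0 1) z *\<^sub>R (cmod (f z) powr q))) \<in> borel_measurable lebesgue"
    using m by (subst (asm) borel_measurable_restrict_space_iff) auto
  also have "(\<lambda>z. ennreal (indicator (ball 0 1) z *\<^sub>R (cmod (f z) powr q))) =
      (\<lambda>z. ennreal (cmod (f z) powr q) * indicator (ball 0 1) z)"
    by (auto simp: indicator_def fun_eq_iff)
  finally have "ennreal (2 * pi) * (\<integral>\<^sup>+z\<in>ball 0 1. ennreal (cmod (f z) powr q) \<partial>lborel) \<le>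
      3 * (ennreal pi * (\<integral>\<^sup>+t\<in>{0<..1}. ?c t \<partial>lborel))"
  proof (rule nn_integral_disk_le_circle_means)
    fix r :: real assume r: "0 < r" "r < 1"
    have "ennreal (D * (1 - r\<^sup>2) powr a) \<le> ennreal (\<bar>D\<bar> * (1 - r\<^sup>2) powr a)"
      by (intro ennreal_leI mult_right_mono) auto
    then show "(\<integral>\<^sup>+\<phi>\<in>{0..2*pi}. ennreal (cmod (f (of_real r * cis \<phi>)) powr q) \<partial>lborel) \<le> ?c (1 - r\<^sup>2)"
      using mean[OF r] by (simp add: ennreal_mult)
  qed measurable
  also have "\<dots> = 3 * (ennreal pi * (ennreal \<bar>D\<bar> * (\<integral>\<^sup>+t\<in>{0<..1}. ennreal (t powr a) \<partial>lborel)))"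
    by (simp add: mult.assoc nn_integral_cmult)
  also have "\<dots> < \<infinity>" using nn_integral_powr_unit_finite[OF a] by (simp add: ennreal_mult_less_top)
  finally have "(\<integral>\<^sup>+z\<in>ball 0 1. ennreal (cmod (f z) powr q) \<partial>lborel) < \<infinity>"
    using pi_gt_zero by (auto simp: ennreal_mult_less_top)
  then show "(\<integral>\<^sup>+z. ennreal (norm (cmod (f z) powr q)) \<partial>lebesgue_on (ball 0 1)) < \<infinity>"
    by (subst nn_integral_lebesgue_on) simp_all
qed

section \<open>Membership in Hardy and Lebesgue spaces\<close>

lemma Lp_circle_imp_integrable:
  assumes h: "h \<in> Lp_circle p" and p: "1 \<le> p"
  shows "integrable (lebesgue_on {0..2*pi}) h"
proof -
  have m: "h \<in> borel_measurable (lebesgue_on {0..2*pi})" using h by (simp add: Lp_circle_def Lp_space_def)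
  have fin: "finite_measure (lebesgue_on {0..2*pi})"
    by (rule finite_measure_lebesgue_on) simp
  show ?thesis
  proof (cases "p = \<infinity>")
    case True
    then obtain C where "AE x in lebesgue_on {0..2*pi}. cmod (h x) \<le> C"
      using h by (auto simp: Lp_circle_def Lp_space_def)
    then show ?thesis using m by (intro finite_measure.integrable_const_bound[OF fin])
  next
    case False
    define q where "q = enn2real p"
    have "ennreal q = p" using False by (simp add: q_def less_top)
    then have q: "q \<ge> 1" using p by (metis ennreal_le_iff ennreal_1 enn2real_nonneg q_def)
    have i: "integrable (lebesgue_on {0..2*pi}) (\<lambda>x. cmod (h x) powr q)"
      using h False by (simp add: Lp_circle_def Lp_space_def q_def)
    have c: "integrable (lebesgue_on {0..2*pi}) (\<lambda>x. 1 :: real)"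
      by (intro continuous_imp_integrable_real continuous_intros)
    show ?thesis
    proof (rule Bochner_Integration.integrable_bound[OF Bochner_Integration.integrable_add[OF c i] m], rule AE_I2)
      fix x
      have "cmod (h x) \<le> 1 + cmod (h x) powr q"
      proof (cases "cmod (h x) \<le> 1")
        case True
        then show ?thesis by (simp add: add_increasing2)
      next
        case False
        then have "cmod (h x) powr 1 \<le> cmod (h x) powr q" using q by (intro powr_mono) auto
        then show ?thesis using False by simp
      qed
      then show "norm (h x) \<le> norm (1 + cmod (h x) powr q)" by simp
    qed
  qed
qed

lemma disk_radius_cis:
  assumes "0 \<le> r" "r < 1"
  shows "of_real r * cis \<phi> \<in> ball 0 1" "cmod (of_real r * cis \<phi>) = r"
  using assms by (simp_all add: norm_mult)

text \<open>
  What \<open>dz f\<close> and \<open>dzbar f\<close> have in common: the estimate is informative away from the origin and is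
  complemented by continuity near it.
\<close>

locale kernel_bounded =
  fixes \<alpha> K :: real and g :: "complex \<Rightarrow> complex" and h :: "real \<Rightarrow> complex"
  assumes \<alpha>: "\<alpha> > -1" "\<alpha> \<noteq> 0" and K: "K > 0"
    and g: "continuous_on (ball 0 1) g" and h: "integrable (lebesgue_on {0..2*pi}) h"
    and bound: "\<And>z. z \<in> ball 0 1 \<Longrightarrow>
      cmod z * cmod (g z) \<le> K * ((1 - (cmod z)\<^sup>2) powr \<alpha> * kernel_mean (\<alpha> + 1) h z)"
begin

lemma inner_bound:
  obtains C0 where "C0 > 0" "\<And>z. cmod z \<le> 1 / 2 \<Longrightarrow> cmod (g z) \<le> C0"
proof -
  have "continuous_on (cball 0 (1 / 2)) g" by (rule continuous_on_subset[OF g]) auto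
  from compact_imp_bounded[OF compact_continuous_image[OF this compact_cball]]
  obtain C0 where "C0 > 0" "\<forall>z\<in>cball 0 (1 / 2). cmod (g z) \<le> C0" by (auto simp: bounded_pos)
  then show thesis using that by simp
qed

lemma outer_bound:
  assumes r: "1 / 2 \<le> r" "r < 1"
  shows "cmod (g (of_real r * cis \<phi>)) \<le> 2 * K * ((1 - r\<^sup>2) powr \<alpha> * kernel_mean (\<alpha> + 1) h (of_real r * cis \<phi>))"
proof -
  note d = disk_radius_cis[of r \<phi>]
  have "1 / 2 * cmod (g (of_real r * cis \<phi>)) \<le> r * cmod (g (of_real r * cis \<phi>))"
    using r by (intro mult_right_mono) auto
  also have "\<dots> \<le> K * ((1 - r\<^sup>2) powr \<alpha> * kernel_mean (\<alpha> + 1) h (of_real r * cis \<phi>))"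
    using bound[of "of_real r * cis \<phi>"] d r by simp
  finally show ?thesis by simp
qed

text \<open>
  Below radius \<open>1 / 2\<close> the function is bounded by \<open>C0\<close>, above it Young's inequality applies. As \<open>1 - r\<^sup>2 \<le> 1\<close> and
  the exponent \<open>q * min \<alpha> 0\<close> is not positive, the bound for small radii has the required form too.
\<close>

lemma circle_means_bound:
  assumes q: "q \<ge> 1" and hq: "integrable (lebesgue_on {0..2*pi}) (\<lambda>\<theta>. cmod (h \<theta>) powr q)"
  obtains D where "D \<ge> 0" "\<And>r. 0 < r \<Longrightarrow> r < 1 \<Longrightarrow>
    (\<integral>\<^sup>+\<phi>\<in>{0..2*pi}. ennreal (cmod (g (of_real r * cis \<phi>)) powr q) \<partial>lborel) \<le>
      ennreal (D * (1 - r\<^sup>2) powr (q * min \<alpha> 0))"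
proof -
  obtain C0 where C0: "C0 > 0" "\<And>z. cmod z \<le> 1 / 2 \<Longrightarrow> cmod (g z) \<le> C0" by (rule inner_bound) blast
  obtain C where C: "C > 0" "\<And>r. 0 \<le> r \<Longrightarrow> r < 1 \<Longrightarrow> \<exists>B>0. circle_kernel_mass (\<alpha> + 1) r \<le> ennreal B \<and>
    (1 - r\<^sup>2) powr \<alpha> * B \<le> C * (1 - r\<^sup>2) powr (min \<alpha> 0)"
    using circle_kernel_mass_bound[OF \<alpha>] by blast
  define H where "H = (LINT \<theta>|lebesgue_on {0..2*pi}. cmod (h \<theta>) powr q)"
  have H: "H \<ge> 0" unfolding H_def by (intro integral_nonneg_AE) auto
  define D where "D = 2 * pi * C0 powr q + (2 * K * C) powr q * H"
  show ?thesis
  proof (rule that[of D])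
    show "D \<ge> 0" using H by (simp add: D_def)
    fix r :: real assume r: "0 < r" "r < 1"
    define t where "t = 1 - r\<^sup>2"
    have t: "0 < t" "t \<le> 1" using r by (auto simp: t_def power_less_one_iff abs_square_less_1)
    have tm: "(t powr (min \<alpha> 0)) powr q = t powr (q * min \<alpha> 0)" by (simp add: powr_powr mult.commute)
    show "(\<integral>\<^sup>+\<phi>\<in>{0..2*pi}. ennreal (cmod (g (of_real r * cis \<phi>)) powr q) \<partial>lborel) \<le>
      ennreal (D * (1 - r\<^sup>2) powr (q * min \<alpha> 0))"
    proof (cases "r \<le> 1 / 2")
      case True
      have "(\<integral>\<^sup>+\<phi>\<in>{0..2*pi}. ennreal (cmod (g (of_real r * cis \<phi>)) powr q) \<partial>lborel) \<le>
          (\<integral>\<^sup>+\<phi>\<in>{0..2*pi}. ennreal (C0 powr q) \<partial>lborel)"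
        using True r q by (intro nn_integral_mono mult_right_mono ennreal_leI powr_mono2 C0(2)) (auto simp: norm_mult)
      also have "\<dots> = ennreal (C0 powr q) * emeasure lborel {0..2*pi}" by (rule nn_integral_cmult_indicator) simp
      also have "\<dots> = ennreal (2 * pi * C0 powr q)" by (simp add: ennreal_mult[symmetric] mult.commute)
      also have "\<dots> \<le> ennreal (D * (1 - r\<^sup>2) powr (q * min \<alpha> 0))"
      proof (rule ennreal_leI)
        have "1 \<le> t powr (q * min \<alpha> 0)"
          using t q powr_mono'[of "q * min \<alpha> 0" 0 t] by (simp add: mult_le_0_iff)
        moreover have "2 * pi * C0 powr q \<le> D" using H by (simp add: D_def)
        moreover have "0 \<le> 2 * pi * C0 powr q" "0 \<le> D" using H by (simp_all add: D_def)
        ultimately show "2 * pi * C0 powr q \<le> D * (1 - r\<^sup>2) powr (q * min \<alpha> 0)"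
          unfolding t_def[symmetric] using mult_mono[of "2 * pi * C0 powr q" D 1 "t powr (q * min \<alpha> 0)"] by simp
      qed
      finally show ?thesis .
    next
      case False
      obtain B where B: "B > 0" "circle_kernel_mass (\<alpha> + 1) r \<le> ennreal B" "t powr \<alpha> * B \<le> C * t powr (min \<alpha> 0)"
        using C(2)[of r] r by (auto simp: t_def)
      \<comment> \<open>On a fixed circle the prefactor is a constant and is absorbed into \<open>h\<close>.\<close>
      define c where "c = 2 * K * t powr \<alpha>"
      have c: "c > 0" using K t by (simp add: c_def)
      have ch: "integrable (lebesgue_on {0..2*pi}) (\<lambda>\<theta>. of_real c * h \<theta>)" using h by simp
      have chq: "(\<lambda>\<theta>. cmod (of_real c * h \<theta>) powr q) = (\<lambda>\<theta>. c powr q * cmod (h \<theta>) powr q)"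
        using c by (simp add: norm_mult powr_mult)
      have ckm: "kernel_mean (\<alpha> + 1) (\<lambda>\<theta>. of_real c * h \<theta>) z = c * kernel_mean (\<alpha> + 1) h z" for z
        using c by (simp add: kernel_mean_def norm_mult mult.left_commute[of _ c])
      have "(\<integral>\<^sup>+\<phi>\<in>{0..2*pi}. ennreal (cmod (g (of_real r * cis \<phi>)) powr q) \<partial>lborel) \<le>
          (\<integral>\<^sup>+\<phi>\<in>{0..2*pi}. ennreal (kernel_mean (\<alpha> + 1) (\<lambda>\<theta>. of_real c * h \<theta>) (of_real r * cis \<phi>) powr q) \<partial>lborel)"
      proof (rule nn_integral_mono)
        fix \<phi>
        have "cmod (g (of_real r * cis \<phi>)) powr q \<le> (2 * K * (t powr \<alpha> * kernel_mean (\<alpha> + 1) h (of_real r * cis \<phi>))) powr q"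
          using outer_bound[of r \<phi>] False r q by (intro powr_mono2) (auto simp: t_def)
        also have "\<dots> = kernel_mean (\<alpha> + 1) (\<lambda>\<theta>. of_real c * h \<theta>) (of_real r * cis \<phi>) powr q"
          unfolding ckm by (simp add: c_def mult.assoc)
        finally show "ennreal (cmod (g (of_real r * cis \<phi>)) powr q) * indicator {0..2*pi} \<phi> \<le>
            ennreal (kernel_mean (\<alpha> + 1) (\<lambda>\<theta>. of_real c * h \<theta>) (of_real r * cis \<phi>) powr q) * indicator {0..2*pi} \<phi>"
          by (intro mult_right_mono ennreal_leI) auto
      qed
      also have "\<dots> \<le> ennreal (B powr q * (LINT \<theta>|lebesgue_on {0..2*pi}. cmod (of_real c * h \<theta>) powr q))"
        using r hq by (intro kernel_mean_circle_bound[OF _ _ q B(2,1) ch]) (auto simp: chq)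
      also have "\<dots> = ennreal ((2 * K * t powr \<alpha>) powr q * (B powr q * H))"
        unfolding chq by (simp add: H_def c_def mult_ac)
      also have "\<dots> \<le> ennreal (D * (1 - r\<^sup>2) powr (q * min \<alpha> 0))"
      proof (rule ennreal_leI)
        have "(2 * K * t powr \<alpha>) powr q * (B powr q * H) = (2 * K * t powr \<alpha> * B) powr q * H"
          using K B(1) by (subst powr_mult) auto
        also have "\<dots> \<le> (2 * K * C * t powr (min \<alpha> 0)) powr q * H"
        proof (intro mult_right_mono powr_mono2 H)
          have "2 * K * (t powr \<alpha> * B) \<le> 2 * K * (C * t powr (min \<alpha> 0))" using K B(3) by (intro mult_left_mono) auto
          then show "2 * K * t powr \<alpha> * B \<le> 2 * K * C * t powr (min \<alpha> 0)" by (simp add: mult.assoc)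
        qed (use K B q in auto)
        also have "\<dots> = (2 * K * C) powr q * H * t powr (q * min \<alpha> 0)"
          using K C(1) by (subst powr_mult) (auto simp: tm)
        also have "\<dots> \<le> D * t powr (q * min \<alpha> 0)" by (intro mult_right_mono) (auto simp: D_def)
        finally show "(2 * K * t powr \<alpha>) powr q * (B powr q * H) \<le> D * (1 - r\<^sup>2) powr (q * min \<alpha> 0)"
          by (simp add: t_def)
      qed
      finally show ?thesis .
    qed
  qed
qed

lemma sup_bound:
  assumes pos: "\<alpha> > 0" and A: "AE \<theta> in lebesgue_on {0..2*pi}. cmod (h \<theta>) \<le> A"
  obtains D where "\<And>z. z \<in> ball 0 1 \<Longrightarrow> cmod (g z) \<le> D"
proof -
  obtain C0 where C0: "C0 > 0" "\<And>z. cmod z \<le> 1 / 2 \<Longrightarrow> cmod (g z) \<le> C0" by (rule inner_bound) blast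
  obtain C where C: "C > 0" "\<And>r. 0 \<le> r \<Longrightarrow> r < 1 \<Longrightarrow> \<exists>B>0. circle_kernel_mass (\<alpha> + 1) r \<le> ennreal B \<and>
    (1 - r\<^sup>2) powr \<alpha> * B \<le> C * (1 - r\<^sup>2) powr (min \<alpha> 0)"
    using circle_kernel_mass_bound[OF \<alpha>] by blast
  have A': "AE \<theta> in lebesgue_on {0..2*pi}. cmod (h \<theta>) \<le> \<bar>A\<bar>" using A by eventually_elim auto
  show ?thesis
  proof (rule that[of "max C0 (2 * K * (\<bar>A\<bar> * C))"])
    fix z :: complex assume z: "z \<in> ball 0 1"
    define r where "r = cmod z"
    define \<phi> where "\<phi> = Arg2pi z"
    have r: "0 \<le> r" "r < 1" using z by (auto simp: r_def)
    have \<phi>: "\<phi> \<in> {0..2*pi}" using Arg2pi_ge_0[of z] Arg2pi_lt_2pi[of z] by (simp add: \<phi>_def)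
    have zr: "z = of_real r * cis \<phi>"
      using Arg2pi_eq[of z] by (simp add: r_def \<phi>_def cis_conv_exp)
    show "cmod (g z) \<le> max C0 (2 * K * (\<bar>A\<bar> * C))"
    proof (cases "r \<le> 1 / 2")
      case True
      then show ?thesis using C0(2)[of z] by (simp add: r_def)
    next
      case False
      obtain B where B: "B > 0" "circle_kernel_mass (\<alpha> + 1) r \<le> ennreal B"
        "(1 - r\<^sup>2) powr \<alpha> * B \<le> C * (1 - r\<^sup>2) powr (min \<alpha> 0)"
        using C(2)[of r] r by auto
      have "r\<^sup>2 < 1" using r by (simp add: abs_square_less_1)
      then have B3: "(1 - r\<^sup>2) powr \<alpha> * B \<le> C" using B(3) pos by simp
      have "cmod (g z) \<le> 2 * K * ((1 - r\<^sup>2) powr \<alpha> * kernel_mean (\<alpha> + 1) h z)"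
        unfolding zr using False r by (intro outer_bound) auto
      also have "\<dots> \<le> 2 * K * ((1 - r\<^sup>2) powr \<alpha> * (\<bar>A\<bar> * B))"
        unfolding zr using K by (intro mult_left_mono kernel_mean_sup_bound[OF r \<phi> B(2,1) h A']) auto
      also have "\<dots> = 2 * K * (\<bar>A\<bar> * ((1 - r\<^sup>2) powr \<alpha> * B))" by simp
      also have "\<dots> \<le> 2 * K * (\<bar>A\<bar> * C)" using K B3 by (intro mult_left_mono) auto
      finally show ?thesis by simp
    qed
  qed
qed

lemma measurable_disk: "g \<in> borel_measurable (lebesgue_on (ball 0 1))"
  using g by (intro continuous_imp_measurable_on_sets_lebesgue) auto

lemma in_Lp_disk:
  assumes p: "1 \<le> p" "p \<noteq> \<infinity>" and hp: "h \<in> Lp_circle p" and a: "enn2real p * min \<alpha> 0 > -1"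
  shows "g \<in> Lp_disk p"
proof -
  define q where "q = enn2real p"
  have "ennreal q = p" using p by (simp add: q_def less_top)
  then have q: "q \<ge> 1" using p by (metis ennreal_le_iff ennreal_1 enn2real_nonneg q_def)
  have hq: "integrable (lebesgue_on {0..2*pi}) (\<lambda>\<theta>. cmod (h \<theta>) powr q)"
    using hp p by (simp add: Lp_circle_def Lp_space_def q_def)
  obtain D where "\<And>r. 0 < r \<Longrightarrow> r < 1 \<Longrightarrow>
    (\<integral>\<^sup>+\<phi>\<in>{0..2*pi}. ennreal (cmod (g (of_real r * cis \<phi>)) powr q) \<partial>lborel) \<le>
      ennreal (D * (1 - r\<^sup>2) powr (q * min \<alpha> 0))"
    using circle_means_bound[OF q hq] by blast
  then have "integrable (lebesgue_on (ball 0 1)) (\<lambda>z. cmod (g z) powr q)"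
    using a by (intro integrable_disk_powr_of_circle_means[OF measurable_disk]) (auto simp: q_def)
  then show ?thesis using p measurable_disk by (simp add: Lp_disk_def Lp_space_def q_def)
qed

lemma in_hardy_space:
  assumes pos: "\<alpha> > 0" and p: "1 \<le> p" and hp: "h \<in> Lp_circle p"
  shows "g \<in> hardy_space p"
proof (cases "p = \<infinity>")
  case True
  then obtain A where "AE \<theta> in lebesgue_on {0..2*pi}. cmod (h \<theta>) \<le> A"
    using hp by (auto simp: Lp_circle_def Lp_space_def)
  then obtain D where D: "\<And>z. z \<in> ball 0 1 \<Longrightarrow> cmod (g z) \<le> D" using sup_bound[OF pos] by blast
  have "hardy_norm p g \<le> ereal D"
    unfolding hardy_norm_def using True D by (auto intro!: SUP_least)
  then have "hardy_norm p g < \<infinity>" by (rule le_less_trans) simp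
  then show ?thesis using True measurable_disk by (simp add: hardy_space_def)
next
  case False
  define q where "q = enn2real p"
  have "ennreal q = p" using False by (simp add: q_def less_top)
  then have q: "q \<ge> 1" using p by (metis ennreal_le_iff ennreal_1 enn2real_nonneg q_def)
  have hq: "integrable (lebesgue_on {0..2*pi}) (\<lambda>\<theta>. cmod (h \<theta>) powr q)"
    using hp False by (simp add: Lp_circle_def Lp_space_def q_def)
  obtain D where D: "D \<ge> 0" "\<And>r. 0 < r \<Longrightarrow> r < 1 \<Longrightarrow>
    (\<integral>\<^sup>+\<phi>\<in>{0..2*pi}. ennreal (cmod (g (of_real r * cis \<phi>)) powr q) \<partial>lborel) \<le>
      ennreal (D * (1 - r\<^sup>2) powr (q * min \<alpha> 0))"
    using circle_means_bound[OF q hq] by blast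
  have int: "integrable (lebesgue_on {0..2*pi}) (\<lambda>\<phi>. cmod (g (of_real r * cis \<phi>)) powr q)" if r: "0 < r" "r < 1" for r
  proof -
    have "continuous_on {0..2*pi} (\<lambda>\<phi>. cmod (g (of_real r * cis \<phi>)) powr q)"
    proof (rule continuous_on_powr')
      show "continuous_on {0..2*pi} (\<lambda>\<phi>. cmod (g (of_real r * cis \<phi>)))"
        by (rule continuous_on_norm, rule continuous_on_compose2[OF g])
          (use disk_radius_cis[of r] r in \<open>auto intro!: continuous_intros\<close>)
    qed (use q in auto)
    then show ?thesis by (rule continuous_imp_integrable_real)
  qed
  have le: "integral_mean q r g \<le> (1 / (2 * pi) * D) powr (1 / q)" if r: "r \<in> {0<..<1}" for r
  proof -
    have "r\<^sup>2 < 1" using r by (auto simp: abs_square_less_1)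
    have "ennreal (LINT \<phi>|lebesgue_on {0..2*pi}. cmod (g (of_real r * cis \<phi>)) powr q) =
        (\<integral>\<^sup>+\<phi>. ennreal (cmod (g (of_real r * cis \<phi>)) powr q) \<partial>lebesgue_on {0..2*pi})"
      using int r by (subst nn_integral_eq_integral) auto
    also have "\<dots> = (\<integral>\<^sup>+\<phi>\<in>{0..2*pi}. ennreal (cmod (g (of_real r * cis \<phi>)) powr q) \<partial>lborel)"
      by (rule nn_integral_lebesgue_on) simp
    also have "\<dots> \<le> ennreal D" using D(2)[of r] r pos \<open>r\<^sup>2 < 1\<close> by simp
    finally have "(LINT \<phi>|lebesgue_on {0..2*pi}. cmod (g (of_real r * cis \<phi>)) powr q) \<le> D" using D(1) by simp
    then show ?thesis unfolding integral_mean_def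
      using q by (intro powr_mono2 mult_left_mono mult_nonneg_nonneg integral_nonneg_AE) auto
  qed
  have "hardy_norm p g \<le> ereal ((1 / (2 * pi) * D) powr (1 / q))"
    unfolding hardy_norm_def using False le by (auto simp: q_def[symmetric] intro!: SUP_least)
  then have "hardy_norm p g < \<infinity>" by (rule le_less_trans) simp
  then show ?thesis
    using False measurable_disk int by (auto simp: hardy_space_def integral_mean_exists_def q_def)
qed

end

lemma ereal_bound_of_less_top:
  assumes "x < (\<infinity> :: ereal)"
  shows "\<exists>C>0. x \<le> ereal C"
proof (cases x)
  case (real r)
  then show ?thesis by (intro exI[of _ "max 1 r"]) auto
next
  case MInf
  then show ?thesis by (intro exI[of _ 1]) auto
qed (use assms in auto)

text \<open>
  Bounded circle means are the case of the weight \<open>(1 - r\<^sup>2) powr 0\<close> in the comparison with area integrals.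
\<close>

lemma hardy_space_subset_Lp_disk:
  assumes p: "1 \<le> p"
  shows "hardy_space p \<subseteq> Lp_disk p"
proof
  fix f assume f: "f \<in> hardy_space p"
  then have m: "f \<in> borel_measurable (lebesgue_on (ball 0 1))" and fin: "hardy_norm p f < \<infinity>"
    by (auto simp: hardy_space_def)
  have "\<exists>C>0. hardy_norm p f \<le> ereal C" using fin by (rule ereal_bound_of_less_top)
  then obtain C where C: "C > 0" "hardy_norm p f \<le> ereal C" by blast
  show "f \<in> Lp_disk p"
  proof (cases "p = \<infinity>")
    case True
    have "cmod (f z) \<le> C" if "z \<in> ball 0 1" for z
    proof -
      have "ereal (cmod (f z)) \<le> hardy_norm p f"
        unfolding hardy_norm_def using True that by (auto intro: SUP_upper)
      then show ?thesis using C(2) by (metis ereal_less_eq(3) order_trans)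
    qed
    then have "AE z in lebesgue_on (ball 0 1). cmod (f z) \<le> C" by (intro AE_I2) auto
    then show ?thesis using True m by (auto simp: Lp_disk_def Lp_space_def)
  next
    case False
    define q where "q = enn2real p"
    have "ennreal q = p" using False by (simp add: q_def less_top)
    then have q: "q \<ge> 1" using p by (metis ennreal_le_iff ennreal_1 enn2real_nonneg q_def)
    have "integrable (lebesgue_on (ball 0 1)) (\<lambda>z. cmod (f z) powr q)"
    proof (rule integrable_disk_powr_of_circle_means[OF m, of 0])
      fix r :: real assume r: "0 < r" "r < 1"
      have int: "integrable (lebesgue_on {0..2*pi}) (\<lambda>\<phi>. cmod (f (of_real r * cis \<phi>)) powr q)"
        using f False r by (auto simp: hardy_space_def integral_mean_exists_def q_def)
      define I where "I = (LINT \<phi>|lebesgue_on {0..2*pi}. cmod (f (of_real r * cis \<phi>)) powr q)"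
      have I: "I \<ge> 0" unfolding I_def by (intro integral_nonneg_AE) auto
      have "ereal (integral_mean q r f) \<le> hardy_norm p f"
        unfolding hardy_norm_def using False r by (auto simp: q_def intro: SUP_upper)
      then have "integral_mean q r f \<le> C" using C(2) by (metis ereal_less_eq(3) order_trans)
      then have "((1 / (2 * pi) * I) powr (1 / q)) powr q \<le> C powr q"
        unfolding integral_mean_def I_def[symmetric] using q by (intro powr_mono2) auto
      moreover have "((1 / (2 * pi) * I) powr (1 / q)) powr q = 1 / (2 * pi) * I"
        using q I by (simp add: powr_powr)
      ultimately have "1 / (2 * pi) * I \<le> C powr q" by (simp only:)
      then have "I \<le> 2 * pi * C powr q" by (simp add: field_simps)
      have "(\<integral>\<^sup>+\<phi>\<in>{0..2*pi}. ennreal (cmod (f (of_real r * cis \<phi>)) powr q) \<partial>lborel) =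
          (\<integral>\<^sup>+\<phi>. ennreal (cmod (f (of_real r * cis \<phi>)) powr q) \<partial>lebesgue_on {0..2*pi})"
        by (rule nn_integral_lebesgue_on[symmetric]) simp
      also have "\<dots> = ennreal I" unfolding I_def using int by (intro nn_integral_eq_integral) auto
      also have "\<dots> \<le> ennreal (2 * pi * C powr q)" using \<open>I \<le> 2 * pi * C powr q\<close> by (rule ennreal_leI)
      also have "r\<^sup>2 < 1" using r by (simp add: abs_square_less_1)
      then have "ennreal (2 * pi * C powr q) = ennreal (2 * pi * C powr q * (1 - r\<^sup>2) powr 0)" by simp
      finally show "(\<integral>\<^sup>+\<phi>\<in>{0..2*pi}. ennreal (cmod (f (of_real r * cis \<phi>)) powr q) \<partial>lborel) \<le>
          ennreal (2 * pi * C powr q * (1 - r\<^sup>2) powr 0)" .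
    qed simp
    then show ?thesis using False m by (simp add: Lp_disk_def Lp_space_def q_def)
  qed
qed

text \<open>
  The \<open>q\<close>-th power of the lower bound has the radial integral \<open>\<integral> t powr (\<alpha> * q)\<close> over \<open>{0<..1}\<close>, which is infinite
  for \<open>q \<ge> - 1 / \<alpha>\<close>; an essentially bounded function would have finite \<open>q\<close>-th power integral for
  \<open>q = - 1 / \<alpha>\<close>. The circle means are at least the value of the radial bound, which is unbounded.
\<close>

lemma not_in_spaces_of_lower_bound:
  fixes f :: "complex \<Rightarrow> complex"
  assumes \<alpha>: "\<alpha> < 0" and c: "c > 0" and lower: "\<And>z. z \<in> ball 0 1 \<Longrightarrow> c * (1 - (cmod z)\<^sup>2) powr \<alpha> \<le> cmod (f z)"
  shows "p \<ge> ennreal (- 1 / \<alpha>) \<Longrightarrow> f \<notin> Lp_disk p" and "f \<notin> hardy_space 1"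
proof -
  have [measurable]: "(indicator (ball 0 1) :: complex \<Rightarrow> ennreal) \<in> borel_measurable borel"
    by (rule borel_measurable_indicator) simp
  have inf: "(\<integral>\<^sup>+z\<in>ball 0 1. ennreal (cmod (f z) powr q) \<partial>lborel) = \<infinity>" if q: "q \<ge> - 1 / \<alpha>" for q
  proof -
    have q0: "q \<ge> 0" using q \<alpha> by (smt (verit) divide_neg_neg)
    have "\<alpha> * q \<le> - 1" using q \<alpha> by (simp add: field_simps)
    then have "\<infinity> = ennreal (c powr q) * (ennreal pi * (\<integral>\<^sup>+t\<in>{0<..1}. ennreal (t powr (\<alpha> * q)) \<partial>lborel))"
      using c by (simp add: nn_integral_powr_unit_infinite ennreal_mult_top)
    also have "\<dots> = ennreal (c powr q) * (\<integral>\<^sup>+z\<in>ball 0 1. ennreal ((1 - (cmod z)\<^sup>2) powr (\<alpha> * q)) \<partial>lborel)"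
      by (subst nn_integral_disk_radial) auto
    also have "\<dots> = (\<integral>\<^sup>+z. ennreal (c powr q) * (ennreal ((1 - (cmod z)\<^sup>2) powr (\<alpha> * q)) * indicator (ball 0 1) z) \<partial>lborel)"
      by (rule nn_integral_cmult[symmetric]) measurable
    also have "\<dots> \<le> (\<integral>\<^sup>+z\<in>ball 0 1. ennreal (cmod (f z) powr q) \<partial>lborel)"
    proof (rule nn_integral_mono)
      fix z :: complex
      show "ennreal (c powr q) * (ennreal ((1 - (cmod z)\<^sup>2) powr (\<alpha> * q)) * indicator (ball 0 1) z) \<le>
          ennreal (cmod (f z) powr q) * indicator (ball 0 1) z"
      proof (cases "z \<in> ball 0 1")
        case True
        have "c powr q * (1 - (cmod z)\<^sup>2) powr (\<alpha> * q) = (c * (1 - (cmod z)\<^sup>2) powr \<alpha>) powr q"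
          using c by (subst powr_mult) (auto simp: powr_powr)
        also have "\<dots> \<le> cmod (f z) powr q" using lower[OF True] c q0 by (intro powr_mono2) auto
        finally show ?thesis using True by (simp add: ennreal_mult[symmetric] ennreal_leI)
      qed simp
    qed
    finally show ?thesis by (simp add: top.extremum_unique)
  qed
  show "f \<notin> Lp_disk p" if p: "p \<ge> ennreal (- 1 / \<alpha>)"
  proof
    assume f: "f \<in> Lp_disk p"
    show False
    proof (cases "p = \<infinity>")
      case False
      define q where "q = enn2real p"
      have "ennreal q = p" using False by (simp add: q_def less_top)
      then have "q \<ge> - 1 / \<alpha>" using p by (metis ennreal_le_iff enn2real_nonneg q_def)
      have "integrable (lebesgue_on (ball 0 1)) (\<lambda>z. cmod (f z) powr q)"
        using f False by (simp add: Lp_disk_def Lp_space_def q_def)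
      then have "(\<integral>\<^sup>+z. ennreal (cmod (f z) powr q) \<partial>lebesgue_on (ball 0 1)) < \<infinity>"
        by (simp add: integrable_iff_bounded)
      then show False using inf[OF \<open>q \<ge> - 1 / \<alpha>\<close>] by (subst (asm) nn_integral_lebesgue_on) auto
    next
      case True
      define q where "q = - 1 / \<alpha>"
      have q: "q \<ge> 0" using \<alpha> by (simp add: q_def divide_nonpos_neg)
      obtain A where A: "AE z in lebesgue_on (ball 0 1). cmod (f z) \<le> A"
        using f True by (auto simp: Lp_disk_def Lp_space_def)
      have "AE z in lebesgue_on (ball 0 1). ennreal (cmod (f z) powr q) \<le> ennreal (\<bar>A\<bar> powr q)"
        using A
      proof eventually_elim
        fix z assume "cmod (f z) \<le> A"
        then have "cmod (f z) \<le> \<bar>A\<bar>" by simp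
        then show "ennreal (cmod (f z) powr q) \<le> ennreal (\<bar>A\<bar> powr q)"
          using q by (intro ennreal_leI powr_mono2) auto
      qed
      then have "(\<integral>\<^sup>+z. ennreal (cmod (f z) powr q) \<partial>lebesgue_on (ball 0 1)) \<le>
          (\<integral>\<^sup>+z. ennreal (\<bar>A\<bar> powr q) \<partial>lebesgue_on (ball 0 (1::real) :: complex set))"
        by (rule nn_integral_mono_AE)
      also have "\<dots> < \<infinity>"
        by (simp add: emeasure_restrict_space ennreal_mult_less_top emeasure_ball)
      finally show False using inf[of q] by (subst (asm) nn_integral_lebesgue_on) (auto simp: q_def)
    qed
  qed
  show "f \<notin> hardy_space 1"
  proof
    assume f: "f \<in> hardy_space 1"
    then have "hardy_norm 1 f < \<infinity>" by (auto simp: hardy_space_def)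
    then have "\<exists>C>0. hardy_norm 1 f \<le> ereal C" by (rule ereal_bound_of_less_top)
    then obtain C where C: "C > 0" "hardy_norm 1 f \<le> ereal C" by blast
    have le: "c * (1 - r\<^sup>2) powr \<alpha> \<le> C" if r: "0 < r" "r < 1" for r
    proof -
      have int: "integrable (lebesgue_on {0..2*pi}) (\<lambda>\<phi>. cmod (f (of_real r * cis \<phi>)))"
        using f r by (auto simp: hardy_space_def integral_mean_exists_def)
      have "2 * pi * (c * (1 - r\<^sup>2) powr \<alpha>) = (LINT \<phi>|lebesgue_on {0..2*pi}. c * (1 - r\<^sup>2) powr \<alpha>)"
        by (simp add: measure_restrict_space)
      also have "\<dots> \<le> (LINT \<phi>|lebesgue_on {0..2*pi}. cmod (f (of_real r * cis \<phi>)))"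
      proof (rule integral_mono)
        show "integrable (lebesgue_on {0..2*pi}) (\<lambda>\<phi>. c * (1 - r\<^sup>2) powr \<alpha>)"
          by (intro continuous_imp_integrable_real continuous_on_const)
        show "c * (1 - r\<^sup>2) powr \<alpha> \<le> cmod (f (of_real r * cis \<phi>))" for \<phi>
          using lower[of "of_real r * cis \<phi>"] disk_radius_cis[of r \<phi>] r by simp
      qed (rule int)
      finally have "c * (1 - r\<^sup>2) powr \<alpha> \<le> 1 / (2 * pi) * (LINT \<phi>|lebesgue_on {0..2*pi}. cmod (f (of_real r * cis \<phi>)))"
        by (simp add: field_simps)
      also have "\<dots> = integral_mean 1 r f"
        unfolding integral_mean_def by (simp add: integral_nonneg_AE)
      finally have "ereal (c * (1 - r\<^sup>2) powr \<alpha>) \<le> ereal (integral_mean 1 r f)" by simp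
      also have "\<dots> \<le> hardy_norm 1 f"
        unfolding hardy_norm_def using r by (auto intro: SUP_upper)
      finally show ?thesis using C(2) by (metis ereal_less_eq(3) order_trans)
    qed
    \<comment> \<open>At \<open>1 - r\<^sup>2 = t\<close> the lower bound equals \<open>c * y\<close>, which exceeds \<open>C\<close>.\<close>
    define y where "y = max 2 (2 * C / c)"
    define t where "t = y powr (1 / \<alpha>)"
    have y: "y > 1" by (simp add: y_def)
    have "t < y powr 0" unfolding t_def using y \<alpha> by (intro powr_less_mono) auto
    then have t: "0 < t" "t < 1" using y by (auto simp: t_def)
    have "t powr \<alpha> = y" using y \<alpha> by (simp add: t_def powr_powr)
    moreover have "c * (1 - (sqrt (1 - t))\<^sup>2) powr \<alpha> \<le> C" using t by (intro le) auto
    ultimately have "c * y \<le> C" using t by simp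
    moreover have "c * (2 * C / c) \<le> c * y" using c by (intro mult_left_mono) (auto simp: y_def)
    ultimately show False using c C(1) by simp
  qed
qed

theorem theorem2p2:
  fixes \<alpha> :: real and p :: ennreal
  assumes "\<alpha> > -1" and "\<alpha> \<noteq> 0" and "1 \<le> p"
  shows
    "(\<forall>F. absolutely_continuous_on_circle F \<longrightarrow> circle_deriv F \<in> Lp_circle p \<longrightarrow>
        (\<alpha> > 0 \<longrightarrow>
           dzbar (alpha_poisson \<alpha> F) \<in> hardy_space p \<and>
           dz (alpha_poisson \<alpha> F) \<in> hardy_space p \<and>
           hardy_space p \<subseteq> Lp_disk p) \<and>
        (\<alpha> < 0 \<longrightarrow> p < ennreal (- 1 / \<alpha>) \<longrightarrow>
           dz (alpha_poisson \<alpha> F) \<in> Lp_disk p \<and>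
           dzbar (alpha_poisson \<alpha> F) \<in> Lp_disk p)) \<and>
     (\<alpha> < 0 \<longrightarrow> p \<ge> ennreal (- 1 / \<alpha>) \<longrightarrow>
        (\<exists>f. alpha_harmonic \<alpha> f \<and>
             dz f \<notin> Lp_disk p \<and> dzbar f \<notin> Lp_disk p \<and>
             dz f \<notin> hardy_space 1 \<and> dzbar f \<notin> hardy_space 1))"
proof (intro conjI allI impI)
  fix F assume ac: "absolutely_continuous_on_circle F" and F': "circle_deriv F \<in> Lp_circle p"
  have int: "integrable (lebesgue_on {0..2*pi}) (circle_deriv F)"
    using F' assms(3) by (rule Lp_circle_imp_integrable)
  have G: "continuous_on {0..2*pi} (\<lambda>\<theta>. F (cis \<theta>))"
    using ac absolutely_continuous_imp_continuous by (auto simp: absolutely_continuous_on_circle_def)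
  interpret z: kernel_bounded \<alpha> 3 "dz (alpha_poisson \<alpha> F)" "circle_deriv F"
    using assms int continuous_on_alpha_poisson_derivs(1)[OF G] alpha_poisson_derivs_bound(2)[OF _ ac int]
    by unfold_locales auto
  interpret zbar: kernel_bounded \<alpha> 1 "dzbar (alpha_poisson \<alpha> F)" "circle_deriv F"
    using assms int continuous_on_alpha_poisson_derivs(2)[OF G] alpha_poisson_derivs_bound(1)[OF _ ac int]
    by unfold_locales auto
  {
    assume pos: "\<alpha> > 0"
    show "dzbar (alpha_poisson \<alpha> F) \<in> hardy_space p" using pos assms(3) F' by (rule zbar.in_hardy_space)
    show "dz (alpha_poisson \<alpha> F) \<in> hardy_space p" using pos assms(3) F' by (rule z.in_hardy_space)
    show "hardy_space p \<subseteq> Lp_disk p" using assms(3) by (rule hardy_space_subset_Lp_disk)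
  next
    assume neg: "\<alpha> < 0" and p: "p < ennreal (- 1 / \<alpha>)"
    have fin: "p \<noteq> \<infinity>" using p by auto
    have "enn2real p < - 1 / \<alpha>"
      using p fin neg by (metis divide_neg_neg enn2real_nonneg ennreal_enn2real ennreal_less_iff infinity_ennreal_def
        neg_less_0_iff_less top.not_eq_extremum zero_less_one)
    then have a: "enn2real p * min \<alpha> 0 > -1" using neg by (simp add: field_simps)
    show "dz (alpha_poisson \<alpha> F) \<in> Lp_disk p" using assms(3) fin F' a by (rule z.in_Lp_disk)
    show "dzbar (alpha_poisson \<alpha> F) \<in> Lp_disk p" using assms(3) fin F' a by (rule zbar.in_Lp_disk)
  }
next
  assume neg: "\<alpha> < 0" and p: "p \<ge> ennreal (- 1 / \<alpha>)"
  let ?K = "alpha_poisson_kernel \<alpha>"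
  define c where "c = (\<alpha> + 1) * 2 powr (- (\<alpha> + 2))"
  have c: "c > 0" using assms(1) by (simp add: c_def)
  have low: "c * (1 - (cmod z)\<^sup>2) powr \<alpha> \<le> (\<alpha> + 1) * ((1 - (cmod z)\<^sup>2) powr \<alpha> * cmod (1 - z) powr (- (\<alpha> + 2)))"
    if z: "z \<in> ball 0 1" for z
  proof -
    have "cmod (1 - z) \<le> 2" using norm_triangle_ineq4[of 1 z] z by simp
    then have "2 powr (- (\<alpha> + 2)) \<le> cmod (1 - z) powr (- (\<alpha> + 2))"
      using assms(1) disk_pos(6)[OF z] by (intro powr_mono2') auto
    then have "(\<alpha> + 1) * ((1 - (cmod z)\<^sup>2) powr \<alpha> * 2 powr (- (\<alpha> + 2))) \<le>
        (\<alpha> + 1) * ((1 - (cmod z)\<^sup>2) powr \<alpha> * cmod (1 - z) powr (- (\<alpha> + 2)))"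
      using assms(1) by (intro mult_left_mono) auto
    then show ?thesis by (simp add: c_def mult_ac)
  qed
  have dz: "c * (1 - (cmod z)\<^sup>2) powr \<alpha> \<le> cmod (dz ?K z)" if "z \<in> ball 0 1" for z
    unfolding has_wirtinger_imp(3)[OF has_wirtinger_kernel[OF that]]
    using low[OF that] norm_kernel_dz_ge[OF that assms(1) neg] by linarith
  have dzbar: "c * (1 - (cmod z)\<^sup>2) powr \<alpha> \<le> cmod (dzbar ?K z)" if "z \<in> ball 0 1" for z
    unfolding has_wirtinger_imp(4)[OF has_wirtinger_kernel[OF that]] norm_kernel_dzbar[OF that assms(1)]
    using low[OF that] .
  show "\<exists>f. alpha_harmonic \<alpha> f \<and> dz f \<notin> Lp_disk p \<and> dzbar f \<notin> Lp_disk p \<and>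
      dz f \<notin> hardy_space 1 \<and> dzbar f \<notin> hardy_space 1"
    using alpha_harmonic_kernel not_in_spaces_of_lower_bound[OF neg c dz]
      not_in_spaces_of_lower_bound[OF neg c dzbar] p by blast
qed

end
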